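(* Let $(\tau_n)_{n\in\mathcal S'}$ be a sequence of almost periods of the Arithmetic Random Wave such that, for some $\alpha>0$ and $\kappa>0$ and all large $n\in\mathcal S'$, $|\tau_n|\le\exp(\mathcal N_n^{1+\alpha})n^{-1/2}$ and $\sup_{t\in\mathbb T^2}|r_n(t+\tau_n)-r_n(t)|\le e^{-\log(n)^\kappa}$. Let $\Omega$ be an open convex subset of $\mathbb R^2$ with compact closure and $\mathcal C^1$ boundary. Put $$\widetilde{\mathcal Z}_n(\Omega)=\{t\in\Omega:\widetilde T_n(t)=0\},\qquad \widetilde{\mathcal Z}_n'(\Omega)=\{t\in\Omega:\widetilde T_n'(t)=0\},$$ and let $H_1$ be the one-dimensional Hausdorff measure on $\mathbb R^2$, normalised so that any segment of length $1$ has measure $1$. Then, for any continuous function $\varphi:\mathbb R^2\to\mathbb R$ with support in $\Omega$, $$\int_{\widetilde{\mathcal Z}_n(\Omega)}\varphi(t)\,H_1(\mathrm dt)-\int_{\widetilde{\mathcal Z}_n'(\Omega)}\varphi(t)\,H_1(\mathrm dt)\longrightarrow0$$ in distribution as $n\to\infty$, $n\in\mathcal S'$.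
   Context: $\mathbb T^2=\mathbb R^2/\mathbb Z^2$, and for $\tau\in\mathbb T^2$, $|\tau|$ is the Euclidean distance from $\tau$ to $0$ in $\mathbb T^2$. $\mathcal S=\{a^2+b^2:(a,b)\in\mathbb Z^2\}$, $\Lambda_n=\{\lambda\in\mathbb Z^2:\lambda_1^2+\lambda_2^2=n\}$, $\mathcal N_n=\operatorname{card}\Lambda_n$. Arithmetic Random Wave: $T_n(t)=\frac1{\sqrt{\mathcal N_n}}\sum_{\lambda\in\Lambda_n}a_\lambda e^{2i\pi\langle\lambda,t\rangle}$, where the $a_\lambda$ are standard complex Gaussian variables, independent except for the relation $a_{-\lambda}=\overline{a_\lambda}$. It is a centered stationary real Gaussian process with covariance function $r_n(t)=\frac1{\mathcal N_n}\sum_{\lambda\in\Lambda_n}\cos(2\pi\langle\lambda,t\rangle)$. Functions on $\mathbb T^2$ are viewed as $\mathbb Z^2$-periodic functions on $\mathbb R^2$. The translated field is $T_n'(t)=T_n(\tau_n+t)$, and the rescaled fields are $\widetilde T_n(t)=T_n(t/\sqrt n)$ and $\widetilde T_n'(t)=T_n'(t/\sqrt n)$. Standing assumption: $\mathcal S'\subset\mathcal S$ is a fixed subset of relative density $1$ in $\mathcal S$ such that, as $n\to\infty$ in $\mathcal S'$: (a) $\mathcal N_n=\log(n)^{\log(2)/2+o(1)}$, so that for every $0<\kappa'<\log(2)/2$, $\mathcal N_n\ge\log(n)^{\kappa'}$ for $n$ large; (b) the probability measures $\frac1{\mathcal N_n}\sum_{\lambda\in\Lambda_n}\delta_{\lambda/\sqrt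 n}$ converge weakly to the uniform probability measure $\sigma$ on the unit circle $\mathbb S^1$, and for every $\rho<\frac12\log(\pi/2)$ and $n$ large enough, $\sup_{\Gamma}\left|\frac1{\mathcal N_n}\operatorname{card}\{\lambda\in\Lambda_n:\lambda/\sqrt n\in\Gamma\}-\sigma(\Gamma)\right|\le\log(n)^{-\rho}$, the supremum being over arcs $\Gamma\subset\mathbb S^1$. All limits in $n$ are along $n\in\mathcal S'$. A sequence of almost periods of the Arithmetic Random Wave is a sequence $\tau_n\in\mathbb T^2$ such that almost surely $\sup_{t\in\mathbb T^2}|T_n(t+\tau_n)-T_n(t)|\to0$, and $\liminf\sqrt n\,|\tau_n|\ge1$. *)

theory Defs
  imports "HOL-Probability.Probability"
begin

definition sums_of_two_squares :: "nat set" where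
  "sums_of_two_squares = {n. \<exists>a b :: int. int n = a\<^sup>2 + b\<^sup>2}"

definition freqs :: "nat \<Rightarrow> (int ^ 2) set" where
  "freqs n = {l. (l $ 1)\<^sup>2 + (l $ 2)\<^sup>2 = int n}"

definition num_freqs :: "nat \<Rightarrow> nat" where
  "num_freqs n = card (freqs n)"

definition lat :: "int ^ 2 \<Rightarrow> real ^ 2" where
  "lat l = (\<chi> i. real_of_int (l $ i))"

definition along :: "nat set \<Rightarrow> nat filter" where
  "along S' = inf sequentially (principal S')"

definition relative_density_one :: "nat set \<Rightarrow> nat set \<Rightarrow> bool" where
  "relative_density_one S' S \<longleftrightarrow> S' \<subseteq> S \<and>
     (\<lambda>x. real (card (S' \<inter> {..x})) / real (card (S \<inter> {..x}))) \<longlonglongrightarrow> 1"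

definition circle_uniform :: "(real ^ 2) measure" where
  "circle_uniform = distr (uniform_measure lborel {0..<2 * pi}) borel
     (\<lambda>\<theta>. \<chi> i. if i = 1 then cos \<theta> else sin \<theta>)"

text \<open>Arcs are the connected subsets of the circle (open, closed, half-open, degenerate or full).\<close>

definition arcs :: "(real ^ 2) set set" where
  "arcs = {\<Gamma>. \<Gamma> \<subseteq> sphere 0 1 \<and> connected \<Gamma>}"

text \<open>Weak convergence of the empirical measures is written with bounded continuous test functions,
  since the weak convergence of the library is for measures on the real line only.\<close>

definition admissible_energies :: "nat set \<Rightarrow> bool" where
  "admissible_energies S' \<longleftrightarrow>
     relative_density_one S' sums_of_two_squares \<and>
     (\<exists>\<epsilon> :: nat \<Rightarrow> real. (\<epsilon> \<longlongrightarrow> 0) (along S') \<and>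
        (\<forall>\<^sub>F n in along S'. real (num_freqs n) = ln (real n) powr (ln 2 / 2 + \<epsilon> n))) \<and>
     (\<forall>f :: real ^ 2 \<Rightarrow> real. continuous_on UNIV f \<and> bounded (range f) \<longrightarrow>
        ((\<lambda>n. (\<Sum>l\<in>freqs n. f (lat l /\<^sub>R sqrt (real n))) / real (num_freqs n))
           \<longlongrightarrow> (\<integral>x. f x \<partial>circle_uniform)) (along S')) \<and>
     (\<forall>\<rho> :: real. \<rho> < ln (pi / 2) / 2 \<longrightarrow>
        (\<forall>\<^sub>F n in along S'.
           (SUP \<Gamma>\<in>arcs. \<bar>real (card {l \<in> freqs n. lat l /\<^sub>R sqrt (real n) \<in> \<Gamma>}) / real (num_freqs n)
                         - measure circle_uniform \<Gamma>\<bar>)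
             \<le> ln (real n) powr (- \<rho>)))"

text \<open>Normalised by \<open>E |X|\<^sup>2 = 1\<close>: real and imaginary parts are independent centred Gaussians of
  variance 1/2.\<close>

definition standard_complex_gaussian :: "'w measure \<Rightarrow> ('w \<Rightarrow> complex) \<Rightarrow> bool" where
  "standard_complex_gaussian M X \<longleftrightarrow>
     X \<in> borel_measurable M \<and>
     distributed M lborel (\<lambda>w. Re (X w)) (normal_density 0 (sqrt (1 / 2))) \<and>
     distributed M lborel (\<lambda>w. Im (X w)) (normal_density 0 (sqrt (1 / 2))) \<and>
     prob_space.indep_var M borel (\<lambda>w. Re (X w)) borel (\<lambda>w. Im (X w))"

text \<open>Independence apart from the relation \<open>a (-l) = cnj (a l)\<close>: any subfamily without a pair of
  opposite indices is independent. The index 0 is left out, as the relation would force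
  \<open>a 0\<close> to be real; it only occurs in \<open>freqs 0\<close>.\<close>

definition wave_coefficients :: "'w measure \<Rightarrow> (int ^ 2 \<Rightarrow> 'w \<Rightarrow> complex) \<Rightarrow> bool" where
  "wave_coefficients M a \<longleftrightarrow>
     prob_space M \<and>
     (\<forall>l. l \<noteq> 0 \<longrightarrow> standard_complex_gaussian M (a l)) \<and>
     (\<forall>l. l \<noteq> 0 \<longrightarrow> (\<forall>w\<in>space M. a (- l) w = cnj (a l w))) \<and>
     (\<forall>H. 0 \<notin> H \<and> H \<inter> uminus ` H = {} \<longrightarrow> prob_space.indep_vars M (\<lambda>_. borel) a H)"

text \<open>Functions on the torus are periodic functions on the plane. The wave is complex-valued as a
  term; its values are real for \<open>n > 0\<close> because of the conjugation relation.\<close>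

definition wave :: "(int ^ 2 \<Rightarrow> 'w \<Rightarrow> complex) \<Rightarrow> nat \<Rightarrow> 'w \<Rightarrow> real ^ 2 \<Rightarrow> complex" where
  "wave a n w t =
     (\<Sum>l\<in>freqs n. a l w * exp (2 * \<i> * complex_of_real pi * complex_of_real (lat l \<bullet> t)))
       / complex_of_real (sqrt (real (num_freqs n)))"

definition wave_cov :: "nat \<Rightarrow> real ^ 2 \<Rightarrow> real" where
  "wave_cov n t = (\<Sum>l\<in>freqs n. cos (2 * pi * (lat l \<bullet> t))) / real (num_freqs n)"

definition translated_wave ::
    "(int ^ 2 \<Rightarrow> 'w \<Rightarrow> complex) \<Rightarrow> (nat \<Rightarrow> real ^ 2) \<Rightarrow> nat \<Rightarrow> 'w \<Rightarrow> real ^ 2 \<Rightarrow> complex" where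
  "translated_wave a \<tau> n w t = wave a n w (\<tau> n + t)"

definition rescaled_wave :: "(int ^ 2 \<Rightarrow> 'w \<Rightarrow> complex) \<Rightarrow> nat \<Rightarrow> 'w \<Rightarrow> real ^ 2 \<Rightarrow> complex" where
  "rescaled_wave a n w t = wave a n w (t /\<^sub>R sqrt (real n))"

definition rescaled_translated_wave ::
    "(int ^ 2 \<Rightarrow> 'w \<Rightarrow> complex) \<Rightarrow> (nat \<Rightarrow> real ^ 2) \<Rightarrow> nat \<Rightarrow> 'w \<Rightarrow> real ^ 2 \<Rightarrow> complex" where
  "rescaled_translated_wave a \<tau> n w t = translated_wave a \<tau> n w (t /\<^sub>R sqrt (real n))"

text \<open>A point of the torus is given by a representative in the plane; its distance to 0 in the
  torus is the distance of the representative to the lattice.\<close>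

definition torus_norm :: "real ^ 2 \<Rightarrow> real" where
  "torus_norm \<tau> = infdist \<tau> (range lat)"

definition almost_periods ::
    "'w measure \<Rightarrow> (int ^ 2 \<Rightarrow> 'w \<Rightarrow> complex) \<Rightarrow> nat set \<Rightarrow> (nat \<Rightarrow> real ^ 2) \<Rightarrow> bool" where
  "almost_periods M a S' \<tau> \<longleftrightarrow>
     (AE w in M. ((\<lambda>n. SUP t. cmod (wave a n w (t + \<tau> n) - wave a n w t)) \<longlongrightarrow> 0) (along S')) \<and>
     Liminf (along S') (\<lambda>n. ereal (sqrt (real n) * torus_norm (\<tau> n))) \<ge> 1"

definition nodal_set :: "(real ^ 2 \<Rightarrow> complex) \<Rightarrow> (real ^ 2) set \<Rightarrow> (real ^ 2) set" where
  "nodal_set f \<Omega> = {t \<in> \<Omega>. f t = 0}"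

text \<open>One-dimensional Hausdorff measure. No normalising constant is needed: with sums of diameters,
  a segment of length 1 has measure 1. Boundedness of the covering sets is required because
  \<open>diameter\<close> is only meaningful for bounded sets.\<close>

definition hausdorff1_content :: "real \<Rightarrow> (real ^ 2) set \<Rightarrow> ennreal" where
  "hausdorff1_content \<delta> A =
     Inf {(\<Sum>i. ennreal (diameter (U i))) | U :: nat \<Rightarrow> (real ^ 2) set.
            A \<subseteq> (\<Union>i. U i) \<and> (\<forall>i. bounded (U i) \<and> diameter (U i) \<le> \<delta>)}"

definition hausdorff1_outer :: "(real ^ 2) set \<Rightarrow> ennreal" where
  "hausdorff1_outer A = (SUP \<delta>\<in>{0<..}. hausdorff1_content \<delta> A)"

definition H1 :: "(real ^ 2) measure" where
  "H1 = measure_of UNIV (sets borel) hausdorff1_outer"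

definition C1_boundary :: "(real ^ 2) set \<Rightarrow> bool" where
  "C1_boundary \<Omega> \<longleftrightarrow>
     (\<forall>x\<in>frontier \<Omega>. \<exists>U (g :: real ^ 2 \<Rightarrow> real) (G :: real ^ 2 \<Rightarrow> real ^ 2).
        open U \<and> x \<in> U \<and>
        (\<forall>y\<in>U. (g has_derivative (\<lambda>h. G y \<bullet> h)) (at y) \<and> G y \<noteq> 0) \<and>
        continuous_on U G \<and>
        \<Omega> \<inter> U = {y \<in> U. g y < 0} \<and> frontier \<Omega> \<inter> U = {y \<in> U. g y = 0})"

text \<open>\<open>weak_conv_m\<close> is about sequences, so \<open>S'\<close> (infinite where this is used) is enumerated
  increasingly.\<close>

definition tendsto_0_in_distribution ::
    "'w measure \<Rightarrow> nat set \<Rightarrow> (nat \<Rightarrow> 'w \<Rightarrow> real) \<Rightarrow> bool" where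
  "tendsto_0_in_distribution M S' X \<longleftrightarrow>
     weak_conv_m (\<lambda>k. distr M borel (X (enumerate S' k))) (return borel 0)"

end

theory Submission
  imports Defs
begin

text \<open>
The two fields differ by a quantity that tends to 0 uniformly, almost surely, and the nodal integral
is a continuous function of the field as long as the zeros are nondegenerate. The proof makes this
quantitative, with constants that do not depend on the energy \<open>n\<close>: the integrals of the two fields are
compared sample by sample, on an event of probability close to 1.

Geometry. Let \<open>f\<close> and \<open>g\<close> be uniformly close, with gradients bounded and Lipschitz by the same constant,
and let \<open>f\<close> be nondegenerate: where \<open>\<bar>f\<bar> < m\<close>, its gradient has norm at least \<open>m\<close>. By interpolation the
gradients are close too. Moving each zero of \<open>f\<close> along the gradient of \<open>f\<close> to a zero of \<open>g\<close> defines a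
map that nearly preserves distances (\<open>perturbed_zero_map\<close>). The Hausdorff measure behaves well under
such maps, so every piece of the zero set of \<open>f\<close> is at most slightly longer than a corresponding piece
of the zero set of \<open>g\<close>, and conversely. A covering argument bounds the lengths
(\<open>zero_set_length_bounded\<close>), and a layer cake argument passes from lengths to integrals of continuous
functions (\<open>H1_integral_stable\<close>).

Probability. Three events have to be likely, the first two uniformly in \<open>n\<close> and the third for large
\<open>n\<close>. The gradients are bounded and Lipschitz on a fixed disc (\<open>field_tame_probability\<close>): expanding the exponentials into power series in the
coordinates of the point bounds the suprema by series of weighted coefficient sums, which have bounded
second moments by orthogonality. The field is nondegenerate (\<open>field_nondegenerate_probability\<close>): the
lattice points on a circle are invariant under the quarter turn, so at each point the value and the
gradient of the rescaled field are independent Gaussian variables with variances that do not depend on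
\<open>n\<close>; they are of size \<open>\<epsilon>\<close> with a probability of order \<open>\<epsilon>\<^sup>3\<close>, while a grid of only \<open>\<epsilon>\<^sup>-\<^sup>2\<close> points has to be
inspected. The two fields are close (\<open>field_almost_period_probability\<close>), by the definition of almost
periods.

Measurability. The nodal integral must be measurable on the whole sample space, degenerate samples
included, since otherwise its distribution is not a probability measure. It follows from the upper
semicontinuity of Hausdorff contents of compact sets (\<open>outer_of_zero_set_measurable\<close>).
\<close>

section \<open>The one-dimensional Hausdorff measure\<close>

text \<open>Caratheodory's criterion. The part of \<open>X\<close> outside \<open>C\<close> is cut into rings \<open>R k\<close>, in which the
distance to \<open>C\<close> is about \<open>1 / k\<close>. Rings with indices of the same parity are at a positive distance
from one another, so their measures add up to at most \<open>\<mu> X\<close>, the series over all rings converges and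
its tails vanish; what remains after removing a tail is at a positive distance from \<open>C\<close>.\<close>
lemma metric_outer_measure_splits_closed:
  fixes \<mu> :: "'a::metric_space set \<Rightarrow> ennreal"
  assumes mono: "\<And>A B. A \<subseteq> B \<Longrightarrow> \<mu> A \<le> \<mu> B"
    and sub: "\<And>A :: nat \<Rightarrow> 'a set. \<mu> (\<Union>i. A i) \<le> (\<Sum>i. \<mu> (A i))"
    and sub2: "\<And>A B. \<mu> (A \<union> B) \<le> \<mu> A + \<mu> B"
    and emp: "\<mu> {} = 0"
    and sep: "\<And>A B d. d > 0 \<Longrightarrow> (\<And>x y. x \<in> A \<Longrightarrow> y \<in> B \<Longrightarrow> d \<le> dist x y) \<Longrightarrow>
                \<mu> A + \<mu> B \<le> \<mu> (A \<union> B)"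
    and "closed C"
  shows "\<mu> (X \<inter> C) + \<mu> (X - C) \<le> \<mu> X"
proof (cases "C = {} \<or> \<mu> X = \<infinity>")
  case True
  then show ?thesis by (auto simp: emp)
next
  case False
  then have ne: "C \<noteq> {}" and fin: "\<mu> X < top" by (auto simp: less_top)
  define g where "g x = infdist x C" for x
  have gpos: "g x > 0" if "x \<notin> C" for x
    unfolding g_def using that ne \<open>closed C\<close>
    by (metis in_closed_iff_infdist_zero infdist_nonneg less_eq_real_def)
  have glip: "g x \<le> g y + dist x y" for x y
    unfolding g_def by (rule infdist_triangle)
  have gC: "g x \<le> dist x y" if "y \<in> C" for x y
    unfolding g_def using that by (rule infdist_le)
  define D where "D n = {x \<in> X - C. 1 / real (n + 1) \<le> g x}" for n :: nat
  define R where "R n = {x \<in> X - C. 1 / real (n + 2) \<le> g x \<and> g x < 1 / real (n + 1)}" for n :: nat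
  \<comment> \<open>Superadditivity along the rings of one parity: consecutive ones are separated by a full ring.\<close>
  have alt: "(\<Sum>k<m. \<mu> (R (2 * k + i))) \<le> \<mu> (\<Union>k<m. R (2 * k + i))" for m i
  proof (induction m)
    case 0
    then show ?case by simp
  next
    case (Suc m)
    have "\<mu> (\<Union>k<m. R (2 * k + i)) + \<mu> (R (2 * m + i)) \<le> \<mu> ((\<Union>k<m. R (2 * k + i)) \<union> R (2 * m + i))"
    proof (cases "m = 0")
      case True
      then show ?thesis by (simp add: emp)
    next
      case False
      let ?d = "1 / real (2 * m + i) - 1 / real (2 * m + i + 1)"
      show ?thesis
      proof (rule sep)
        show "0 < ?d" using False by (simp add: frac_less2)
        fix x y assume "x \<in> (\<Union>k<m. R (2 * k + i))" and y: "y \<in> R (2 * m + i)"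
        then obtain k where k: "k < m" "x \<in> R (2 * k + i)" by auto
        have "1 / real (2 * m + i) \<le> 1 / real (2 * k + i + 2)"
          using k(1) by (intro frac_le) auto
        also have "\<dots> \<le> g x" using k(2) by (auto simp: R_def)
        finally have "1 / real (2 * m + i) \<le> g x" .
        moreover have "g y < 1 / real (2 * m + i + 1)" using y by (auto simp: R_def)
        ultimately show "?d \<le> dist x y" using glip[of x y] by linarith
      qed
    qed
    with Suc have "(\<Sum>k<m. \<mu> (R (2 * k + i))) + \<mu> (R (2 * m + i)) \<le> \<mu> ((\<Union>k<m. R (2 * k + i)) \<union> R (2 * m + i))"
      by (meson add_right_mono order_trans)
    moreover have "(\<Union>k<Suc m. R (2 * k + i)) = (\<Union>k<m. R (2 * k + i)) \<union> R (2 * m + i)"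
      by (auto simp: lessThan_Suc)
    ultimately show ?case by (simp only: sum.lessThan_Suc)
  qed
  have altX: "(\<Sum>k<m. \<mu> (R (2 * k + i))) \<le> \<mu> X" for m i
  proof -
    have "(\<Union>k<m. R (2 * k + i)) \<subseteq> X" by (auto simp: R_def)
    from mono[OF this] alt[where m = m and i = i] show ?thesis by (rule order_trans[rotated])
  qed
  have split: "(\<Sum>k<2 * m. \<mu> (R k)) = (\<Sum>k<m. \<mu> (R (2 * k + 0))) + (\<Sum>k<m. \<mu> (R (2 * k + 1)))" for m
    by (induction m) (auto simp: algebra_simps)
  define S where "S = (\<Sum>k. \<mu> (R k))"
  have "S \<le> \<mu> X + \<mu> X"
    unfolding S_def
  proof (rule suminf_le_const[OF summableI])
    fix n
    have "(\<Sum>k<n. \<mu> (R k)) \<le> (\<Sum>k<2 * n. \<mu> (R k))"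
      by (intro sum_mono2) auto
    also have "\<dots> \<le> \<mu> X + \<mu> X"
      unfolding split by (intro add_mono altX)
    finally show "(\<Sum>k<n. \<mu> (R k)) \<le> \<mu> X + \<mu> X" .
  qed
  then have Sfin: "S < top" using fin by (auto simp: less_top[symmetric] top_unique)
  \<comment> \<open>Stated as a sum, because subtraction in \<open>ennreal\<close> would need finiteness everywhere.\<close>
  have tail: "(\<Sum>k. \<mu> (R (k + n))) + (\<Sum>k<n. \<mu> (R k)) \<le> S" for n
  proof (rule ennreal_suminf_bound_add)
    fix N
    have "(\<Sum>k<N. \<mu> (R (k + n))) + (\<Sum>k<n. \<mu> (R k)) = (\<Sum>k<N + n. \<mu> (R k))"
      by (induction N) (auto simp: algebra_simps)
    also have "\<dots> \<le> S" unfolding S_def by (rule sum_le_suminf) (auto intro: summableI)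
    finally show "(\<Sum>k<N. \<mu> (R (k + n))) + (\<Sum>k<n. \<mu> (R k)) \<le> S" .
  qed
  have cover: "X - C \<subseteq> D n \<union> (\<Union>k. R (k + n))" for n
  proof
    fix x assume x: "x \<in> X - C"
    then have gx: "g x > 0" using gpos by auto
    show "x \<in> D n \<union> (\<Union>k. R (k + n))"
    proof (cases "1 / real (n + 1) \<le> g x")
      case True
      then show ?thesis using x by (auto simp: D_def)
    next
      case False
      let ?P = "\<lambda>m. 1 / real (m + 1) \<le> g x"
      \<comment> \<open>The ring of a point is the one of the least index whose inner radius it reaches.\<close>
      obtain m where "1 / real (Suc m) < g x" using gx nat_approx_posE by blast
      then have Pm: "?P m" by simp
      define l where "l = (LEAST m. ?P m)"
      have Pl: "?P l" unfolding l_def using Pm by (rule LeastI)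
      have "l > n"
      proof (rule ccontr)
        assume "\<not> l > n"
        then have "1 / real (n + 1) \<le> 1 / real (l + 1)" by (intro divide_left_mono) auto
        with Pl False show False by linarith
      qed
      then obtain k where k: "l = Suc (k + n)" by (metis add.commute less_imp_Suc_add)
      have "\<not> ?P (k + n)" using not_less_Least[of "k + n" ?P] k unfolding l_def by auto
      then have "x \<in> R (k + n)" using Pl k x by (auto simp: R_def algebra_simps)
      then show ?thesis by auto
    qed
  qed
  have "(\<Sum>k. \<mu> (R k)) + (\<mu> (X \<inter> C) + \<mu> (X - C)) \<le> \<mu> X + S"
  proof (rule ennreal_suminf_bound_add)
    fix n
    have "\<mu> (X - C) \<le> \<mu> (D n) + \<mu> (\<Union>k. R (k + n))"
      using mono[OF cover] sub2 order_trans by blast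
    also have "\<dots> \<le> \<mu> (D n) + (\<Sum>k. \<mu> (R (k + n)))"
      by (intro add_left_mono sub)
    finally have 1: "\<mu> (X - C) \<le> \<mu> (D n) + (\<Sum>k. \<mu> (R (k + n)))" .
    have "\<mu> (X \<inter> C) + \<mu> (D n) \<le> \<mu> ((X \<inter> C) \<union> D n)"
    proof (rule sep)
      show "0 < 1 / real (n + 1)" by simp
      fix x y assume "x \<in> X \<inter> C" "y \<in> D n"
      then show "1 / real (n + 1) \<le> dist x y" using gC[of x y] by (auto simp: D_def dist_commute)
    qed
    also have "\<dots> \<le> \<mu> X" by (intro mono) (auto simp: D_def)
    finally have 2: "\<mu> (X \<inter> C) + \<mu> (D n) \<le> \<mu> X" .
    have "(\<Sum>k<n. \<mu> (R k)) + (\<mu> (X \<inter> C) + \<mu> (X - C))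
        \<le> (\<Sum>k<n. \<mu> (R k)) + (\<mu> (X \<inter> C) + (\<mu> (D n) + (\<Sum>k. \<mu> (R (k + n)))))"
      by (intro add_left_mono 1)
    also have "\<dots> = (\<mu> (X \<inter> C) + \<mu> (D n)) + ((\<Sum>k. \<mu> (R (k + n))) + (\<Sum>k<n. \<mu> (R k)))"
      by (simp add: ac_simps)
    also have "\<dots> \<le> \<mu> X + S" by (intro add_mono 2 tail)
    finally show "(\<Sum>k<n. \<mu> (R k)) + (\<mu> (X \<inter> C) + \<mu> (X - C)) \<le> \<mu> X + S" .
  qed
  then have "S + (\<mu> (X \<inter> C) + \<mu> (X - C)) \<le> S + \<mu> X" by (simp add: S_def add.commute)
  then show ?thesis using Sfin by (auto simp: ennreal_add_left_cancel_le)
qed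


lemma content_le:
  assumes "A \<subseteq> (\<Union>i. U i)" "\<And>i :: nat. bounded (U i)" "\<And>i. diameter (U i) \<le> \<delta>"
  shows "hausdorff1_content \<delta> A \<le> (\<Sum>i. ennreal (diameter (U i)))"
  unfolding hausdorff1_content_def using assms by (intro Inf_lower) blast

lemma content_less_cover:
  assumes "hausdorff1_content \<delta> A < t"
  obtains U :: "nat \<Rightarrow> (real ^ 2) set" where "A \<subseteq> (\<Union>i. U i)" "\<And>i. bounded (U i)"
    "\<And>i. diameter (U i) \<le> \<delta>" "(\<Sum>i. ennreal (diameter (U i))) < t"
  using assms unfolding hausdorff1_content_def Inf_less_iff by blast

lemma le_content:
  assumes "\<And>U :: nat \<Rightarrow> (real ^ 2) set. A \<subseteq> (\<Union>i. U i) \<Longrightarrow> (\<And>i. bounded (U i)) \<Longrightarrow>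
    (\<And>i. diameter (U i) \<le> \<delta>) \<Longrightarrow> t \<le> (\<Sum>i. ennreal (diameter (U i)))"
  shows "t \<le> hausdorff1_content \<delta> A"
  unfolding hausdorff1_content_def by (rule Inf_greatest) (use assms in blast)

lemma content_mono: "A \<subseteq> B \<Longrightarrow> hausdorff1_content \<delta> A \<le> hausdorff1_content \<delta> B"
  by (rule le_content) (blast intro: content_le)

lemma content_antimono: "\<delta> \<le> \<delta>' \<Longrightarrow> hausdorff1_content \<delta>' A \<le> hausdorff1_content \<delta> A"
  by (rule le_content, rule content_le) (auto intro: order_trans)

lemma content_le_outer: "\<delta> > 0 \<Longrightarrow> hausdorff1_content \<delta> A \<le> hausdorff1_outer A"
  unfolding hausdorff1_outer_def by (rule SUP_upper) auto

lemma outer_le: "(\<And>\<delta>. \<delta> > 0 \<Longrightarrow> hausdorff1_content \<delta> A \<le> t) \<Longrightarrow> hausdorff1_outer A \<le> t"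
  unfolding hausdorff1_outer_def by (rule SUP_least) auto

lemma outer_mono: "A \<subseteq> B \<Longrightarrow> hausdorff1_outer A \<le> hausdorff1_outer B"
  by (rule outer_le) (meson content_mono content_le_outer order_trans)

lemma content_empty: "\<delta> \<ge> 0 \<Longrightarrow> hausdorff1_content \<delta> {} = 0"
  using content_le[of "{}" "\<lambda>_. {}" \<delta>] by simp

lemma outer_empty [simp]: "hausdorff1_outer {} = 0"
  using outer_le[of "{}" 0] by (simp add: content_empty)

lemma content_countably_subadditive:
  fixes A :: "nat \<Rightarrow> (real ^ 2) set"
  shows "hausdorff1_content \<delta> (\<Union>i. A i) \<le> (\<Sum>i. hausdorff1_content \<delta> (A i))"
proof (rule ennreal_le_epsilon)
  fix e :: real assume fin: "(\<Sum>i. hausdorff1_content \<delta> (A i)) < top" and e: "0 < e"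
  have "\<exists>U :: nat \<Rightarrow> (real ^ 2) set. A i \<subseteq> (\<Union>j. U j) \<and> (\<forall>j. bounded (U j)) \<and> (\<forall>j. diameter (U j) \<le> \<delta>) \<and>
     (\<Sum>j. ennreal (diameter (U j))) < hausdorff1_content \<delta> (A i) + ennreal (e * (1 / 2) ^ Suc i)" for i
  proof -
    have "hausdorff1_content \<delta> (A i) < top"
      using fin ennreal_suminf_lessD by blast
    then have "hausdorff1_content \<delta> (A i) < hausdorff1_content \<delta> (A i) + ennreal (e * (1 / 2) ^ Suc i)"
      using e ennreal_add_left_cancel_less[of "hausdorff1_content \<delta> (A i)" 0 "ennreal (e * (1 / 2) ^ Suc i)"]
      by (auto simp: less_top)
    then show ?thesis by (rule content_less_cover) blast
  qed
  then obtain U :: "nat \<Rightarrow> nat \<Rightarrow> (real ^ 2) set" where U: "\<And>i. A i \<subseteq> (\<Union>j. U i j)" "\<And>i j. bounded (U i j)"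
    "\<And>i j. diameter (U i j) \<le> \<delta>"
    "\<And>i. (\<Sum>j. ennreal (diameter (U i j))) < hausdorff1_content \<delta> (A i) + ennreal (e * (1 / 2) ^ Suc i)"
    by metis
  define V where "V n = (case prod_decode n of (i, j) \<Rightarrow> U i j)" for n
  have "hausdorff1_content \<delta> (\<Union>i. A i) \<le> (\<Sum>n. ennreal (diameter (V n)))"
  proof (rule content_le)
    show "(\<Union>i. A i) \<subseteq> (\<Union>n. V n)"
    proof
      fix x assume "x \<in> (\<Union>i. A i)"
      then obtain i j where "x \<in> U i j" using U(1) by blast
      then have "x \<in> V (prod_encode (i, j))" by (simp add: V_def)
      then show "x \<in> (\<Union>n. V n)" by blast
    qed
  qed (auto simp: V_def U(2,3) split: prod.splits)
  also have "(\<Sum>n. ennreal (diameter (V n))) = (\<Sum>i. \<Sum>j. ennreal (diameter (U i j)))"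
    using suminf_ennreal_2dimen[of "\<lambda>i. \<Sum>j. ennreal (diameter (U i j))" "\<lambda>(i, j). ennreal (diameter (U i j))"]
    by (simp add: V_def comp_def case_prod_beta')
  also have "\<dots> \<le> (\<Sum>i. hausdorff1_content \<delta> (A i) + ennreal (e * (1 / 2) ^ Suc i))"
    by (intro suminf_le less_imp_le U(4) summableI)
  also have "\<dots> = (\<Sum>i. hausdorff1_content \<delta> (A i)) + (\<Sum>i. ennreal (e * (1 / 2) ^ Suc i))"
    by (rule suminf_add[symmetric]) auto
  also have "(\<Sum>i. ennreal (e * (1 / 2) ^ Suc i)) = ennreal e"
    using sums_mult[OF power_half_series, of e] e
    by (subst suminf_ennreal2) (auto simp: sums_iff)
  finally show "hausdorff1_content \<delta> (\<Union>i. A i) \<le> (\<Sum>i. hausdorff1_content \<delta> (A i)) + ennreal e" .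
qed

lemma outer_countably_subadditive:
  fixes A :: "nat \<Rightarrow> (real ^ 2) set"
  shows "hausdorff1_outer (\<Union>i. A i) \<le> (\<Sum>i. hausdorff1_outer (A i))"
proof (rule outer_le)
  fix \<delta> :: real assume "\<delta> > 0"
  have "hausdorff1_content \<delta> (\<Union>i. A i) \<le> (\<Sum>i. hausdorff1_content \<delta> (A i))"
    by (rule content_countably_subadditive)
  also have "\<dots> \<le> (\<Sum>i. hausdorff1_outer (A i))"
    by (intro suminf_le content_le_outer \<open>\<delta> > 0\<close> summableI)
  finally show "hausdorff1_content \<delta> (\<Union>i. A i) \<le> (\<Sum>i. hausdorff1_outer (A i))" .
qed

lemma outer_UN_finite_le:
  assumes "finite I"
  shows "hausdorff1_outer (\<Union>i\<in>I. A i) \<le> (\<Sum>i\<in>I. hausdorff1_outer (A i))"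
  using assms
proof (induction I)
  case (insert x F)
  have "hausdorff1_outer (A x \<union> (\<Union>i\<in>F. A i)) \<le> hausdorff1_outer (A x) + hausdorff1_outer (\<Union>i\<in>F. A i)"
  proof -
    let ?B = "\<lambda>i::nat. if i = 0 then A x else if i = 1 then (\<Union>i\<in>F. A i) else {}"
    have "(\<Union>i. ?B i) = A x \<union> (\<Union>i\<in>F. A i)" by (force split: if_splits)
    moreover have "(\<Sum>i. hausdorff1_outer (?B i)) = (\<Sum>i\<in>{0,1}. hausdorff1_outer (?B i))"
      by (rule suminf_finite) auto
    ultimately show ?thesis using outer_countably_subadditive[of ?B] by simp
  qed
  then show ?case using insert by (simp add: add_left_mono order_trans)
qed simp

lemma outer_Un_le: "hausdorff1_outer (A \<union> B) \<le> hausdorff1_outer A + hausdorff1_outer B"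
  using outer_UN_finite_le[of "{True, False}" "\<lambda>b. if b then A else B"] by (simp add: Un_commute)

text \<open>A covering set of diameter less than \<open>d\<close> cannot meet both sets, so every fine cover of the union
splits into a cover of \<open>A\<close> and a cover of \<open>B\<close>.\<close>
lemma outer_separated:
  assumes d: "d > 0" and AB: "\<And>x y. x \<in> A \<Longrightarrow> y \<in> B \<Longrightarrow> d \<le> dist x y"
  shows "hausdorff1_outer A + hausdorff1_outer B \<le> hausdorff1_outer (A \<union> B)"
proof -
  have small: "hausdorff1_content \<delta> A + hausdorff1_content \<delta> B \<le> hausdorff1_content \<delta> (A \<union> B)"
    if \<delta>: "0 < \<delta>" "\<delta> < d" for \<delta>
  proof (rule le_content)
    fix U :: "nat \<Rightarrow> (real ^ 2) set"
    assume U: "A \<union> B \<subseteq> (\<Union>i. U i)" "\<And>i. bounded (U i)" "\<And>i. diameter (U i) \<le> \<delta>"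
    define V where "V i = (if U i \<inter> A = {} then {} else U i)" for i
    define W where "W i = (if U i \<inter> B = {} then {} else U i)" for i
    have disj: "U i \<inter> A = {} \<or> U i \<inter> B = {}" for i
    proof (rule ccontr)
      assume "\<not> (U i \<inter> A = {} \<or> U i \<inter> B = {})"
      then obtain x y where xy: "x \<in> U i" "x \<in> A" "y \<in> U i" "y \<in> B" by blast
      then have "dist x y \<le> \<delta>" using diameter_bounded_bound[OF U(2) xy(1,3)] U(3)[of i] by linarith
      then show False using AB[OF xy(2,4)] \<delta> by linarith
    qed
    have "hausdorff1_content \<delta> A \<le> (\<Sum>i. ennreal (diameter (V i)))"
    proof (rule content_le)
      show "A \<subseteq> (\<Union>i. V i)" using U(1) unfolding V_def by (auto split: if_splits) blast
    qed (use U \<delta> in \<open>auto simp: V_def\<close>)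
    moreover have "hausdorff1_content \<delta> B \<le> (\<Sum>i. ennreal (diameter (W i)))"
    proof (rule content_le)
      show "B \<subseteq> (\<Union>i. W i)" using U(1) unfolding W_def by (auto split: if_splits) blast
    qed (use U \<delta> in \<open>auto simp: W_def\<close>)
    ultimately have "hausdorff1_content \<delta> A + hausdorff1_content \<delta> B
        \<le> (\<Sum>i. ennreal (diameter (V i))) + (\<Sum>i. ennreal (diameter (W i)))"
      by (rule add_mono)
    also have "\<dots> = (\<Sum>i. ennreal (diameter (V i)) + ennreal (diameter (W i)))"
      by (rule suminf_add) auto
    also have "\<dots> \<le> (\<Sum>i. ennreal (diameter (U i)))"
      using disj by (intro suminf_le summableI) (auto simp: V_def W_def)
    finally show "hausdorff1_content \<delta> A + hausdorff1_content \<delta> B \<le> (\<Sum>i. ennreal (diameter (U i)))" .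
  qed
  have A: "hausdorff1_outer A + hausdorff1_content \<delta>' B \<le> hausdorff1_outer (A \<union> B)" if "\<delta>' > 0" for \<delta>'
  proof -
    have "hausdorff1_content \<delta> A + hausdorff1_content \<delta>' B \<le> hausdorff1_outer (A \<union> B)" if "\<delta> > 0" for \<delta>
    proof -
      define m where "m = min (min \<delta> \<delta>') (d / 2)"
      have m: "0 < m" "m < d" "m \<le> \<delta>" "m \<le> \<delta>'" using d that \<open>\<delta>' > 0\<close> by (auto simp: m_def)
      have "hausdorff1_content \<delta> A + hausdorff1_content \<delta>' B \<le> hausdorff1_content m A + hausdorff1_content m B"
        by (intro add_mono content_antimono m)
      also have "\<dots> \<le> hausdorff1_content m (A \<union> B)" by (intro small m)
      also have "\<dots> \<le> hausdorff1_outer (A \<union> B)" by (intro content_le_outer m)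
      finally show ?thesis .
    qed
    then have "(SUP \<delta>\<in>{0<..}. hausdorff1_content \<delta> A + hausdorff1_content \<delta>' B) \<le> hausdorff1_outer (A \<union> B)"
      by (intro SUP_least) auto
    then show ?thesis
      unfolding hausdorff1_outer_def[of A] by (subst ennreal_SUP_add_left[symmetric]) auto
  qed
  then have "(SUP \<delta>'\<in>{0<..}. hausdorff1_outer A + hausdorff1_content \<delta>' B) \<le> hausdorff1_outer (A \<union> B)"
    by (intro SUP_least) auto
  then have "(SUP \<delta>'\<in>{0<..}. hausdorff1_content \<delta>' B + hausdorff1_outer A) \<le> hausdorff1_outer (A \<union> B)"
    by (simp add: add.commute)
  then have "(SUP \<delta>'\<in>{0<..}. hausdorff1_content \<delta>' B) + hausdorff1_outer A \<le> hausdorff1_outer (A \<union> B)"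
    by (subst ennreal_SUP_add_left[symmetric]) auto
  then show ?thesis
    unfolding hausdorff1_outer_def[of B] by (simp add: add.commute)
qed

text \<open>Without this fact the measure built from the outer measure would be the zero measure. Closed sets
belong to the Caratheodory system, and they generate the Borel sets.\<close>
lemma measure_space_hausdorff1: "measure_space UNIV (sets borel) hausdorff1_outer"
proof -
  let ?L = "lambda_system UNIV UNIV hausdorff1_outer"
  have sa: "sigma_algebra (UNIV :: (real ^ 2) set) UNIV"
    using sigma_algebra_Pow[of "UNIV :: (real ^ 2) set"] by simp
  interpret sigma_algebra "UNIV :: (real ^ 2) set" UNIV by (rule sa)
  have "outer_measure_space UNIV hausdorff1_outer"
    unfolding outer_measure_space_def positive_def increasing_def countably_subadditive_def
    using outer_mono outer_countably_subadditive by auto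
  then have L: "measure_space UNIV ?L hausdorff1_outer"
    by (rule caratheodory_lemma)
  have "C \<in> ?L" if "closed C" for C
  proof -
    have "hausdorff1_outer (X \<inter> C) + hausdorff1_outer (X - C) = hausdorff1_outer X" for X
    proof (rule antisym)
      show "hausdorff1_outer (X \<inter> C) + hausdorff1_outer (X - C) \<le> hausdorff1_outer X"
        by (rule metric_outer_measure_splits_closed[where \<mu> = hausdorff1_outer, OF outer_mono outer_countably_subadditive
              outer_Un_le outer_empty outer_separated that])
      have "hausdorff1_outer X = hausdorff1_outer ((X \<inter> C) \<union> (X - C))"
        by (intro arg_cong[where f = hausdorff1_outer]) auto
      also have "\<dots> \<le> hausdorff1_outer (X \<inter> C) + hausdorff1_outer (X - C)" by (rule outer_Un_le)
      finally show "hausdorff1_outer X \<le> hausdorff1_outer (X \<inter> C) + hausdorff1_outer (X - C)" .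
    qed
    then show ?thesis by (simp add: lambda_system_eq)
  qed
  then have cl: "Collect closed \<subseteq> ?L" by (intro subsetI) (simp only: mem_Collect_eq)
  have saL: "sigma_algebra UNIV ?L" using L by (simp add: measure_space_def)
  have "sets borel = sigma_sets UNIV (Collect closed :: (real ^ 2) set set)"
    unfolding borel_eq_closed by (rule sets_measure_of) simp
  then have "sets borel \<subseteq> ?L"
    using sigma_algebra.sigma_sets_subset[OF saL cl] by (simp only:)
  moreover have "sigma_algebra (UNIV :: (real ^ 2) set) (sets borel)"
    using sets.sigma_algebra_axioms[of "borel :: (real ^ 2) measure"] by (simp only: space_borel)
  ultimately show ?thesis
    by (intro measure_down[OF L])
qed

lemma space_H1 [simp]: "space H1 = UNIV"
  by (simp add: H1_def)

lemma sets_H1 [simp, measurable_cong]: "sets H1 = sets borel"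
  unfolding H1_def by (metis sets.sets_measure_of_eq space_borel)

lemma emeasure_H1: "A \<in> sets borel \<Longrightarrow> emeasure H1 A = hausdorff1_outer A"
  unfolding H1_def
  by (rule emeasure_measure_of_sigma)
     (use measure_space_hausdorff1 in \<open>auto simp: measure_space_def\<close>)

lemma bounded_if_dist_le:
  assumes "\<And>p q. p \<in> S \<Longrightarrow> q \<in> S \<Longrightarrow> dist p q \<le> e"
  shows "bounded S"
proof (cases "S = {}")
  case False
  then obtain p where "p \<in> S" by blast
  then show ?thesis using assms unfolding bounded_def by blast
qed simp

text \<open>A map that contracts distances by at most the factor \<open>L\<close> has an inverse with Lipschitz constant \<open>L\<close>,
along which covers of the image can be pulled back. This is how lengths of zero sets get compared.\<close>
lemma outer_le_expanding_image:
  assumes L: "L > 0" and exp: "\<And>p q. p \<in> A \<Longrightarrow> q \<in> A \<Longrightarrow> dist p q \<le> L * dist (\<Phi> p) (\<Phi> q)"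
  shows "hausdorff1_outer A \<le> ennreal L * hausdorff1_outer (\<Phi> ` A)"
proof (rule outer_le)
  fix \<delta> :: real assume "\<delta> > 0"
  have "hausdorff1_content \<delta> A / ennreal L \<le> hausdorff1_content (\<delta> / L) (\<Phi> ` A)"
  proof (rule le_content)
    fix U :: "nat \<Rightarrow> (real ^ 2) set"
    assume U: "\<Phi> ` A \<subseteq> (\<Union>i. U i)" "\<And>i. bounded (U i)" "\<And>i. diameter (U i) \<le> \<delta> / L"
    define V where "V i = {p \<in> A. \<Phi> p \<in> U i}" for i
    have dist: "dist p q \<le> L * diameter (U i)" if "p \<in> V i" "q \<in> V i" for p q i
    proof -
      have "dist (\<Phi> p) (\<Phi> q) \<le> diameter (U i)"
        using that by (intro diameter_bounded_bound U) (auto simp: V_def)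
      then have "L * dist (\<Phi> p) (\<Phi> q) \<le> L * diameter (U i)" using L by (intro mult_left_mono) auto
      then show ?thesis using exp[of p q] that by (auto simp: V_def)
    qed
    have diam: "diameter (V i) \<le> L * diameter (U i)" for i
      using dist L U(2) by (intro diameter_le) (auto simp: dist_norm diameter_ge_0)
    have "bounded (V i)" for i
      using dist by (rule bounded_if_dist_le)
    moreover have "diameter (V i) \<le> \<delta>" for i
    proof -
      have "L * diameter (U i) \<le> \<delta>" using U(3)[of i] L by (simp add: field_simps)
      then show ?thesis using diam[of i] by linarith
    qed
    moreover have "A \<subseteq> (\<Union>i. V i)" using U(1) by (auto simp: V_def)
    ultimately have "hausdorff1_content \<delta> A \<le> (\<Sum>i. ennreal (diameter (V i)))"
      by (intro content_le) auto
    also have "\<dots> \<le> (\<Sum>i. ennreal L * ennreal (diameter (U i)))"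
      using diam L by (intro suminf_le summableI) (auto simp: ennreal_mult'[symmetric] intro: ennreal_leI)
    also have "\<dots> = ennreal L * (\<Sum>i. ennreal (diameter (U i)))" by simp
    finally show "hausdorff1_content \<delta> A / ennreal L \<le> (\<Sum>i. ennreal (diameter (U i)))"
      using L by (simp add: divide_le_posI_ennreal mult.commute)
  qed
  also have "\<dots> \<le> hausdorff1_outer (\<Phi> ` A)"
    using \<open>\<delta> > 0\<close> L by (intro content_le_outer) auto
  finally have "hausdorff1_content \<delta> A / ennreal L * ennreal L \<le> hausdorff1_outer (\<Phi> ` A) * ennreal L"
    by (rule mult_right_mono) simp
  moreover have "hausdorff1_content \<delta> A / ennreal L * ennreal L = hausdorff1_content \<delta> A"
    using L by (simp add: ennreal_divide_times ennreal_mult_divide_eq)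
  ultimately show "hausdorff1_content \<delta> A \<le> ennreal L * hausdorff1_outer (\<Phi> ` A)"
    by (simp add: mult.commute)
qed

text \<open>A set on which some real function \<open>h\<close> satisfies such an inequality is a Lipschitz graph over an
interval, and its length is at most \<open>L\<close> times the length of the interval.\<close>
lemma outer_le_of_expanding_height:
  fixes h :: "real ^ 2 \<Rightarrow> real"
  assumes L: "L > 0" and exp: "\<And>p q. p \<in> A \<Longrightarrow> q \<in> A \<Longrightarrow> dist p q \<le> L * \<bar>h p - h q\<bar>"
    and ab: "\<And>p. p \<in> A \<Longrightarrow> a \<le> h p \<and> h p \<le> b" and "a \<le> b"
  shows "hausdorff1_outer A \<le> ennreal (L * (b - a))"
proof (rule outer_le)
  fix \<delta> :: real assume "\<delta> > 0"
  obtain k :: nat where k: "L * (b - a) / \<delta> < real k" using reals_Archimedean2 by blast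
  have "L * (b - a) / \<delta> \<ge> 0" using L \<open>a \<le> b\<close> \<open>\<delta> > 0\<close> by simp
  with k have kpos: "k > 0" by linarith
  define d where "d = (b - a) / real k"
  have d0: "d \<ge> 0" using \<open>a \<le> b\<close> by (simp add: d_def)
  have Ld: "L * d \<le> \<delta>" using k kpos \<open>\<delta> > 0\<close> by (simp add: d_def field_simps)
  define U where "U i = (if i < k then {p \<in> A. a + real i * d \<le> h p \<and> h p \<le> a + real (Suc i) * d} else {})" for i
  have dist: "dist p q \<le> L * d" if "p \<in> U i" "q \<in> U i" for p q i
  proof -
    have "\<bar>h p - h q\<bar> \<le> d" using that by (auto simp: U_def algebra_simps abs_le_iff split: if_splits)
    then have "L * \<bar>h p - h q\<bar> \<le> L * d" using L by (intro mult_left_mono) auto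
    then show ?thesis using exp[of p q] that by (auto simp: U_def split: if_splits)
  qed
  have diam: "diameter (U i) \<le> L * d" for i
    using dist L d0 by (intro diameter_le) (auto simp: dist_norm)
  have bdd: "bounded (U i)" for i
    using dist by (rule bounded_if_dist_le)
  have "hausdorff1_content \<delta> A \<le> (\<Sum>i. ennreal (diameter (U i)))"
  proof (rule content_le)
    show "A \<subseteq> (\<Union>i. U i)"
    proof
      fix p assume p: "p \<in> A"
      show "p \<in> (\<Union>i. U i)"
      proof (cases "d = 0")
        case True
        then have "b = a" using kpos by (simp add: d_def)
        then have "p \<in> U 0" using ab[OF p] p kpos by (auto simp: U_def True)
        then show ?thesis by blast
      next
        case False
        then have dp: "d > 0" using d0 by simp
        define x where "x = (h p - a) / d"
        have x0: "x \<ge> 0" using ab[OF p] dp by (simp add: x_def)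
        have hx: "h p = a + x * d" using dp by (simp add: x_def)
        have "h p \<le> a + real k * d" using ab[OF p] kpos by (simp add: d_def)
        then have xk: "x \<le> real k" using hx dp by simp
        define i where "i = (if x = real k then k - 1 else nat \<lfloor>x\<rfloor>)"
        have "i < k \<and> real i \<le> x \<and> x \<le> real (Suc i)"
          using xk x0 kpos unfolding i_def by (auto simp: of_nat_diff) linarith+
        then have "p \<in> U i" using p hx dp by (simp add: U_def mult_right_mono)
        then show ?thesis by blast
      qed
    qed
    show "diameter (U i) \<le> \<delta>" for i using diam[of i] Ld by linarith
  qed (rule bdd)
  also have "(\<Sum>i. ennreal (diameter (U i))) = (\<Sum>i<k. ennreal (diameter (U i)))"
    by (rule suminf_finite) (auto simp: U_def)
  also have "\<dots> \<le> (\<Sum>i<k. ennreal (L * d))"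
    by (intro sum_mono ennreal_leI diam)
  also have "\<dots> = ennreal (L * (b - a))"
    using L d0 kpos by (simp add: d_def ennreal_of_nat_eq_real_of_nat ennreal_mult'[symmetric])
  finally show "hausdorff1_content \<delta> A \<le> ennreal (L * (b - a))" .
qed

section \<open>Integrals over zero sets\<close>

text \<open>Every set of a cover can be thickened to an open set at an arbitrarily small total cost, so a cover
of \<open>Z\<close> also covers all sets in some neighbourhood of \<open>Z\<close>. The doubling of \<open>\<delta>\<close> leaves room for the
thickening.\<close>
lemma content_upper_semicontinuous:
  assumes "\<delta> > 0" and less: "hausdorff1_content \<delta> Z < t"
  shows "\<exists>V. open V \<and> Z \<subseteq> V \<and> hausdorff1_content (2 * \<delta>) V < t"
proof -
  obtain U :: "nat \<Rightarrow> (real ^ 2) set" where U: "Z \<subseteq> (\<Union>i. U i)" "\<And>i. bounded (U i)"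
    "\<And>i. diameter (U i) \<le> \<delta>" and St: "(\<Sum>i. ennreal (diameter (U i))) < t"
    using content_less_cover[OF less] by metis
  let ?S = "\<Sum>i. ennreal (diameter (U i))"
  obtain u where u: "?S < u" "u < t" using dense[OF St] by auto
  have "u < top" using u(2) by (rule order.strict_trans2) simp
  moreover have "?S < top" using u(1) by (rule order.strict_trans2) simp
  ultimately obtain ur sr where ur: "u = ennreal ur" "0 \<le> ur" and sr: "?S = ennreal sr" "0 \<le> sr"
    by (metis ennreal_cases less_top)
  have "sr < ur" using u(1) sr ur by (simp add: ennreal_less_iff)
  \<comment> \<open>The total thickening stays below the gap between the sum of the diameters and \<open>t\<close>.\<close>
  define e where "e = min \<delta> (ur - sr)"
  have e: "0 < e" "e \<le> \<delta>" "sr + e \<le> ur" using \<open>sr < ur\<close> \<open>\<delta> > 0\<close> by (auto simp: e_def)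
  define r where "r i = e * (1 / 2) ^ Suc i / 2" for i :: nat
  have rpos: "r i > 0" for i using e by (simp add: r_def)
  have rle: "2 * r i \<le> \<delta>" for i
  proof -
    have "(1 / 2 :: real) ^ Suc i \<le> 1" by (rule power_le_one) auto
    then have "e * (1 / 2) ^ Suc i \<le> e * 1" using e by (intro mult_left_mono) auto
    moreover have "2 * r i = e * (1 / 2) ^ Suc i" by (simp add: r_def)
    ultimately show ?thesis using e by linarith
  qed
  define V where "V i = (\<Union>x\<in>U i. ball x (r i))" for i
  have dist: "dist p q \<le> diameter (U i) + 2 * r i" if pq: "p \<in> V i" "q \<in> V i" for p q i
  proof -
    obtain x y where xy: "x \<in> U i" "y \<in> U i" "dist x p < r i" "dist y q < r i"
      using pq by (auto simp: V_def)
    have "dist p q \<le> dist p x + dist x y + dist y q"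
      using dist_triangle[of p q x] dist_triangle[of x q y] by linarith
    then show ?thesis
      using xy diameter_bounded_bound[OF U(2) xy(1,2)] by (simp add: dist_commute)
  qed
  have diam: "diameter (V i) \<le> diameter (U i) + 2 * r i" for i
    using dist rpos[of i] diameter_ge_0[OF U(2)] 
    by (intro diameter_le) (auto simp: dist_norm intro: add_nonneg_nonneg less_imp_le)
  have "hausdorff1_content (2 * \<delta>) (\<Union>i. V i) \<le> (\<Sum>i. ennreal (diameter (V i)))"
  proof (rule content_le)
    show "bounded (V i)" for i using dist by (rule bounded_if_dist_le)
    show "diameter (V i) \<le> 2 * \<delta>" for i using diam[of i] rle[of i] U(3)[of i] by linarith
  qed simp
  also have "\<dots> \<le> (\<Sum>i. ennreal (diameter (U i)) + ennreal (e * (1 / 2) ^ Suc i))"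
  proof (intro suminf_le summableI)
    fix i
    have "ennreal (diameter (V i)) \<le> ennreal (diameter (U i) + 2 * r i)"
      by (intro ennreal_leI diam)
    also have "\<dots> = ennreal (diameter (U i)) + ennreal (e * (1 / 2) ^ Suc i)"
      using e diameter_ge_0[OF U(2)] by (subst ennreal_plus[symmetric]) (auto simp: r_def)
    finally show "ennreal (diameter (V i)) \<le> ennreal (diameter (U i)) + ennreal (e * (1 / 2) ^ Suc i)" .
  qed
  also have "\<dots> = ?S + (\<Sum>i. ennreal (e * (1 / 2) ^ Suc i))"
    by (rule suminf_add[symmetric]) auto
  also have "(\<Sum>i. ennreal (e * (1 / 2) ^ Suc i)) = ennreal e"
    using sums_mult[OF power_half_series, of e] e
    by (subst suminf_ennreal2) (auto simp: sums_iff)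
  also have "?S + ennreal e = ennreal (sr + e)" using sr e by simp
  also have "\<dots> \<le> u" using e ur by (auto intro: ennreal_leI)
  finally have "hausdorff1_content (2 * \<delta>) (\<Union>i. V i) < t" using u(2) by (rule order.strict_trans1)
  moreover have "open (\<Union>i. V i)" by (auto simp: V_def)
  moreover have "Z \<subseteq> (\<Union>i. V i)"
  proof
    fix x assume "x \<in> Z"
    then obtain i where i: "x \<in> U i" using U(1) by blast
    moreover have "x \<in> ball x (r i)" using rpos by simp
    ultimately have "x \<in> V i" unfolding V_def by blast
    then show "x \<in> (\<Union>i. V i)" by blast
  qed
  ultimately show ?thesis by blast
qed

text \<open>If \<open>V\<close> is a neighbourhood of the zero set in \<open>K\<close> for the parameter \<open>c\<close>, then by compactness of \<open>K\<close> it
contains the zero sets for all parameters near \<open>c\<close>. Hence the content of the zero set is upper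
semicontinuous in the parameter, up to the loss in \<open>\<delta>\<close>, and its supremum over \<open>\<delta>\<close> is measurable. The
argument applies to degenerate zero sets of infinite length as well.\<close>
lemma outer_of_zero_set_measurable:
  fixes F :: "'c::topological_space \<Rightarrow> real ^ 2 \<Rightarrow> complex"
  assumes F: "continuous_on UNIV (\<lambda>(c, t). F c t)" and K: "compact K"
  shows "(\<lambda>c. hausdorff1_outer {t \<in> K. F c t = 0}) \<in> borel_measurable borel"
proof (rule borel_measurableI_le)
  fix y :: ennreal
  define Z where "Z c = {t \<in> K. F c t = 0}" for c
  have near: "\<exists>W. open W \<and> c \<in> W \<and> (\<forall>c'\<in>W. Z c' \<subseteq> V)" if "open V" "Z c \<subseteq> V" for c V
  proof -
    let ?W = "{p. (case p of (c, t) \<Rightarrow> F c t) \<noteq> 0}"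
    have "open ?W" using F by (intro open_Collect_neq) auto
    moreover have "compact (K - V)" using K that(1) by (rule compact_diff)
    moreover have "{c} \<times> (K - V) \<subseteq> ?W" using that(2) by (auto simp: Z_def)
    ultimately obtain X where "c \<in> X" "open X" "X \<times> (K - V) \<subseteq> ?W"
      using Elementary_Topology.tube_lemma by metis
    then show ?thesis by (intro exI[of _ X]) (auto simp: Z_def)
  qed
  define \<delta> where "\<delta> k = 1 / real (Suc k)" for k
  define A where "A k = {c. hausdorff1_content (\<delta> k) (Z c) < y + ennreal (\<delta> k)}" for k
  \<comment> \<open>Taking interiors makes the sets Borel; the loss of a factor 2 in \<open>\<delta>\<close> disappears in the supremum.\<close>
  have "{c. hausdorff1_outer (Z c) \<le> y} = (\<Inter>k. interior (A k))" if "y < top"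
  proof (intro equalityI subsetI)
    fix c assume c: "c \<in> {c. hausdorff1_outer (Z c) \<le> y}"
    show "c \<in> (\<Inter>k. interior (A k))"
    proof
      fix k
      have "hausdorff1_content (\<delta> k / 2) (Z c) \<le> y"
        using c content_le_outer[of "\<delta> k / 2" "Z c"] by (auto simp: \<delta>_def intro: order_trans)
      also have "y < y + ennreal (\<delta> k)"
        using that ennreal_add_left_cancel_less[of y 0 "ennreal (\<delta> k)"] by (auto simp: \<delta>_def)
      finally have "\<exists>V. open V \<and> Z c \<subseteq> V \<and> hausdorff1_content (2 * (\<delta> k / 2)) V < y + ennreal (\<delta> k)"
        by (intro content_upper_semicontinuous) (auto simp: \<delta>_def)
      then obtain V where V: "open V" "Z c \<subseteq> V" "hausdorff1_content (\<delta> k) V < y + ennreal (\<delta> k)"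
        by auto
      obtain W where W: "open W" "c \<in> W" "\<forall>c'\<in>W. Z c' \<subseteq> V" using near[OF V(1,2)] by auto
      have "W \<subseteq> A k"
        using order.strict_trans1[OF content_mono V(3)] W(3) by (auto simp: A_def)
      then show "c \<in> interior (A k)" using W by (auto intro: interiorI)
    qed
  next
    fix c assume c: "c \<in> (\<Inter>k. interior (A k))"
    have A: "hausdorff1_content (\<delta> k) (Z c) < y + ennreal (\<delta> k)" for k
    proof -
      have "c \<in> A k" using c interior_subset by blast
      then show ?thesis by (simp add: A_def)
    qed
    have "hausdorff1_outer (Z c) \<le> y"
    proof (rule outer_le)
      fix d :: real assume d: "d > 0"
      show "hausdorff1_content d (Z c) \<le> y"
      proof (rule ennreal_le_epsilon)
        fix e :: real assume "e > 0"
        obtain k where k: "\<delta> k < min d e" using nat_approx_posE[of "min d e"] d \<open>e > 0\<close>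
          by (auto simp: \<delta>_def)
        have "hausdorff1_content d (Z c) \<le> hausdorff1_content (\<delta> k) (Z c)"
          using k by (intro content_antimono) auto
        also have "\<dots> \<le> y + ennreal (\<delta> k)" using A by (rule less_imp_le)
        also have "\<dots> \<le> y + ennreal e" using k by (intro add_left_mono ennreal_leI) auto
        finally show "hausdorff1_content d (Z c) \<le> y + ennreal e" .
      qed
    qed
    then show "c \<in> {c. hausdorff1_outer (Z c) \<le> y}" by simp
  qed
  moreover have "(\<Inter>k. interior (A k)) \<in> sets borel" by (intro sets.countable_INT'') auto
  moreover have "{c. hausdorff1_outer (Z c) \<le> y} = UNIV" if "\<not> y < top"
    using that by (auto simp: less_top[symmetric])
  ultimately have "{c. hausdorff1_outer (Z c) \<le> y} \<in> sets borel" by (cases "y < top") auto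
  then show "{c \<in> space borel. hausdorff1_outer {t \<in> K. F c t = 0} \<le> y} \<in> sets borel"
    by (simp add: Z_def)
qed

text \<open>For nonnegative functions the integral over a curve is kept in \<open>ennreal\<close>: a degenerate zero set may
have infinite length, and measurability in a parameter has to hold there too.\<close>
definition H1_integral :: "(real ^ 2 \<Rightarrow> real) \<Rightarrow> (real ^ 2) set \<Rightarrow> ennreal" where
  "H1_integral \<psi> Z = (\<integral>\<^sup>+ x. ennreal (\<psi> x) * indicator Z x \<partial>H1)"

text \<open>A Riemann sum of the layer cake formula, at the heights \<open>h, 2 * h, \<dots>, J * h\<close>. It expresses the
integral through lengths of superlevel sets, which are closed and therefore accessible to the two
results on lengths of zero sets (measurability above, comparison below).\<close>
definition layer_sum :: "(real ^ 2 \<Rightarrow> real) \<Rightarrow> real \<Rightarrow> nat \<Rightarrow> (real ^ 2) set \<Rightarrow> ennreal" where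
  "layer_sum \<psi> h J Z = (\<Sum>j=1..J. ennreal h * hausdorff1_outer (Z \<inter> {x. \<psi> x \<ge> real j * h}))"

lemma sum_levels_bounds:
  fixes y h :: real
  assumes "h > 0" "y \<le> real J * h"
  defines "s \<equiv> (\<Sum>j=1..J. if real j * h \<le> y then h else 0)"
  shows "s \<le> max 0 y" "max 0 y - h \<le> s"
proof -
  define m where "m = nat \<lfloor>y / h\<rfloor>"
  have fl: "real j * h \<le> y \<longleftrightarrow> j \<le> m" if "j \<ge> 1" for j
  proof -
    have "real j * h \<le> y \<longleftrightarrow> real j \<le> y / h" using assms(1) by (simp add: field_simps)
    also have "\<dots> \<longleftrightarrow> int j \<le> \<lfloor>y / h\<rfloor>" by (simp add: le_floor_iff)
    also have "\<dots> \<longleftrightarrow> j \<le> m" using that by (simp add: m_def le_nat_iff) linarith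
    finally show ?thesis .
  qed
  have "y / h \<le> real J" using assms by (simp add: field_simps)
  then have "m \<le> J" unfolding m_def by linarith
  have "s = (\<Sum>j=1..J. if j \<le> m then h else 0)" unfolding s_def
    by (intro sum.cong) (auto simp: fl)
  also have "\<dots> = (\<Sum>j\<in>{1..J} \<inter> {j. j \<le> m}. h)" by (subst sum.inter_restrict) simp_all
  also have "{1..J} \<inter> {j. j \<le> m} = {1..m}" using \<open>m \<le> J\<close> by auto
  finally have s: "s = real m * h" by simp
  have "real m \<le> max 0 (y / h)" "max 0 (y / h) - 1 \<le> real m" unfolding m_def by linarith+
  then have "real m * h \<le> max 0 (y / h) * h" "(max 0 (y / h) - 1) * h \<le> real m * h"
    using assms(1) by (auto intro: mult_right_mono)
  moreover have "max 0 (y / h) * h = max 0 y" using assms(1) by (simp add: max_def field_simps)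
  ultimately show "s \<le> max 0 y" "max 0 y - h \<le> s" by (auto simp: s algebra_simps)
qed

lemma closed_superlevel:
  "continuous_on UNIV \<psi> \<Longrightarrow> closed {x :: real ^ 2. (\<psi> x :: real) \<ge> a}"
  by (intro closed_Collect_le continuous_on_const)

lemma layer_sum_eq_integral:
  assumes \<psi>: "continuous_on UNIV \<psi>" and h: "h > 0" and Z: "closed Z"
  shows "layer_sum \<psi> h J Z
    = (\<integral>\<^sup>+ x. ennreal (\<Sum>j=1..J. if real j * h \<le> \<psi> x then h else 0) * indicator Z x \<partial>H1)"
proof -
  have cl: "closed (Z \<inter> {x. \<psi> x \<ge> real j * h})" for j
    using Z closed_superlevel[OF \<psi>] by (rule closed_Int)
  have m [measurable]: "Z \<inter> {x. \<psi> x \<ge> real j * h} \<in> sets H1" for j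
    using borel_closed[OF cl] by simp
  have "ennreal (\<Sum>j=1..J. if real j * h \<le> \<psi> x then h else 0) * indicator Z x
     = (\<Sum>j=1..J. ennreal h * indicator (Z \<inter> {x. \<psi> x \<ge> real j * h}) x)" for x
  proof -
    have "ennreal (\<Sum>j=1..J. if real j * h \<le> \<psi> x then h else 0)
      = (\<Sum>j=1..J. ennreal (if real j * h \<le> \<psi> x then h else 0))"
      using h by (intro sum_ennreal[symmetric]) auto
    then show ?thesis
      by (simp only: sum_distrib_right) (intro sum.cong, auto split: split_indicator)
  qed
  then have "(\<integral>\<^sup>+ x. ennreal (\<Sum>j=1..J. if real j * h \<le> \<psi> x then h else 0) * indicator Z x \<partial>H1)
    = (\<integral>\<^sup>+ x. (\<Sum>j=1..J. ennreal h * indicator (Z \<inter> {x. \<psi> x \<ge> real j * h}) x) \<partial>H1)" by simp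
  also have "\<dots> = (\<Sum>j=1..J. \<integral>\<^sup>+ x. ennreal h * indicator (Z \<inter> {x. \<psi> x \<ge> real j * h}) x \<partial>H1)"
    by (rule nn_integral_sum) measurable
  also have "\<dots> = layer_sum \<psi> h J Z"
    unfolding layer_sum_def
    by (intro sum.cong refl) (simp add: nn_integral_cmult_indicator emeasure_H1 borel_closed[OF cl])
  finally show ?thesis by simp
qed

lemma layer_sum_le_H1_integral:
  assumes "continuous_on UNIV \<psi>" "h > 0" "closed Z" "\<And>x. \<psi> x \<le> real J * h"
  shows "layer_sum \<psi> h J Z \<le> H1_integral \<psi> Z"
  unfolding layer_sum_eq_integral[OF assms(1-3)] H1_integral_def
proof (intro nn_integral_mono mult_right_mono)
  fix x
  show "ennreal (\<Sum>j = 1..J. if real j * h \<le> \<psi> x then h else 0) \<le> ennreal (\<psi> x)"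
    using sum_levels_bounds(1)[OF assms(2) assms(4)[of x]]
    by (cases "\<psi> x \<ge> 0") (auto simp: max_def ennreal_neg intro: ennreal_leI)
qed simp

text \<open>The layer_sum miss at most the height \<open>h\<close> at every point, which costs \<open>h\<close> times the length.\<close>
lemma H1_integral_le_layer_sum:
  assumes \<psi>: "continuous_on UNIV \<psi>" and h: "h > 0" and Z: "closed Z" and J: "\<And>x. \<psi> x \<le> real J * h"
    and B: "closed B" "\<And>x. \<psi> x > 0 \<Longrightarrow> x \<in> B"
  shows "H1_integral \<psi> Z \<le> ennreal h * hausdorff1_outer (Z \<inter> B) + layer_sum \<psi> h J Z"
proof -
  have cl: "closed (Z \<inter> B)" using Z B(1) by (rule closed_Int)
  have [measurable]: "Z \<inter> B \<in> sets H1" "Z \<in> sets H1" "\<psi> \<in> borel_measurable H1"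
    using borel_closed[OF cl] borel_closed[OF Z] borel_measurable_continuous_onI[OF \<psi>] by (simp_all add: measurable_def)
  have "H1_integral \<psi> Z \<le> (\<integral>\<^sup>+ x. ennreal h * indicator (Z \<inter> B) x
     + ennreal (\<Sum>j=1..J. if real j * h \<le> \<psi> x then h else 0) * indicator Z x \<partial>H1)"
    unfolding H1_integral_def
  proof (intro nn_integral_mono)
    fix x
    let ?s = "\<Sum>j = 1..J. if real j * h \<le> \<psi> x then h else 0"
    have "\<psi> x - h \<le> ?s" using sum_levels_bounds(2)[OF h J[of x]] by auto
    moreover have "?s \<ge> 0" using h by (intro sum_nonneg) auto
    ultimately have "ennreal (\<psi> x) \<le> ennreal h + ennreal ?s"
      using h ennreal_plus[of h ?s] ennreal_leI[of "\<psi> x" "h + ?s"] by (simp del: ennreal_plus)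
    then show "ennreal (\<psi> x) * indicator Z x \<le> ennreal h * indicator (Z \<inter> B) x + ennreal ?s * indicator Z x"
      using B(2)[of x] by (cases "\<psi> x > 0") (auto split: split_indicator simp: ennreal_neg)
  qed
  also have "\<dots> = (\<integral>\<^sup>+ x. ennreal h * indicator (Z \<inter> B) x \<partial>H1) + layer_sum \<psi> h J Z"
    unfolding layer_sum_eq_integral[OF \<psi> h Z] by (rule nn_integral_add) measurable
  also have "(\<integral>\<^sup>+ x. ennreal h * indicator (Z \<inter> B) x \<partial>H1) = ennreal h * hausdorff1_outer (Z \<inter> B)"
    by (simp add: nn_integral_cmult_indicator emeasure_H1 borel_closed[OF cl])
  finally show ?thesis .
qed

text \<open>Fatou's lemma; it remains true when both sides are infinite, where no dominated convergence is
available.\<close>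
lemma H1_integral_eq_liminf_layer_sum:
  assumes \<psi>: "continuous_on UNIV \<psi>" and Z: "closed Z" and b: "\<And>x. \<psi> x \<le> real b"
  shows "H1_integral \<psi> Z = liminf (\<lambda>k. layer_sum \<psi> (1 / real (Suc k)) (b * Suc k) Z)"
proof (rule antisym)
  let ?h = "\<lambda>k. 1 / real (Suc k)"
  let ?s = "\<lambda>k x. \<Sum>j=1..b * Suc k. if real j * ?h k \<le> \<psi> x then ?h k else 0"
  have J: "\<psi> x \<le> real (b * Suc k) * ?h k" for x k
  proof -
    have "real (b * Suc k) * ?h k = real b" by (simp only: of_nat_mult) (simp add: field_simps)
    then show ?thesis using b[of x] by simp
  qed
  have [measurable]: "Z \<in> sets H1" "\<psi> \<in> borel_measurable H1"
    using borel_closed[OF Z] borel_measurable_continuous_onI[OF \<psi>] by (simp_all add: measurable_def)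
  have lim: "(\<lambda>k. ennreal (?s k x) * indicator Z x) \<longlonglongrightarrow> ennreal (\<psi> x) * indicator Z x" for x
  proof -
    have "(\<lambda>k. max 0 (\<psi> x) - ?h k) \<longlonglongrightarrow> max 0 (\<psi> x) - 0"
      by (intro tendsto_diff tendsto_const LIMSEQ_Suc[OF lim_1_over_n])
    then have low: "(\<lambda>k. max 0 (\<psi> x) - ?h k) \<longlonglongrightarrow> max 0 (\<psi> x)" by simp
    have "max 0 (\<psi> x) - ?h k \<le> ?s k x" "?s k x \<le> max 0 (\<psi> x)" for k
      using sum_levels_bounds[OF _ J[of x k]] by auto
    then have "(\<lambda>k. ?s k x) \<longlonglongrightarrow> max 0 (\<psi> x)"
      by (intro tendsto_sandwich[OF _ _ low tendsto_const] always_eventually allI)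
    then have "(\<lambda>k. ennreal (?s k x)) \<longlonglongrightarrow> ennreal (max 0 (\<psi> x))" by (rule tendsto_ennrealI)
    moreover have "ennreal (max 0 (\<psi> x)) = ennreal (\<psi> x)" by (simp add: max_def ennreal_neg)
    ultimately have "(\<lambda>k. ennreal (?s k x)) \<longlonglongrightarrow> ennreal (\<psi> x)" by (simp only:)
    then show ?thesis
      by (cases "x \<in> Z") (simp_all only: indicator_def of_bool_def if_True if_False simp_thms mult_1_right mult_zero_right tendsto_const)
  qed
  have "H1_integral \<psi> Z = (\<integral>\<^sup>+ x. liminf (\<lambda>k. ennreal (?s k x) * indicator Z x) \<partial>H1)"
    unfolding H1_integral_def by (intro nn_integral_cong lim_imp_Liminf[OF sequentially_bot lim, symmetric])
  also have "\<dots> \<le> liminf (\<lambda>k. \<integral>\<^sup>+ x. ennreal (?s k x) * indicator Z x \<partial>H1)"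
    by (rule nn_integral_liminf) measurable
  also have "\<dots> = liminf (\<lambda>k. layer_sum \<psi> (?h k) (b * Suc k) Z)"
    by (subst layer_sum_eq_integral[OF \<psi> _ Z]) simp_all
  finally show "H1_integral \<psi> Z \<le> liminf (\<lambda>k. layer_sum \<psi> (?h k) (b * Suc k) Z)" .
  have "liminf (\<lambda>k. layer_sum \<psi> (?h k) (b * Suc k) Z) \<le> liminf (\<lambda>k. H1_integral \<psi> Z)"
    by (intro Liminf_mono always_eventually allI layer_sum_le_H1_integral \<psi> Z J) auto
  then show "liminf (\<lambda>k. layer_sum \<psi> (?h k) (b * Suc k) Z) \<le> H1_integral \<psi> Z"
    by (simp add: Liminf_const)
qed

lemma bounded_above_of_compact_support:
  fixes \<psi> :: "real ^ 2 \<Rightarrow> real"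
  assumes \<psi>: "continuous_on UNIV \<psi>" and supp: "\<And>x. \<psi> x > 0 \<Longrightarrow> x \<in> cball 0 R"
  shows "\<exists>b :: nat. b > 0 \<and> (\<forall>x. \<psi> x \<le> real b)"
proof -
  have "bounded (\<psi> ` cball 0 R)"
    using \<psi> by (intro compact_imp_bounded compact_continuous_image) (auto intro: continuous_on_subset)
  then obtain c where "\<forall>y\<in>\<psi> ` cball 0 R. norm y \<le> c" unfolding bounded_iff by blast
  then have c: "\<bar>\<psi> x\<bar> \<le> c" if "x \<in> cball 0 R" for x using that by (metis image_eqI real_norm_def)
  obtain b :: nat where b: "max 1 c \<le> real b" using real_arch_simple by blast
  have "\<psi> x \<le> real b" for x
  proof (cases "\<psi> x > 0")
    case True
    then show ?thesis using c[OF supp[OF True]] b by linarith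
  qed (use b in linarith)
  moreover have "b > 0" using b by (cases b) auto
  ultimately show ?thesis by blast
qed

lemma H1_integral_of_zero_set_measurable:
  fixes F :: "'c::topological_space \<Rightarrow> real ^ 2 \<Rightarrow> complex"
  assumes F: "continuous_on UNIV (\<lambda>(c, t). F c t)"
    and \<psi>: "continuous_on UNIV \<psi>"
    and supp: "\<And>x. \<psi> x > 0 \<Longrightarrow> x \<in> cball 0 R"
  shows "(\<lambda>c. H1_integral \<psi> {t. F c t = 0}) \<in> borel_measurable borel"
proof -
  obtain b :: nat where b: "\<And>x. \<psi> x \<le> real b"
    using bounded_above_of_compact_support[OF \<psi> supp] by blast
  have cl: "closed {t. F c t = 0}" for c
  proof -
    have "continuous_on UNIV (\<lambda>t. case (c, t) of (c, t) \<Rightarrow> F c t)"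
      by (rule continuous_on_compose2[OF F]) (auto intro!: continuous_intros)
    then show ?thesis by (intro closed_Collect_eq) auto
  qed
  have "(\<lambda>c. hausdorff1_outer ({t. F c t = 0} \<inter> {x. \<psi> x \<ge> real j * h})) \<in> borel_measurable borel"
    if "j \<in> {1..J}" "h > 0" for j J h
  proof -
    have "real j * h > 0" using that by simp
    then have "{x. \<psi> x \<ge> real j * h} \<subseteq> cball 0 R" using supp by fastforce
    then have "compact {x. \<psi> x \<ge> real j * h}"
      using closed_superlevel[OF \<psi>] bounded_subset[OF bounded_cball] by (auto simp: compact_eq_bounded_closed)
    then have "(\<lambda>c. hausdorff1_outer {t \<in> {x. \<psi> x \<ge> real j * h}. F c t = 0}) \<in> borel_measurable borel"
      by (rule outer_of_zero_set_measurable[OF F])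
    moreover have "{t \<in> {x. \<psi> x \<ge> real j * h}. F c t = 0} = {t. F c t = 0} \<inter> {x. \<psi> x \<ge> real j * h}" for c
      by auto
    ultimately show ?thesis by simp
  qed
  note level = this
  have "(\<lambda>c. layer_sum \<psi> (1 / real (Suc k)) (b * Suc k) {t. F c t = 0}) \<in> borel_measurable borel" for k
    unfolding layer_sum_def by (intro borel_measurable_sum borel_measurable_times_ennreal borel_measurable_const)
      (rule level[of _ "b * Suc k"], simp_all)
  then have "(\<lambda>c. liminf (\<lambda>k. layer_sum \<psi> (1 / real (Suc k)) (b * Suc k) {t. F c t = 0})) \<in> borel_measurable borel"
    by (rule borel_measurable_liminf)
  then show ?thesis by (simp add: H1_integral_eq_liminf_layer_sum[OF \<psi> cl b])
qed

text \<open>The value of the Bochner integral of \<open>\<phi>\<close> over \<open>Z\<close>, with its convention 0 for functions that are not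
integrable, written out in terms of the positive and the negative part.\<close>
definition signed_integral :: "(real ^ 2 \<Rightarrow> real) \<Rightarrow> (real ^ 2) set \<Rightarrow> real" where
  "signed_integral \<phi> Z =
    (if H1_integral (\<lambda>x. max 0 (\<phi> x)) Z < top \<and> H1_integral (\<lambda>x. max 0 (- \<phi> x)) Z < top
     then enn2real (H1_integral (\<lambda>x. max 0 (\<phi> x)) Z) - enn2real (H1_integral (\<lambda>x. max 0 (- \<phi> x)) Z) else 0)"

lemma set_integral_eq_signed_integral:
  assumes \<phi>: "continuous_on UNIV \<phi>" and supp: "\<And>x. x \<notin> \<Omega> \<Longrightarrow> \<phi> x = 0" and Z: "closed Z"
  shows "(LINT t:Z \<inter> \<Omega>|H1. \<phi> t) = signed_integral \<phi> Z"
proof -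
  define g where "g x = indicator Z x * \<phi> x" for x
  have eq: "(LINT t:Z \<inter> \<Omega>|H1. \<phi> t) = integral\<^sup>L H1 g"
    unfolding set_lebesgue_integral_def g_def
    by (intro Bochner_Integration.integral_cong refl) (auto split: split_indicator simp: supp)
  have [measurable]: "Z \<in> sets H1" "\<phi> \<in> borel_measurable H1"
    using borel_closed[OF Z] borel_measurable_continuous_onI[OF \<phi>] by (simp_all add: measurable_def)
  have meas: "g \<in> borel_measurable H1" unfolding g_def by measurable
  have pos: "(\<integral>\<^sup>+ x. ennreal (g x) \<partial>H1) = H1_integral (\<lambda>x. max 0 (\<phi> x)) Z"
    unfolding H1_integral_def g_def by (intro nn_integral_cong) (auto split: split_indicator simp: max_def ennreal_neg)
  have neg: "(\<integral>\<^sup>+ x. ennreal (- g x) \<partial>H1) = H1_integral (\<lambda>x. max 0 (- \<phi> x)) Z"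
    unfolding H1_integral_def g_def by (intro nn_integral_cong) (auto split: split_indicator simp: max_def ennreal_neg)
  have int: "integrable H1 g \<longleftrightarrow> H1_integral (\<lambda>x. max 0 (\<phi> x)) Z < top \<and> H1_integral (\<lambda>x. max 0 (- \<phi> x)) Z < top"
    unfolding real_integrable_def pos neg by (simp add: meas less_top)
  show ?thesis
  proof (cases "integrable H1 g")
    case True
    then show ?thesis
      using real_lebesgue_integral_def[OF True] int by (simp add: eq pos neg signed_integral_def)
  next
    case False
    then have "\<not> (H1_integral (\<lambda>x. max 0 (\<phi> x)) Z < top \<and> H1_integral (\<lambda>x. max 0 (- \<phi> x)) Z < top)" using int by simp
    then show ?thesis using not_integrable_integral_eq[OF False] by (simp only: eq signed_integral_def if_False)
  qed
qed

text \<open>A comparison of lengths on arbitrary subsets, with a displacement by at most \<open>\<theta>\<close>, becomes a comparison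
of integrals: the superlevel set of \<open>\<psi>\<close> at height \<open>(j + 1) * h\<close> is moved into the superlevel set at
height \<open>j * h\<close>, because \<open>\<psi>\<close> varies by at most \<open>h\<close> over the distance \<open>\<theta>\<close>.\<close>
lemma H1_integral_comparison:
  assumes \<psi>: "continuous_on UNIV \<psi>" and h: "h > 0" and J: "\<And>x. \<psi> x \<le> real J * h"
    and supp: "\<And>x. \<psi> x > 0 \<Longrightarrow> x \<in> cball 0 R"
    and osc: "\<And>x y. dist x y \<le> \<theta> \<Longrightarrow> \<bar>\<psi> x - \<psi> y\<bar> \<le> h"
    and \<theta>: "\<theta> \<ge> 0" "\<theta> \<le> 1" and L: "L \<ge> 0"
    and Z: "closed Z1" "closed Z2"
    and fin: "hausdorff1_outer (Z1 \<inter> cball 0 R) \<le> ennreal C" "hausdorff1_outer (Z2 \<inter> cball 0 (R + 1)) \<le> ennreal C"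
    and C: "C \<ge> 0"
    and cmp: "\<And>B. B \<subseteq> cball 0 R \<Longrightarrow>
       hausdorff1_outer (Z1 \<inter> B) \<le> ennreal L * hausdorff1_outer (Z2 \<inter> {y. \<exists>x\<in>B. dist x y \<le> \<theta>})"
  shows "H1_integral \<psi> Z1 \<le> ennreal (h * C * (1 + L)) + ennreal L * H1_integral \<psi> Z2"
proof -
  let ?m2 = "\<lambda>j. hausdorff1_outer (Z2 \<inter> cball 0 (R + 1) \<inter> {x. \<psi> x \<ge> real j * h})"
  have each: "hausdorff1_outer (Z1 \<inter> {x. \<psi> x \<ge> real (Suc j) * h}) \<le> ennreal L * ?m2 j" for j
  proof -
    let ?B = "{x. \<psi> x \<ge> real (Suc j) * h}"
    have pos: "\<psi> x > 0" if "x \<in> ?B" for x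
    proof -
      have "real (Suc j) * h > 0" using h by simp
      then show ?thesis using that by simp
    qed
    have "hausdorff1_outer (Z1 \<inter> ?B) \<le> ennreal L * hausdorff1_outer (Z2 \<inter> {y. \<exists>x\<in>?B. dist x y \<le> \<theta>})"
      using supp pos by (intro cmp) blast
    also have "\<dots> \<le> ennreal L * ?m2 j"
    proof (intro mult_left_mono outer_mono subsetI)
      fix y assume "y \<in> Z2 \<inter> {y. \<exists>x\<in>?B. dist x y \<le> \<theta>}"
      then obtain x where x: "y \<in> Z2" "x \<in> ?B" "dist x y \<le> \<theta>" by auto
      have "norm x \<le> R" using supp[OF pos[OF x(2)]] by simp
      moreover have "norm y \<le> norm x + dist x y" by (metis dist_commute dist_norm norm_triangle_sub)
      ultimately have "norm y \<le> R + 1" using x(3) \<theta> by linarith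
      moreover have "real (Suc j) * h \<le> \<psi> x" using x(2) by simp
      then have "real j * h \<le> \<psi> y" using osc[OF x(3)] by (simp add: algebra_simps)
      ultimately show "y \<in> Z2 \<inter> cball 0 (R + 1) \<inter> {x. \<psi> x \<ge> real j * h}" using x(1) by simp
    qed simp
    finally show ?thesis .
  qed
  have "layer_sum \<psi> h J Z1 = (\<Sum>j<J. ennreal h * hausdorff1_outer (Z1 \<inter> {x. \<psi> x \<ge> real (Suc j) * h}))"
    unfolding layer_sum_def by (rule sum.reindex_bij_witness[of _ Suc "\<lambda>j. j - 1"]) auto
  also have "\<dots> \<le> (\<Sum>j<J. ennreal h * (ennreal L * ?m2 j))"
    by (intro sum_mono mult_left_mono each) simp
  also have "\<dots> = ennreal L * (\<Sum>j<J. ennreal h * ?m2 j)" by (simp add: sum_distrib_left ac_simps)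
  also have "\<dots> \<le> ennreal L * (\<Sum>j\<in>insert 0 {1..J}. ennreal h * ?m2 j)"
    by (intro mult_left_mono sum_mono2) auto
  also have "\<dots> = ennreal L * (ennreal h * ?m2 0 + (\<Sum>j=1..J. ennreal h * ?m2 j))" by simp
  also have "\<dots> \<le> ennreal L * (ennreal h * ennreal C + layer_sum \<psi> h J Z2)"
  proof (intro mult_left_mono add_mono)
    show "?m2 0 \<le> ennreal C" using outer_mono fin(2) by (rule order_trans) auto
    show "(\<Sum>j=1..J. ennreal h * ?m2 j) \<le> layer_sum \<psi> h J Z2"
      unfolding layer_sum_def by (intro sum_mono mult_left_mono outer_mono) auto
  qed auto
  also have "\<dots> \<le> ennreal L * (ennreal h * ennreal C + H1_integral \<psi> Z2)"
    by (intro mult_left_mono add_left_mono layer_sum_le_H1_integral \<psi> h Z J) simp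
  finally have lay: "layer_sum \<psi> h J Z1 \<le> ennreal L * (ennreal h * ennreal C + H1_integral \<psi> Z2)" .
  have "H1_integral \<psi> Z1 \<le> ennreal h * hausdorff1_outer (Z1 \<inter> cball 0 R) + layer_sum \<psi> h J Z1"
    by (rule H1_integral_le_layer_sum[OF \<psi> h Z(1) J closed_cball supp])
  also have "\<dots> \<le> ennreal h * ennreal C + ennreal L * (ennreal h * ennreal C + H1_integral \<psi> Z2)"
    by (intro add_mono mult_left_mono fin lay) simp
  also have "\<dots> = ennreal (h * C * (1 + L)) + ennreal L * H1_integral \<psi> Z2"
    using h C L by (simp add: distrib_left ennreal_mult'[symmetric] add.assoc[symmetric] ennreal_plus[symmetric] algebra_simps del: ennreal_plus)
  finally show ?thesis .
qed

section \<open>Zero sets of nearby nondegenerate functions\<close>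

lemma norm_vec2: "(norm (x :: real ^ 2))\<^sup>2 = (x $ 1)\<^sup>2 + (x $ 2)\<^sup>2"
  unfolding power2_norm_eq_inner by (simp add: inner_vec_def sum_2 power2_eq_square)

lemma inner_vec2: "(x :: real ^ 2) \<bullet> y = x $ 1 * y $ 1 + x $ 2 * y $ 2"
  by (simp add: inner_vec_def sum_2)

lemma norm_vec2_le: "norm (x :: real ^ 2) \<le> \<bar>x $ 1\<bar> + \<bar>x $ 2\<bar>"
  using norm_le_l1_cart[of x] by (simp add: sum_2)

text \<open>The pair \<open>f, G\<close> is a function with its gradient, where the gradient is bounded and Lipschitz on a disc
with a common constant. The Lipschitz condition plays the role of a bound on second derivatives.\<close>
definition tame :: "real \<Rightarrow> real \<Rightarrow> (real ^ 2 \<Rightarrow> real) \<Rightarrow> (real ^ 2 \<Rightarrow> real ^ 2) \<Rightarrow> bool" where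
  "tame R M f G \<longleftrightarrow>
     (\<forall>x. (f has_derivative (\<lambda>h. G x \<bullet> h)) (at x)) \<and>
     (\<forall>x\<in>cball 0 R. norm (G x) \<le> M) \<and>
     (\<forall>x\<in>cball 0 R. \<forall>y\<in>cball 0 R. norm (G x - G y) \<le> M * dist x y)"

lemma tame_mono: "tame R M f G \<Longrightarrow> R' \<le> R \<Longrightarrow> tame R' M f G"
  unfolding tame_def by auto

lemma tameD:
  assumes "tame R M f G"
  shows "(f has_derivative (\<lambda>h. G x \<bullet> h)) (at x)"
    and "x \<in> cball 0 R \<Longrightarrow> norm (G x) \<le> M"
    and "x \<in> cball 0 R \<Longrightarrow> y \<in> cball 0 R \<Longrightarrow> norm (G x - G y) \<le> M * dist x y"
  using assms unfolding tame_def by auto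

lemma tame_continuous: "tame R M f G \<Longrightarrow> continuous_on UNIV f"
  by (intro continuous_at_imp_continuous_on ballI has_derivative_continuous[OF tameD(1)])

lemma derivative_along_line:
  fixes f :: "real ^ 2 \<Rightarrow> real"
  assumes "\<And>x. (f has_derivative (\<lambda>h. G x \<bullet> h)) (at x)"
  shows "((\<lambda>s. f (p + s *\<^sub>R v)) has_real_derivative (G (p + s *\<^sub>R v) \<bullet> v)) (at s)"
proof -
  have "((\<lambda>s. p + s *\<^sub>R v) has_derivative (\<lambda>h. h *\<^sub>R v)) (at s)"
    by (auto intro!: derivative_eq_intros)
  then have "((\<lambda>s. f (p + s *\<^sub>R v)) has_derivative (\<lambda>h. G (p + s *\<^sub>R v) \<bullet> (h *\<^sub>R v))) (at s)"
    using assms by (rule has_derivative_compose)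
  then show ?thesis
    by (rule has_derivative_imp_has_field_derivative) simp
qed

lemma mvt_along_line:
  fixes f :: "real ^ 2 \<Rightarrow> real"
  assumes "\<And>x. (f has_derivative (\<lambda>h. G x \<bullet> h)) (at x)"
  obtains s where "0 < s" "s < 1" "f y - f x = G (x + s *\<^sub>R (y - x)) \<bullet> (y - x)"
  using MVT2[of 0 1 "\<lambda>s. f (x + s *\<^sub>R (y - x))" "\<lambda>s. G (x + s *\<^sub>R (y - x)) \<bullet> (y - x)"]
    derivative_along_line[OF assms] by auto

lemma segment_in_cball:
  fixes x y :: "real ^ 2"
  assumes "x \<in> cball 0 R" "y \<in> cball 0 R" "0 \<le> s" "s \<le> 1"
  shows "x + s *\<^sub>R (y - x) \<in> cball 0 R"
proof -
  have "(1 - s) *\<^sub>R x + s *\<^sub>R y \<in> cball 0 R"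
    using assms by (intro convexD_alt convex_cball) auto
  then show ?thesis by (simp add: algebra_simps)
qed

text \<open>The mixed difference of \<open>f\<close> over two segments \<open>u v\<close> and \<open>p q\<close> is of second order, the product of their
distance and their length, apart from the amount by which the segments fail to be parallel.\<close>
lemma second_difference_le:
  assumes f: "tame R M f G" and M: "M \<ge> 0"
    and cb: "u \<in> cball 0 R" "v \<in> cball 0 R" "p \<in> cball 0 R" "q \<in> cball 0 R"
    and up: "dist u p \<le> d" "dist v q \<le> d"
  shows "\<bar>(f u - f v) - (f p - f q)\<bar> \<le> M * d * dist p q + M * norm ((u - v) - (p - q))"
proof -
  let ?a = "\<lambda>s. v + s *\<^sub>R (u - v)" and ?b = "\<lambda>s. q + s *\<^sub>R (p - q)"
  have "\<exists>s>0. s < 1 \<and> (f (?a 1) - f (?b 1)) - (f (?a 0) - f (?b 0))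
      = (1 - 0) * (G (?a s) \<bullet> (u - v) - G (?b s) \<bullet> (p - q))"
    by (rule MVT2) (auto intro!: DERIV_diff derivative_along_line tameD(1)[OF f])
  then obtain s where s: "0 < s" "s < 1"
    and eq: "(f u - f p) - (f v - f q) = G (?a s) \<bullet> (u - v) - G (?b s) \<bullet> (p - q)" by auto
  have in_ball: "?a s \<in> cball 0 R" "?b s \<in> cball 0 R"
    using segment_in_cball[OF cb(2) cb(1), of s] segment_in_cball[OF cb(4) cb(3), of s] s by auto
  have "dist (?a s) (?b s) \<le> d"
  proof -
    have "?a s - ?b s = (1 - s) *\<^sub>R (v - q) + s *\<^sub>R (u - p)" by (simp add: algebra_simps)
    then have "dist (?a s) (?b s) = norm ((1 - s) *\<^sub>R (v - q) + s *\<^sub>R (u - p))"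
      unfolding dist_norm by (rule arg_cong)
    also have "\<dots> \<le> norm ((1 - s) *\<^sub>R (v - q)) + norm (s *\<^sub>R (u - p))" by (rule norm_triangle_ineq)
    also have "\<dots> = (1 - s) * dist v q + s * dist u p" using s by (simp add: dist_norm)
    also have "\<dots> \<le> (1 - s) * d + s * d" using s up by (intro add_mono mult_left_mono) auto
    finally show ?thesis by (simp add: algebra_simps)
  qed
  then have "norm (G (?a s) - G (?b s)) \<le> M * d"
    using tameD(3)[OF f in_ball] M by (meson mult_left_mono order_trans)
  then have 1: "\<bar>(G (?a s) - G (?b s)) \<bullet> (p - q)\<bar> \<le> M * d * dist p q"
    using Cauchy_Schwarz_ineq2[of "G (?a s) - G (?b s)" "p - q"]
    by (smt (verit) dist_norm mult_right_mono norm_ge_zero)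
  have 2: "\<bar>G (?a s) \<bullet> ((u - v) - (p - q))\<bar> \<le> M * norm ((u - v) - (p - q))"
    using Cauchy_Schwarz_ineq2[of "G (?a s)" "(u - v) - (p - q)"] tameD(2)[OF f in_ball(1)]
    by (smt (verit) mult_right_mono norm_ge_zero)
  have "(f u - f v) - (f p - f q)
      = (G (?a s) - G (?b s)) \<bullet> (p - q) + G (?a s) \<bullet> ((u - v) - (p - q))"
    using eq by (simp add: inner_diff_left inner_diff_right)
  then show ?thesis using 1 2 by linarith
qed

text \<open>A zero \<open>p\<close> of \<open>f\<close> is moved along the vector \<open>Gf p\<close> until \<open>g\<close> vanishes. Along this line \<open>g\<close> increases
with slope at least \<open>c\<close>, so that a zero is met at a unique parameter \<open>S p\<close> in \<open>[- \<sigma>, \<sigma>]\<close>. The direction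
\<open>Gf p\<close> is Lipschitz in \<open>p\<close>, and so is \<open>S p\<close>, with a constant proportional to \<open>\<delta>\<close>; therefore the map
displaces nearby points by nearly the same vector, and \<open>\<kappa>\<close> bounds the relative error.\<close>
lemma perturbed_zero_map:
  assumes f: "tame (R + 1) M f Gf" and g: "tame (R + 1) M g Gg"
    and M: "M > 0" and m: "m > 0" and \<delta>: "\<delta> > 0"
    and nondeg: "\<And>p. p \<in> cball 0 R \<Longrightarrow> f p = 0 \<Longrightarrow> m \<le> norm (Gf p)"
    and close: "\<And>x. x \<in> cball 0 (R + 1) \<Longrightarrow> \<bar>f x - g x\<bar> \<le> \<delta>"
      "\<And>x. x \<in> cball 0 (R + 1) \<Longrightarrow> norm (Gf x - Gg x) \<le> \<delta>"
    and c_def: "c = m\<^sup>2 / 2" and \<sigma>_def: "\<sigma> = \<delta> / c"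
    and small: "\<sigma> * M \<le> 1" "\<delta> + M * (\<sigma> * M) \<le> m / 2"
    and \<kappa>_def: "\<kappa> = M * ((2 * \<delta> + 2 * \<sigma> * M\<^sup>2) / c) + \<sigma> * M" and \<kappa>: "\<kappa> < 1"
  shows "\<exists>\<Phi>. (\<forall>p\<in>cball 0 R. f p = 0 \<longrightarrow> g (\<Phi> p) = 0 \<and> dist p (\<Phi> p) \<le> \<sigma> * M) \<and>
     (\<forall>p\<in>cball 0 R. \<forall>q\<in>cball 0 R. f p = 0 \<longrightarrow> f q = 0 \<longrightarrow> (1 - \<kappa>) * dist p q \<le> dist (\<Phi> p) (\<Phi> q))"
proof -
  define A where "A = {p \<in> cball 0 R. f p = 0}"
  have c: "c > 0" using m by (simp add: c_def)
  have \<sigma>: "\<sigma> > 0" using \<delta> c by (simp add: \<sigma>_def)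
  have \<sigma>c: "\<sigma> * c = \<delta>" using c by (simp add: \<sigma>_def)
  have A1: "p \<in> cball 0 (R + 1)" "norm (Gf p) \<le> M" "m \<le> norm (Gf p)" "f p = 0" if "p \<in> A" for p
    using that nondeg tameD(2)[OF f, of p] by (auto simp: A_def)
  have move: "p + s *\<^sub>R Gf p \<in> cball 0 (R + 1)" "dist (p + s *\<^sub>R Gf p) p \<le> \<sigma> * M"
    if "p \<in> A" "\<bar>s\<bar> \<le> \<sigma>" for p s
  proof -
    have "norm (s *\<^sub>R Gf p) \<le> \<sigma> * M"
      using that(2) A1(2)[OF that(1)] \<sigma> by (auto intro!: mult_mono)
    then show "dist (p + s *\<^sub>R Gf p) p \<le> \<sigma> * M" by (simp add: dist_norm)
    have "norm (p + s *\<^sub>R Gf p) \<le> norm p + norm (s *\<^sub>R Gf p)" by (rule norm_triangle_ineq)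
    also have "\<dots> \<le> R + 1" using \<open>norm (s *\<^sub>R Gf p) \<le> \<sigma> * M\<close> small(1) that(1) by (auto simp: A_def)
    finally show "p + s *\<^sub>R Gf p \<in> cball 0 (R + 1)" by simp
  qed
  let ?F = "\<lambda>p s. g (p + s *\<^sub>R Gf p)"
  \<comment> \<open>At distance at most \<open>\<sigma> * M\<close> from \<open>p\<close> the gradient of \<open>g\<close> still is close to the gradient of \<open>f\<close> at \<open>p\<close>.\<close>
  have slope: "c \<le> Gg (p + s *\<^sub>R Gf p) \<bullet> Gf p" if p: "p \<in> A" and s: "\<bar>s\<bar> \<le> \<sigma>" for p s
  proof -
    let ?u = "p + s *\<^sub>R Gf p"
    have "norm (Gf ?u - Gf p) \<le> M * dist ?u p" by (rule tameD(3)[OF f move(1)[OF p s] A1(1)[OF p]])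
    also have "\<dots> \<le> M * (\<sigma> * M)" using move(2)[OF p s] M by (intro mult_left_mono) auto
    finally have "norm (Gg ?u - Gf p) \<le> \<delta> + M * (\<sigma> * M)"
      using close(2)[OF move(1)[OF p s]] norm_triangle_ineq[of "Gg ?u - Gf ?u" "Gf ?u - Gf p"]
      by (simp add: norm_minus_commute)
    then have "norm (Gg ?u - Gf p) \<le> m / 2" using small(2) by linarith
    then have "\<bar>(Gg ?u - Gf p) \<bullet> Gf p\<bar> \<le> m / 2 * norm (Gf p)"
      using Cauchy_Schwarz_ineq2[of "Gg ?u - Gf p" "Gf p"]
      by (smt (verit) mult_right_mono norm_ge_zero)
    moreover have "Gg ?u \<bullet> Gf p = (norm (Gf p))\<^sup>2 + (Gg ?u - Gf p) \<bullet> Gf p"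
      by (simp add: inner_diff_left power2_norm_eq_inner)
    moreover have "norm (Gf p) * (norm (Gf p) - m / 2) = (norm (Gf p))\<^sup>2 - m / 2 * norm (Gf p)"
      by (simp add: power2_eq_square right_diff_distrib)
    ultimately have "norm (Gf p) * (norm (Gf p) - m / 2) \<le> Gg ?u \<bullet> Gf p"
      by linarith
    moreover have "m * (m / 2) \<le> norm (Gf p) * (norm (Gf p) - m / 2)"
      using A1(3)[OF p] m by (intro mult_mono) auto
    ultimately show ?thesis by (simp add: c_def power2_eq_square)
  qed
  have mono: "c * (b - a) \<le> ?F p b - ?F p a" if p: "p \<in> A" and ab: "a \<le> b" "\<bar>a\<bar> \<le> \<sigma>" "\<bar>b\<bar> \<le> \<sigma>" for p a b
  proof (cases "a = b")
    case False
    then have "\<exists>z>a. z < b \<and> ?F p b - ?F p a = (b - a) * (Gg (p + z *\<^sub>R Gf p) \<bullet> Gf p)"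
      using ab by (intro MVT2 derivative_along_line tameD(1)[OF g]) auto
    then obtain z where z: "a < z" "z < b" "?F p b - ?F p a = (b - a) * (Gg (p + z *\<^sub>R Gf p) \<bullet> Gf p)"
      by blast
    have "c \<le> Gg (p + z *\<^sub>R Gf p) \<bullet> Gf p" using z ab by (intro slope p) auto
    then have "(b - a) * c \<le> (b - a) * (Gg (p + z *\<^sub>R Gf p) \<bullet> Gf p)"
      using ab by (intro mult_left_mono) auto
    then show ?thesis using z(3) by (simp add: mult.commute)
  qed simp
  have expand: "c * \<bar>b - a\<bar> \<le> \<bar>?F p b - ?F p a\<bar>" if "p \<in> A" "\<bar>a\<bar> \<le> \<sigma>" "\<bar>b\<bar> \<le> \<sigma>" for p a b
    using mono[of p a b] mono[of p b a] that by (cases "a \<le> b") (auto simp: abs_if algebra_simps)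
  have "\<exists>s. \<bar>s\<bar> \<le> \<sigma> \<and> ?F p s = 0" if p: "p \<in> A" for p
  proof -
    have g0: "\<bar>?F p 0\<bar> \<le> \<delta>" using close(1)[OF A1(1)[OF p]] A1(4)[OF p] by simp
    have "?F p (- \<sigma>) \<le> 0" "0 \<le> ?F p \<sigma>"
      using mono[OF p, of 0 \<sigma>] mono[OF p, of "- \<sigma>" 0] g0 \<sigma> \<sigma>c by (auto simp: algebra_simps abs_le_iff)
    moreover have "continuous_on {- \<sigma>..\<sigma>} (?F p)"
      by (rule continuous_on_compose2[OF tame_continuous[OF g]]) (auto intro!: continuous_intros)
    ultimately have "\<exists>x\<ge>- \<sigma>. x \<le> \<sigma> \<and> ?F p x = 0" using \<sigma> by (intro IVT') auto
    then show ?thesis by (auto simp: abs_le_iff)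
  qed
  then obtain S where S: "\<And>p. p \<in> A \<Longrightarrow> \<bar>S p\<bar> \<le> \<sigma>" "\<And>p. p \<in> A \<Longrightarrow> ?F p (S p) = 0" by metis
  define \<Phi> where "\<Phi> p = p + S p *\<^sub>R Gf p" for p
  have "(1 - \<kappa>) * dist p q \<le> dist (\<Phi> p) (\<Phi> q)" if p: "p \<in> A" and q: "q \<in> A" for p q
  proof -
    \<comment> \<open>Comparing both points at the parameter of \<open>q\<close>: there \<open>g\<close> vanishes on the side of \<open>q\<close>.\<close>
    let ?s = "S q"
    let ?u = "p + ?s *\<^sub>R Gf p" and ?v = "q + ?s *\<^sub>R Gf q"
    note s = S(1)[OF q]
    have lipG: "norm (Gf p - Gf q) \<le> M * dist p q" by (rule tameD(3)[OF f A1(1)[OF p] A1(1)[OF q]])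
    have "norm ((?u - ?v) - (p - q)) = \<bar>?s\<bar> * norm (Gf p - Gf q)"
      by (simp add: algebra_simps flip: scaleR_diff_right)
    also have "\<dots> \<le> \<sigma> * (M * dist p q)" using s lipG \<sigma> by (intro mult_mono) auto
    finally have uv: "norm ((?u - ?v) - (p - q)) \<le> \<sigma> * (M * dist p q)" .
    have "norm (?u - ?v) \<le> norm (p - q) + norm ((?u - ?v) - (p - q))"
      using norm_triangle_ineq[of "p - q" "(?u - ?v) - (p - q)"]
      by (simp only: add_diff_cancel_left' diff_add_cancel add.commute[of "p - q"])
    also have "\<dots> \<le> dist p q + \<sigma> * (M * dist p q)" using uv by (simp add: dist_norm)
    also have "\<dots> \<le> 2 * dist p q"
      using mult_right_mono[OF small(1), of "dist p q"] by (simp add: mult.assoc)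
    finally have duv: "norm (?u - ?v) \<le> 2 * dist p q" .
    have 1: "\<bar>(f ?u - f ?v) - (f p - f q)\<bar> \<le> M * (\<sigma> * M) * dist p q + M * (\<sigma> * (M * dist p q))"
      using second_difference_le[OF f _ move(1)[OF p s] move(1)[OF q s] A1(1)[OF p] A1(1)[OF q]
          move(2)[OF p s] move(2)[OF q s]] uv M
      by (smt (verit) mult_left_mono)
    have 2: "\<bar>(g ?u - g ?v) - (f ?u - f ?v)\<bar> \<le> \<delta> * (2 * dist p q)"
    proof -
      have "((\<lambda>x. g x - f x) has_derivative (\<lambda>h. (Gg x - Gf x) \<bullet> h)) (at x)" for x
        using has_derivative_diff[OF tameD(1)[OF g] tameD(1)[OF f], of x]
        by (simp add: inner_diff_left)
      then obtain z where z: "0 < z" "z < 1"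
        and eq: "(g ?u - f ?u) - (g ?v - f ?v)
          = (Gg (?v + z *\<^sub>R (?u - ?v)) - Gf (?v + z *\<^sub>R (?u - ?v))) \<bullet> (?u - ?v)"
        by (rule mvt_along_line[where f = "\<lambda>x. g x - f x" and G = "\<lambda>x. Gg x - Gf x" and x = ?v and y = ?u])
      have "?v + z *\<^sub>R (?u - ?v) \<in> cball 0 (R + 1)"
        using z move(1)[OF p s] move(1)[OF q s] by (intro segment_in_cball) auto
      then have "norm (Gg (?v + z *\<^sub>R (?u - ?v)) - Gf (?v + z *\<^sub>R (?u - ?v))) \<le> \<delta>"
        using close(2) by (simp add: norm_minus_commute)
      then have "\<bar>(g ?u - f ?u) - (g ?v - f ?v)\<bar> \<le> \<delta> * (2 * dist p q)"
        unfolding eq using duv \<delta>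
        by (intro order_trans[OF Cauchy_Schwarz_ineq2] mult_mono) auto
      then show ?thesis by (simp add: algebra_simps)
    qed
    have "g ?v = 0" using S(2)[OF q] by simp
    then have "\<bar>g ?u\<bar> \<le> (2 * \<delta> + 2 * \<sigma> * M\<^sup>2) * dist p q"
      using 1 2 A1(4)[OF p] A1(4)[OF q] by (simp add: algebra_simps power2_eq_square)
    moreover have "c * \<bar>S q - S p\<bar> \<le> \<bar>g ?u\<bar>"
      using expand[OF p S(1)[OF p] S(1)[OF q]] S(2)[OF p] by simp
    ultimately have "c * \<bar>S q - S p\<bar> \<le> (2 * \<delta> + 2 * \<sigma> * M\<^sup>2) * dist p q" by linarith
    then have sdiff: "\<bar>S p - S q\<bar> \<le> (2 * \<delta> + 2 * \<sigma> * M\<^sup>2) / c * dist p q"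
      using c by (simp add: field_simps abs_minus_commute)
    have "S p *\<^sub>R Gf p - S q *\<^sub>R Gf q = (S p - S q) *\<^sub>R Gf p + S q *\<^sub>R (Gf p - Gf q)"
      by (simp add: algebra_simps)
    then have "norm (S p *\<^sub>R Gf p - S q *\<^sub>R Gf q) \<le> \<bar>S p - S q\<bar> * norm (Gf p) + \<bar>S q\<bar> * norm (Gf p - Gf q)"
      by (metis norm_scaleR norm_triangle_ineq)
    also have "\<dots> \<le> ((2 * \<delta> + 2 * \<sigma> * M\<^sup>2) / c * dist p q) * M + \<sigma> * (M * dist p q)"
      using sdiff A1(2)[OF p] s lipG \<sigma> \<delta> c by (intro add_mono mult_mono) auto
    also have "\<dots> = \<kappa> * dist p q" by (simp add: \<kappa>_def algebra_simps)
    finally have disp: "norm (S p *\<^sub>R Gf p - S q *\<^sub>R Gf q) \<le> \<kappa> * dist p q" .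
    have "p - q = (\<Phi> p - \<Phi> q) - (S p *\<^sub>R Gf p - S q *\<^sub>R Gf q)" by (simp add: \<Phi>_def algebra_simps)
    then have "norm (p - q) \<le> norm (\<Phi> p - \<Phi> q) + norm (S p *\<^sub>R Gf p - S q *\<^sub>R Gf q)"
      by (metis norm_triangle_ineq4)
    then show ?thesis using disp by (simp add: dist_norm algebra_simps)
  qed
  moreover have "g (\<Phi> p) = 0 \<and> dist p (\<Phi> p) \<le> \<sigma> * M" if "p \<in> A" for p
    using S[OF that] move(2)[OF that S(1)[OF that]] by (simp add: \<Phi>_def dist_commute)
  ultimately show ?thesis by (intro exI[of _ \<Phi>]) (auto simp: A_def)
qed

text \<open>All error terms of the map between the zero sets vanish with \<open>\<delta>\<close>. The bound is uniform: \<open>\<delta>\<close> depends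
on \<open>f\<close> and \<open>g\<close> only through the constants \<open>R\<close>, \<open>M\<close>, \<open>m\<close> and \<open>\<theta>\<close>.\<close>
lemma zero_set_transport:
  fixes R M m \<theta> :: real
  assumes M: "M > 0" and m: "m > 0" and \<theta>: "\<theta> > 0"
  shows "\<exists>\<delta>>0. \<forall>f g Gf Gg. tame (R + 1) M f Gf \<longrightarrow> tame (R + 1) M g Gg \<longrightarrow>
     (\<forall>p\<in>cball 0 R. f p = 0 \<longrightarrow> m \<le> norm (Gf p)) \<longrightarrow>
     (\<forall>x\<in>cball 0 (R + 1). \<bar>f x - g x\<bar> \<le> \<delta> \<and> norm (Gf x - Gg x) \<le> \<delta>) \<longrightarrow>
     (\<forall>B\<subseteq>cball 0 R. hausdorff1_outer ({x. f x = 0} \<inter> B)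
        \<le> ennreal (1 + \<theta>) * hausdorff1_outer ({x. g x = 0} \<inter> {y. \<exists>x\<in>B. dist x y \<le> \<theta>}))"
proof -
  define c where "c = m\<^sup>2 / 2"
  have c: "c > 0" using m by (simp add: c_def)
  let ?\<sigma> = "\<lambda>\<delta>. \<delta> / c"
  let ?\<kappa> = "\<lambda>\<delta>. M * ((2 * \<delta> + 2 * ?\<sigma> \<delta> * M\<^sup>2) / c) + ?\<sigma> \<delta> * M"
  have ids: "((\<lambda>\<delta>::real. \<delta>) \<longlongrightarrow> 0) (at_right 0)" by (rule tendsto_ident_at)
  have lim1: "((\<lambda>\<delta>. ?\<sigma> \<delta> * M) \<longlongrightarrow> 0 / c * M) (at_right 0)"
    and lim2: "((\<lambda>\<delta>. \<delta> + M * (?\<sigma> \<delta> * M)) \<longlongrightarrow> 0 + M * (0 / c * M)) (at_right 0)"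
    and lim3: "((\<lambda>\<delta>. (1 + \<theta>) * (1 - ?\<kappa> \<delta>)) \<longlongrightarrow>
        (1 + \<theta>) * (1 - (M * ((2 * 0 + 2 * (0 / c) * M\<^sup>2) / c) + 0 / c * M))) (at_right 0)"
    using c by (intro tendsto_intros ids; simp)+
  have "\<forall>\<^sub>F \<delta> in at_right 0. \<delta> > 0 \<and> ?\<sigma> \<delta> * M < min 1 \<theta> \<and> \<delta> + M * (?\<sigma> \<delta> * M) < m / 2
      \<and> 1 < (1 + \<theta>) * (1 - ?\<kappa> \<delta>)"
    using \<theta> m lim1 lim2 lim3
    by (intro eventually_conj eventually_at_right_less order_tendstoD) auto
  then obtain \<delta> where \<delta>: "\<delta> > 0" "?\<sigma> \<delta> * M < min 1 \<theta>" "\<delta> + M * (?\<sigma> \<delta> * M) < m / 2"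
      "1 < (1 + \<theta>) * (1 - ?\<kappa> \<delta>)"
    using eventually_happens'[of "at_right (0::real)"] by (auto simp: trivial_limit_at_right_real)
  have \<kappa>: "?\<kappa> \<delta> < 1"
  proof (rule ccontr)
    assume "\<not> ?\<kappa> \<delta> < 1"
    then have "(1 + \<theta>) * (1 - ?\<kappa> \<delta>) \<le> 0" using \<theta> by (intro mult_nonneg_nonpos) auto
    then show False using \<delta>(4) by linarith
  qed
  show ?thesis
  proof (intro exI[of _ \<delta>] conjI allI impI \<delta>(1))
    fix f g Gf Gg B
    assume f: "tame (R + 1) M f Gf" and g: "tame (R + 1) M g Gg"
      and nd: "\<forall>p\<in>cball 0 R. f p = 0 \<longrightarrow> m \<le> norm (Gf p)"
      and cl: "\<forall>x\<in>cball 0 (R + 1). \<bar>f x - g x\<bar> \<le> \<delta> \<and> norm (Gf x - Gg x) \<le> \<delta>"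
      and B: "B \<subseteq> cball (0 :: real ^ 2) R"
    have "\<exists>\<Phi>. (\<forall>p\<in>cball 0 R. f p = 0 \<longrightarrow> g (\<Phi> p) = 0 \<and> dist p (\<Phi> p) \<le> ?\<sigma> \<delta> * M) \<and>
     (\<forall>p\<in>cball 0 R. \<forall>q\<in>cball 0 R. f p = 0 \<longrightarrow> f q = 0 \<longrightarrow> (1 - ?\<kappa> \<delta>) * dist p q \<le> dist (\<Phi> p) (\<Phi> q))"
    proof (rule perturbed_zero_map[OF f g M m \<delta>(1) _ _ _ c_def refl _ _ refl \<kappa>])
      show "?\<sigma> \<delta> * M \<le> 1" "\<delta> + M * (?\<sigma> \<delta> * M) \<le> m / 2" using \<delta>(2,3) by linarith+
    qed (use nd cl in \<open>simp_all del: mem_cball\<close>)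
    then obtain \<Phi> where
      P1: "\<forall>p\<in>cball 0 R. f p = 0 \<longrightarrow> g (\<Phi> p) = 0 \<and> dist p (\<Phi> p) \<le> ?\<sigma> \<delta> * M" and
      P2: "\<forall>p\<in>cball 0 R. \<forall>q\<in>cball 0 R. f p = 0 \<longrightarrow> f q = 0 \<longrightarrow> (1 - ?\<kappa> \<delta>) * dist p q \<le> dist (\<Phi> p) (\<Phi> q)"
      by (elim exE conjE)
    note \<Phi>1 = P1[rule_format] and \<Phi>2 = P2[rule_format]
    have "hausdorff1_outer ({x. f x = 0} \<inter> B) \<le> ennreal (1 + \<theta>) * hausdorff1_outer (\<Phi> ` ({x. f x = 0} \<inter> B))"
    proof (rule outer_le_expanding_image[where L = "1 + \<theta>" and \<Phi> = \<Phi>])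
      fix p q assume "p \<in> {x. f x = 0} \<inter> B" "q \<in> {x. f x = 0} \<inter> B"
      then have "(1 - ?\<kappa> \<delta>) * dist p q \<le> dist (\<Phi> p) (\<Phi> q)" using B by (intro \<Phi>2) auto
      then have "(1 + \<theta>) * ((1 - ?\<kappa> \<delta>) * dist p q) \<le> (1 + \<theta>) * dist (\<Phi> p) (\<Phi> q)"
        using \<theta> by (intro mult_left_mono) auto
      moreover have "1 * dist p q \<le> ((1 + \<theta>) * (1 - ?\<kappa> \<delta>)) * dist p q"
        using \<delta>(4) by (intro mult_right_mono) auto
      ultimately show "dist p q \<le> (1 + \<theta>) * dist (\<Phi> p) (\<Phi> q)" by (simp add: mult.assoc)
    qed (use \<theta> in auto)
    also have "\<dots> \<le> ennreal (1 + \<theta>) * hausdorff1_outer ({x. g x = 0} \<inter> {y. \<exists>x\<in>B. dist x y \<le> \<theta>})"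
    proof (intro mult_left_mono outer_mono subsetI)
      fix y assume "y \<in> \<Phi> ` ({x. f x = 0} \<inter> B)"
      then obtain p where p: "y = \<Phi> p" "f p = 0" "p \<in> B" by auto
      then have "g y = 0" "dist p y \<le> ?\<sigma> \<delta> * M" using \<Phi>1[of p] B by auto
      then show "y \<in> {x. g x = 0} \<inter> {y. \<exists>x\<in>B. dist x y \<le> \<theta>}" using p(3) \<delta>(2) by force
    qed simp
    finally show "hausdorff1_outer ({x. f x = 0} \<inter> B)
        \<le> ennreal (1 + \<theta>) * hausdorff1_outer ({x. g x = 0} \<inter> {y. \<exists>x\<in>B. dist x y \<le> \<theta>})" .
  qed
qed

lemma plane_norm_split:
  fixes v x :: "real ^ 2"
  assumes "norm v = 1"
  defines "w \<equiv> (\<chi> i. if i = 1 then - (v $ 2) else v $ 1)"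
  shows "(norm x)\<^sup>2 = (v \<bullet> x)\<^sup>2 + (w \<bullet> x)\<^sup>2" "norm w = 1"
proof -
  note n = norm_vec2
  have v: "(v $ 1)\<^sup>2 + (v $ 2)\<^sup>2 = 1" using n[of v] assms(1) by simp
  have "(v \<bullet> x)\<^sup>2 + (w \<bullet> x)\<^sup>2 = ((v $ 1)\<^sup>2 + (v $ 2)\<^sup>2) * ((x $ 1)\<^sup>2 + (x $ 2)\<^sup>2)"
    by (simp add: w_def inner_vec_def sum_2 power2_eq_square algebra_simps)
  then show "(norm x)\<^sup>2 = (v \<bullet> x)\<^sup>2 + (w \<bullet> x)\<^sup>2" using v n[of x] by simp
  have "(norm w)\<^sup>2 = 1" using v by (simp add: n w_def add.commute)
  then show "norm w = 1" using norm_ge_zero[of w] by (simp add: power2_eq_1_iff)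
qed

text \<open>The gradient is almost constant on a disc of diameter \<open>r\<close>, so the zero set inside such a disc is a
Lipschitz graph over the direction orthogonal to the gradient at one of its points. Finitely many
discs cover the large one, and their number depends only on the constants.\<close>
lemma zero_set_length_bounded:
  fixes R M m :: real
  assumes M: "M > 0" and m: "m > 0"
  shows "\<exists>C\<ge>0. \<forall>f G. tame R M f G \<longrightarrow> (\<forall>p\<in>cball 0 R. f p = 0 \<longrightarrow> m \<le> norm (G p)) \<longrightarrow>
    hausdorff1_outer ({x. f x = 0} \<inter> cball 0 R) \<le> ennreal C"
proof -
  \<comment> \<open>Within distance \<open>r\<close> the gradient changes by at most half of its minimal norm \<open>m\<close>.\<close>
  define r where "r = m / (2 * M)"
  have r: "r > 0" using M m by (simp add: r_def)
  have Mr: "M * r = m / 2" using M by (simp add: r_def)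
  obtain T where T: "finite T" "cball (0 :: real ^ 2) R \<subseteq> (\<Union>x\<in>T. ball x (r / 2))"
  proof -
    have "cball (0 :: real ^ 2) R \<subseteq> (\<Union>x\<in>cball 0 R. ball x (r / 2))" using r by force
    from compactE_image[OF compact_cball _ this] that show ?thesis by (metis open_ball)
  qed
  show ?thesis
  proof (intro exI[of _ "real (card T) * (2 * (2 * r))"] conjI allI impI)
    fix f :: "real ^ 2 \<Rightarrow> real" and G
    assume f: "tame R M f G" and nd: "\<forall>p\<in>cball 0 R. f p = 0 \<longrightarrow> m \<le> norm (G p)"
    define A where "A x = {q \<in> cball 0 R. f q = 0} \<inter> ball x (r / 2)" for x
    have small: "hausdorff1_outer (A x) \<le> ennreal (2 * (2 * r))" for x
    proof (cases "A x = {}")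
      case False
      then obtain p where p: "p \<in> A x" by blast
      have near: "dist q q' \<le> r" if "q \<in> A x" "q' \<in> A x" for q q'
        using that dist_triangle2[of q q' x] by (auto simp: A_def dist_commute)
      have in_ball: "q \<in> cball 0 R" "f q = 0" if "q \<in> A x" for q using that by (auto simp: A_def)
      have Gp: "norm (G p) \<ge> m" using nd in_ball[OF p] by blast
      define v where "v = G p /\<^sub>R norm (G p)"
      have Gpos: "norm (G p) > 0" using Gp m by linarith
      then have nv: "norm v = 1" by (simp add: v_def)
      define w where "w = ((\<chi> i. if i = 1 then - (v $ 2) else v $ 1) :: real ^ 2)"
      note split = plane_norm_split[OF nv, folded w_def]
      have flat: "\<bar>v \<bullet> (q - q')\<bar> \<le> norm (q - q') / 2" if q: "q \<in> A x" "q' \<in> A x" for q q'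
      proof -
        obtain s where s: "0 < s" "s < 1" and eq: "f q - f q' = G (q' + s *\<^sub>R (q - q')) \<bullet> (q - q')"
          by (rule mvt_along_line[OF tameD(1)[OF f]])
        let ?z = "q' + s *\<^sub>R (q - q')"
        have zb: "?z \<in> cball 0 R" using s in_ball q by (intro segment_in_cball) auto
        have "?z \<in> ball x (r / 2)"
        proof -
          have "(1 - s) *\<^sub>R q' + s *\<^sub>R q \<in> ball x (r / 2)"
            using q s by (intro convexD_alt convex_ball) (auto simp: A_def)
          then show ?thesis by (simp add: algebra_simps)
        qed
        then have "dist ?z p \<le> r"
          using p dist_triangle2[of ?z p x] by (auto simp: A_def dist_commute)
        then have "norm (G ?z - G p) \<le> m / 2"
          using tameD(3)[OF f zb in_ball(1)[OF p]] M Mr by (smt (verit) mult_left_mono)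
        then have "\<bar>(G ?z - G p) \<bullet> (q - q')\<bar> \<le> m / 2 * norm (q - q')"
          by (intro order_trans[OF Cauchy_Schwarz_ineq2] mult_right_mono) auto
        moreover have "G ?z \<bullet> (q - q') = 0" using eq in_ball(2) q by simp
        ultimately have "\<bar>G p \<bullet> (q - q')\<bar> \<le> m / 2 * norm (q - q')"
          by (simp add: inner_diff_left)
        also have "\<dots> \<le> norm (G p) * (norm (q - q') / 2)"
          using Gp by (simp add: mult_right_mono)
        finally have "\<bar>G p \<bullet> (q - q')\<bar> \<le> norm (G p) * (norm (q - q') / 2)" .
        moreover have "G p = norm (G p) *\<^sub>R v" using Gpos by (simp add: v_def)
        then have "G p \<bullet> (q - q') = norm (G p) * (v \<bullet> (q - q'))" by (metis inner_scaleR_left)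
        ultimately have "norm (G p) * \<bar>v \<bullet> (q - q')\<bar> \<le> norm (G p) * (norm (q - q') / 2)"
          by (simp add: abs_mult)
        then show ?thesis using Gpos by (rule mult_left_le_imp_le)
      qed
      have "hausdorff1_outer (A x) \<le> ennreal (2 * ((w \<bullet> p + r) - (w \<bullet> p - r)))"
      proof (rule outer_le_of_expanding_height[where h = "\<lambda>q. w \<bullet> q"])
        fix q q' assume q: "q \<in> A x" "q' \<in> A x"
        let ?n = "norm (q - q')"
        have "(v \<bullet> (q - q'))\<^sup>2 \<le> (?n / 2)\<^sup>2" using flat[OF q] by (rule abs_le_square_iff[THEN iffD1, OF order_trans]) simp
        then have "?n\<^sup>2 \<le> (2 * (w \<bullet> (q - q')))\<^sup>2"
          using split(1)[of "q - q'"] by (simp add: power_divide power_mult_distrib)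
            (smt (verit) zero_le_power2)
        then have "?n \<le> \<bar>2 * (w \<bullet> (q - q'))\<bar>" using abs_le_square_iff[of ?n "2 * (w \<bullet> (q - q'))"] by simp
        then show "dist q q' \<le> 2 * \<bar>w \<bullet> q - w \<bullet> q'\<bar>"
          unfolding abs_mult inner_diff_right dist_norm by simp
      next
        fix q assume q: "q \<in> A x"
        have "\<bar>w \<bullet> (q - p)\<bar> \<le> norm w * norm (q - p)" by (rule Cauchy_Schwarz_ineq2)
        also have "\<dots> \<le> r" using near[OF q p] split(2) by (simp add: dist_norm)
        finally show "w \<bullet> p - r \<le> w \<bullet> q \<and> w \<bullet> q \<le> w \<bullet> p + r"
          by (auto simp: inner_diff_right abs_le_iff)
      qed (use r in auto)
      then show ?thesis by simp
    qed simp
    have "hausdorff1_outer ({x. f x = 0} \<inter> cball 0 R) \<le> hausdorff1_outer (\<Union>x\<in>T. A x)"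
      using T(2) by (intro outer_mono) (auto simp: A_def)
    also have "\<dots> \<le> (\<Sum>x\<in>T. hausdorff1_outer (A x))" by (rule outer_UN_finite_le[OF T(1)])
    also have "\<dots> \<le> (\<Sum>x\<in>T. ennreal (2 * (2 * r)))" by (intro sum_mono small)
    also have "\<dots> = ennreal (real (card T) * (2 * (2 * r)))"
      using r by (simp add: ennreal_of_nat_eq_real_of_nat ennreal_mult'[symmetric])
    finally show "hausdorff1_outer ({x. f x = 0} \<inter> cball 0 R) \<le> ennreal (real (card T) * (2 * (2 * r)))" .
  qed (use r in auto)
qed

text \<open>Landau's interpolation inequality: a difference that is small in the supremum norm and has a
Lipschitz gradient cannot have a large gradient, since it would keep growing over the distance \<open>s\<close>.\<close>
lemma gradients_close:
  assumes f: "tame (R + 1) M f Gf" and g: "tame (R + 1) M g Gg" and s: "0 < s" "s \<le> 1"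
    and cl: "\<And>x. x \<in> cball 0 (R + 1) \<Longrightarrow> \<bar>f x - g x\<bar> \<le> \<delta>" and M: "M \<ge> 0"
    and x: "x \<in> cball 0 R"
  shows "norm (Gf x - Gg x) \<le> 2 * \<delta> / s + 2 * M * s"
proof (cases "Gf x = Gg x")
  case True
  have "\<delta> \<ge> 0" using cl[of x] x abs_ge_zero[of "f x - g x"] by (auto intro: order_trans)
  then show ?thesis using True s M by simp
next
  case False
  define H where "H x = Gf x - Gg x" for x
  define v where "v = H x /\<^sub>R norm (H x)"
  have nH: "norm (H x) > 0" using False by (simp add: H_def)
  have nv: "norm v = 1" using nH by (simp add: v_def)
  have Hv: "H x \<bullet> v = norm (H x)" using nH by (simp add: v_def power2_norm_eq_inner[symmetric] power2_eq_square)
  have der: "((\<lambda>x. f x - g x) has_derivative (\<lambda>h. H x \<bullet> h)) (at x)" for x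
    using has_derivative_diff[OF tameD(1)[OF f] tameD(1)[OF g], of x] by (simp add: H_def inner_diff_left)
  let ?y = "x + s *\<^sub>R v"
  have xb: "x \<in> cball 0 (R + 1)" using x by auto
  have yb: "?y \<in> cball 0 (R + 1)"
    using norm_triangle_ineq[of x "s *\<^sub>R v"] x nv s by simp
  obtain z where z: "0 < z" "z < 1" and eq: "(f ?y - g ?y) - (f x - g x) = H (x + z *\<^sub>R (?y - x)) \<bullet> (?y - x)"
    by (rule mvt_along_line[OF der])
  let ?z = "x + z *\<^sub>R (?y - x)"
  have zb: "?z \<in> cball 0 (R + 1)" using z xb yb by (intro segment_in_cball) auto
  have "dist ?z x = z * s" using z s nv by (simp add: dist_norm)
  also have "\<dots> \<le> s" using z s by simp
  finally have dz: "dist ?z x \<le> s" .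
  have "norm (H ?z - H x) \<le> norm (Gf ?z - Gf x) + norm (Gg ?z - Gg x)"
    unfolding H_def using norm_triangle_ineq4[of "Gf ?z - Gf x" "Gg ?z - Gg x"] by (simp add: algebra_simps)
  also have "\<dots> \<le> M * dist ?z x + M * dist ?z x" by (intro add_mono tameD(3)[OF f zb xb] tameD(3)[OF g zb xb])
  also have "\<dots> \<le> 2 * M * s" using mult_left_mono[OF dz M] by simp
  finally have "\<bar>(H ?z - H x) \<bullet> v\<bar> \<le> 2 * M * s"
    using Cauchy_Schwarz_ineq2[of "H ?z - H x" v] nv by simp
  then have "norm (H x) - 2 * M * s \<le> H ?z \<bullet> v" using Hv by (simp add: inner_diff_left)
  moreover have "s * (H ?z \<bullet> v) \<le> 2 * \<delta>"
    using eq cl[OF xb] cl[OF yb] by (simp add: inner_scaleR_right)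
  then have "H ?z \<bullet> v \<le> 2 * \<delta> / s" using s by (simp add: field_simps)
  ultimately show ?thesis by (simp add: H_def)
qed


lemma H1_integral_bounded:
  assumes \<psi>: "continuous_on UNIV \<psi>" and b: "b > 0" "\<And>x. \<psi> x \<le> b"
    and supp: "\<And>x. \<psi> x > 0 \<Longrightarrow> x \<in> cball 0 R"
    and Z: "closed Z" and fin: "hausdorff1_outer (Z \<inter> cball 0 R) \<le> ennreal C" and C: "C \<ge> 0"
  shows "H1_integral \<psi> Z \<le> ennreal (2 * b * C)"
proof -
  have "H1_integral \<psi> Z \<le> ennreal b * hausdorff1_outer (Z \<inter> cball 0 R) + layer_sum \<psi> b 1 Z"
    using b(2) by (intro H1_integral_le_layer_sum \<psi> b(1) Z supp closed_cball) auto
  also have "layer_sum \<psi> b 1 Z \<le> ennreal b * hausdorff1_outer (Z \<inter> cball 0 R)"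
    using b(1) supp by (auto simp: layer_sum_def intro!: mult_left_mono outer_mono)
  also have "ennreal b * hausdorff1_outer (Z \<inter> cball 0 R) + ennreal b * hausdorff1_outer (Z \<inter> cball 0 R)
      \<le> ennreal b * ennreal C + ennreal b * ennreal C"
    by (intro add_mono mult_left_mono fin) auto
  also have "\<dots> = ennreal (2 * b * C)"
    using b(1) C by (simp add: ennreal_mult'[symmetric] ennreal_plus[symmetric] del: ennreal_plus)
  finally show ?thesis by (simp add: add_left_mono)
qed

text \<open>The situation in which zero sets are compared; \<open>f\<close> is nondegenerate in the sense that it cannot be
small together with its gradient. The radii leave room for one step to the zero of the other
function and one step of interpolation.\<close>
definition perturbation :: "real \<Rightarrow> real \<Rightarrow> real \<Rightarrow> real \<Rightarrow> (real ^ 2 \<Rightarrow> real) \<Rightarrow> (real ^ 2 \<Rightarrow> real) \<Rightarrow> bool" where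
  "perturbation R M m \<delta> f g \<longleftrightarrow> (\<exists>Gf Gg. tame (R + 3) M f Gf \<and> tame (R + 3) M g Gg \<and>
     (\<forall>p\<in>cball 0 (R + 1). \<bar>f p\<bar> < m \<longrightarrow> m \<le> norm (Gf p)) \<and>
     (\<forall>x\<in>cball 0 (R + 3). \<bar>f x - g x\<bar> \<le> \<delta>))"

lemma perturbation_mono: "perturbation R M m \<delta> f g \<Longrightarrow> \<delta> \<le> \<delta>' \<Longrightarrow> perturbation R M m \<delta>' f g"
  unfolding perturbation_def by (meson order_trans)

text \<open>Transport in both directions: a zero of \<open>g\<close> almost is a zero of \<open>f\<close>, so \<open>g\<close> inherits nondegeneracy with
half the constant, and the two one-sided comparisons together bound the difference.\<close>
theorem H1_integral_stable:
  fixes \<psi> :: "real ^ 2 \<Rightarrow> real"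
  assumes \<psi>: "continuous_on UNIV \<psi>" "\<And>x. \<psi> x \<ge> 0" and supp: "\<And>x. \<psi> x > 0 \<Longrightarrow> x \<in> cball 0 R"
    and M: "M > 0" and m: "m > 0" and \<epsilon>: "\<epsilon> > 0"
  shows "\<exists>\<delta>>0. \<forall>f g. perturbation R M m \<delta> f g \<longrightarrow>
     H1_integral \<psi> {x. f x = 0} < top \<and> H1_integral \<psi> {x. g x = 0} < top \<and>
     \<bar>enn2real (H1_integral \<psi> {x. f x = 0}) - enn2real (H1_integral \<psi> {x. g x = 0})\<bar> \<le> \<epsilon>"
proof -
  define m' where "m' = m / 2"
  have m': "m' > 0" using m by (simp add: m'_def)
  obtain C where C: "C \<ge> 0" and len: "\<And>f G. tame (R + 1) M f G \<Longrightarrow>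
      (\<forall>p\<in>cball 0 (R + 1). f p = 0 \<longrightarrow> m' \<le> norm (G p)) \<Longrightarrow>
      hausdorff1_outer ({x. f x = 0} \<inter> cball 0 (R + 1)) \<le> ennreal C"
    using zero_set_length_bounded[OF M m', of "R + 1"] by blast
  obtain b where b: "b > 0" "\<And>x. \<psi> x \<le> b"
    using bounded_above_of_compact_support[OF \<psi>(1) supp] of_nat_0_less_iff by metis
  \<comment> \<open>The height of a layer and the displacement \<open>\<theta>\<close> below each account for half of \<open>\<epsilon>\<close>.\<close>
  define h where "h = \<epsilon> / (6 * (C + 1))"
  have h: "h > 0" using \<epsilon> C by (simp add: h_def)
  obtain \<theta>0 where \<theta>0: "\<theta>0 > 0" "\<And>x y. x \<in> cball 0 (R + 1) \<Longrightarrow> y \<in> cball 0 (R + 1) \<Longrightarrow>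
      dist x y < \<theta>0 \<Longrightarrow> \<bar>\<psi> x - \<psi> y\<bar> \<le> h"
  proof -
    have "uniformly_continuous_on (cball 0 (R + 1)) \<psi>"
      using \<psi>(1) by (intro compact_uniformly_continuous compact_cball) (auto intro: continuous_on_subset)
    then obtain d where "d > 0" "\<forall>x\<in>cball 0 (R + 1). \<forall>x'\<in>cball 0 (R + 1). dist x' x < d \<longrightarrow> dist (\<psi> x') (\<psi> x) < h"
      using h unfolding uniformly_continuous_on_def by blast
    then show ?thesis using that by (metis dist_real_def less_imp_le)
  qed
  define \<theta> where "\<theta> = min (min 1 (\<theta>0 / 2)) (\<epsilon> / (4 * b * (C + 1)))"
  have \<theta>: "\<theta> > 0" "\<theta> \<le> 1" "\<theta> < \<theta>0" "\<theta> \<le> \<epsilon> / (4 * b * (C + 1))"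
    using \<theta>0(1) \<epsilon> b(1) C by (auto simp: \<theta>_def)
  have osc: "\<bar>\<psi> x - \<psi> y\<bar> \<le> h" if xy: "dist x y \<le> \<theta>" for x y
  proof (cases "\<psi> x > 0 \<or> \<psi> y > 0")
    case True
    then have "norm x \<le> R \<or> norm y \<le> R" using supp by fastforce
    moreover have "norm x \<le> norm y + dist x y" "norm y \<le> norm x + dist x y"
      by (metis dist_norm norm_triangle_sub) (metis dist_commute dist_norm norm_triangle_sub)
    ultimately have "x \<in> cball 0 (R + 1)" "y \<in> cball 0 (R + 1)" using xy \<theta> by auto
    then show ?thesis using \<theta>0(2) xy \<theta>(3) by simp
  next
    case False
    then have "\<psi> x = 0" "\<psi> y = 0" using \<psi>(2)[of x] \<psi>(2)[of y] by auto
    then show ?thesis using h by simp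
  qed
  obtain J :: nat where "b / h \<le> real J" using real_arch_simple by blast
  then have J: "\<psi> x \<le> real J * h" for x
    using b(2)[of x] h by (simp add: field_simps)
  obtain \<delta>' where \<delta>': "\<delta>' > 0" and
    T: "\<forall>f g Gf Gg. tame (R + 1) M f Gf \<longrightarrow> tame (R + 1) M g Gg \<longrightarrow>
     (\<forall>p\<in>cball 0 R. f p = 0 \<longrightarrow> m' \<le> norm (Gf p)) \<longrightarrow>
     (\<forall>x\<in>cball 0 (R + 1). \<bar>f x - g x\<bar> \<le> \<delta>' \<and> norm (Gf x - Gg x) \<le> \<delta>') \<longrightarrow>
     (\<forall>B\<subseteq>cball 0 R. hausdorff1_outer ({x. f x = 0} \<inter> B)
        \<le> ennreal (1 + \<theta>) * hausdorff1_outer ({x. g x = 0} \<inter> {y. \<exists>x\<in>B. dist x y \<le> \<theta>}))"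
    using zero_set_transport[OF M m' \<theta>(1), of R] by (elim exE conjE)
  have transp: "hausdorff1_outer ({x. f x = 0} \<inter> B)
        \<le> ennreal (1 + \<theta>) * hausdorff1_outer ({x. g x = 0} \<inter> {y. \<exists>x\<in>B. dist x y \<le> \<theta>})"
    if "tame (R + 1) M f Gf" "tame (R + 1) M g Gg" "\<forall>p\<in>cball 0 R. f p = 0 \<longrightarrow> m' \<le> norm (Gf p)"
      "\<forall>x\<in>cball 0 (R + 1). \<bar>f x - g x\<bar> \<le> \<delta>' \<and> norm (Gf x - Gg x) \<le> \<delta>'" "B \<subseteq> cball 0 R" for f g Gf Gg B
    by (rule T[THEN spec, THEN spec, THEN spec, THEN spec, THEN mp, THEN mp, THEN mp, THEN mp, THEN spec, THEN mp, OF that])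
  define \<delta>2 where "\<delta>2 = min \<delta>' (m / 2)"
  have \<delta>2: "\<delta>2 > 0" "\<delta>2 \<le> \<delta>'" "\<delta>2 \<le> m / 2" using \<delta>' m by (auto simp: \<delta>2_def)
  \<comment> \<open>The step of the interpolation, chosen to make both error terms at most \<open>\<delta>2 / 2\<close>.\<close>
  define s where "s = min 1 (\<delta>2 / (4 * M))"
  have s: "s > 0" "s \<le> 1" "2 * M * s \<le> \<delta>2 / 2"
  proof -
    show "s > 0" "s \<le> 1" using \<delta>2 M by (auto simp: s_def)
    have "2 * M * s \<le> 2 * M * (\<delta>2 / (4 * M))" using M by (intro mult_left_mono) (auto simp: s_def)
    then show "2 * M * s \<le> \<delta>2 / 2" using M by simp
  qed
  define \<delta> where "\<delta> = min (min \<delta>' (m / 2)) (\<delta>2 * s / 4)"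
  have \<delta>: "\<delta> > 0" "\<delta> \<le> \<delta>'" "\<delta> < m" "2 * \<delta> / s \<le> \<delta>2 / 2"
  proof -
    show "\<delta> > 0" "\<delta> \<le> \<delta>'" "\<delta> < m" using \<delta>' m \<delta>2 s by (auto simp: \<delta>_def)
    have "\<delta> \<le> \<delta>2 * s / 4" by (simp add: \<delta>_def)
    then show "2 * \<delta> / s \<le> \<delta>2 / 2" using s(1) by (simp add: field_simps)
  qed
  show ?thesis
  proof (intro exI[of _ \<delta>] conjI[OF \<delta>(1)] allI impI)
    fix f g assume "perturbation R M m \<delta> f g"
    then obtain Gf Gg where f: "tame (R + 3) M f Gf" and g: "tame (R + 3) M g Gg"
      and nd: "\<forall>p\<in>cball 0 (R + 1). \<bar>f p\<bar> < m \<longrightarrow> m \<le> norm (Gf p)"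
      and cl: "\<forall>x\<in>cball 0 (R + 3). \<bar>f x - g x\<bar> \<le> \<delta>"
      unfolding perturbation_def by (elim exE conjE)
    have f1: "tame (R + 1) M f Gf" and g1: "tame (R + 1) M g Gg"
      using tame_mono[OF f] tame_mono[OF g] by simp_all
    have f2: "tame (R + 1 + 1) M f Gf" and g2: "tame (R + 1 + 1) M g Gg"
      using tame_mono[OF f] tame_mono[OF g] by simp_all
    have grad: "norm (Gf x - Gg x) \<le> \<delta>2" if "x \<in> cball 0 (R + 1)" for x
    proof -
      have "norm (Gf x - Gg x) \<le> 2 * \<delta> / s + 2 * M * s"
        using cl M by (intro gradients_close[OF f2 g2 s(1,2) _ _ that]) auto
      then show ?thesis using s(3) \<delta>(4) by linarith
    qed
    have ndf: "\<forall>p\<in>cball 0 (R + 1). f p = 0 \<longrightarrow> m' \<le> norm (Gf p)"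
    proof (intro ballI impI)
      fix p assume "p \<in> cball 0 (R + 1)" "f p = 0"
      then have "m \<le> norm (Gf p)" using nd m by simp
      then show "m' \<le> norm (Gf p)" using m by (simp add: m'_def)
    qed
    have ndg: "\<forall>p\<in>cball 0 (R + 1). g p = 0 \<longrightarrow> m' \<le> norm (Gg p)"
    proof (intro ballI impI)
      fix p assume p: "p \<in> cball 0 (R + 1)" "g p = 0"
      have "p \<in> cball 0 (R + 3)" using p(1) by simp
      then have "\<bar>f p - g p\<bar> \<le> \<delta>" using cl by blast
      then have "\<bar>f p\<bar> \<le> \<delta>" using p(2) by simp
      then have "m \<le> norm (Gf p)" using nd p(1) \<delta>(3) by simp
      moreover have "norm (Gf p) \<le> norm (Gg p) + norm (Gf p - Gg p)"
        using norm_triangle_ineq[of "Gg p" "Gf p - Gg p"] by simp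
      ultimately show "m' \<le> norm (Gg p)" using grad[OF p(1)] \<delta>2(3) by (simp add: m'_def)
    qed
    have close: "\<forall>x\<in>cball 0 (R + 1). \<bar>f x - g x\<bar> \<le> \<delta>' \<and> norm (Gf x - Gg x) \<le> \<delta>'"
    proof
      fix x :: "real ^ 2" assume x: "x \<in> cball 0 (R + 1)"
      then have "\<bar>f x - g x\<bar> \<le> \<delta>" using cl by simp
      then show "\<bar>f x - g x\<bar> \<le> \<delta>' \<and> norm (Gf x - Gg x) \<le> \<delta>'" using grad[OF x] \<delta>(2) \<delta>2(2) by linarith
    qed
    then have close': "\<forall>x\<in>cball 0 (R + 1). \<bar>g x - f x\<bar> \<le> \<delta>' \<and> norm (Gg x - Gf x) \<le> \<delta>'"
      by (simp add: abs_minus_commute norm_minus_commute)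
    have Zf: "closed {x. f x = 0}" and Zg: "closed {x. g x = 0}"
      using tame_continuous[OF f] tame_continuous[OF g] by (auto intro!: closed_Collect_eq)
    note lenf = len[OF f1 ndf] and leng = len[OF g1 ndg]
    have sub: "cball (0 :: real ^ 2) R \<subseteq> cball 0 (R + 1)" by auto
    have lenf': "hausdorff1_outer ({x. f x = 0} \<inter> cball 0 R) \<le> ennreal C"
      and leng': "hausdorff1_outer ({x. g x = 0} \<inter> cball 0 R) \<le> ennreal C"
      using lenf leng sub by (meson Int_mono order_refl order_trans outer_mono)+
    have L: "1 + \<theta> \<ge> 0" "\<theta> \<ge> 0" using \<theta> by auto
    have fg: "H1_integral \<psi> {x. f x = 0} \<le> ennreal (h * C * (1 + (1 + \<theta>))) + ennreal (1 + \<theta>) * H1_integral \<psi> {x. g x = 0}"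
      using sub ndf
      by (intro H1_integral_comparison[OF \<psi>(1) h J supp osc L(2) \<theta>(2) L(1) Zf Zg lenf' leng C] transp[OF f1 g1 _ close])
         auto
    have gf: "H1_integral \<psi> {x. g x = 0} \<le> ennreal (h * C * (1 + (1 + \<theta>))) + ennreal (1 + \<theta>) * H1_integral \<psi> {x. f x = 0}"
      using sub ndg
      by (intro H1_integral_comparison[OF \<psi>(1) h J supp osc L(2) \<theta>(2) L(1) Zg Zf leng' lenf C] transp[OF g1 f1 _ close'])
         auto
    have bf: "H1_integral \<psi> {x. f x = 0} \<le> ennreal (2 * b * C)"
      by (rule H1_integral_bounded[OF \<psi>(1) b supp Zf lenf' C])
    have bg: "H1_integral \<psi> {x. g x = 0} \<le> ennreal (2 * b * C)"
      by (rule H1_integral_bounded[OF \<psi>(1) b supp Zg leng' C])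
    define x where "x = enn2real (H1_integral \<psi> {x. f x = 0})"
    define y where "y = enn2real (H1_integral \<psi> {x. g x = 0})"
    have finf: "H1_integral \<psi> {x. f x = 0} < top" and fing: "H1_integral \<psi> {x. g x = 0} < top"
      using bf bg by (auto intro: order.strict_trans1)
    have x: "H1_integral \<psi> {x. f x = 0} = ennreal x" "x \<ge> 0" and y: "H1_integral \<psi> {x. g x = 0} = ennreal y" "y \<ge> 0"
      using finf fing by (simp_all add: x_def y_def)
    define e where "e = h * C * (1 + (1 + \<theta>))"
    have e0: "e \<ge> 0" using h C \<theta> by (simp add: e_def)
    have 1: "x \<le> e + (1 + \<theta>) * y" "y \<le> e + (1 + \<theta>) * x" "x \<le> 2 * b * C" "y \<le> 2 * b * C"
    proof -
      have pe: "ennreal (e + (1 + \<theta>) * z) = ennreal e + ennreal (1 + \<theta>) * ennreal z" if "z \<ge> 0" for z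
        using e0 \<theta> that by (simp add: ennreal_mult[symmetric] ennreal_plus[symmetric] del: ennreal_plus)
      have "ennreal x \<le> ennreal (e + (1 + \<theta>) * y)"
        using fg unfolding x(1) y(1) e_def[symmetric] pe[OF y(2)] .
      then show "x \<le> e + (1 + \<theta>) * y" using e0 y \<theta> by (subst (asm) ennreal_le_iff) auto
      have "ennreal y \<le> ennreal (e + (1 + \<theta>) * x)"
        using gf unfolding x(1) y(1) e_def[symmetric] pe[OF x(2)] .
      then show "y \<le> e + (1 + \<theta>) * x" using e0 x \<theta> by (subst (asm) ennreal_le_iff) auto
      show "x \<le> 2 * b * C" "y \<le> 2 * b * C"
        using bf bg x y b(1) C by (simp_all add: ennreal_le_iff)
    qed
    have "e \<le> \<epsilon> / 2"
    proof -
      have "e \<le> h * C * 3" using h C \<theta> unfolding e_def by (intro mult_left_mono) auto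
      also have "\<dots> \<le> h * (C + 1) * 3" using h by simp
      also have "\<dots> = \<epsilon> / 2" using C by (simp add: h_def field_simps)
      finally show ?thesis .
    qed
    moreover have "\<theta> * (2 * b * C) \<le> \<epsilon> / 2"
    proof -
      have "\<theta> * (2 * b * C) \<le> \<epsilon> / (4 * b * (C + 1)) * (2 * b * (C + 1))"
        using \<theta> b(1) C \<epsilon> by (intro mult_mono) auto
      also have "\<dots> = \<epsilon> / 2"
      proof -
        define d where "d = b * (C + 1)"
        have "d > 0" using b(1) C by (simp add: d_def)
        then have "\<epsilon> / (4 * d) * (2 * d) = \<epsilon> / 2" by simp
        then show ?thesis by (simp add: d_def mult.assoc)
      qed
      finally show ?thesis .
    qed
    moreover have "\<theta> * y \<le> \<theta> * (2 * b * C)" "\<theta> * x \<le> \<theta> * (2 * b * C)"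
      using 1(3,4) \<theta> by (auto intro: mult_left_mono)
    ultimately have "\<bar>x - y\<bar> \<le> \<epsilon>" using 1(1,2) by (simp add: algebra_simps abs_le_iff)
    then show "H1_integral \<psi> {x. f x = 0} < top \<and> H1_integral \<psi> {x. g x = 0} < top \<and>
     \<bar>enn2real (H1_integral \<psi> {x. f x = 0}) - enn2real (H1_integral \<psi> {x. g x = 0})\<bar> \<le> \<epsilon>"
      using finf fing by (simp add: x_def y_def)
  qed
qed


lemma signed_integral_stable:
  assumes \<phi>: "continuous_on UNIV \<phi>" and supp: "\<And>x. \<phi> x \<noteq> 0 \<Longrightarrow> x \<in> cball 0 R"
    and M: "M > 0" and m: "m > 0" and \<epsilon>: "\<epsilon> > 0"
  shows "\<exists>\<delta>>0. \<forall>f g. perturbation R M m \<delta> f g \<longrightarrow>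
     \<bar>signed_integral \<phi> {x. f x = 0} - signed_integral \<phi> {x. g x = 0}\<bar> \<le> \<epsilon>"
proof -
  let ?p = "\<lambda>x. max 0 (\<phi> x)" and ?q = "\<lambda>x. max 0 (- \<phi> x)"
  have cp: "continuous_on UNIV ?p" and cq: "continuous_on UNIV ?q"
    using \<phi> by (auto intro!: continuous_intros)
  have e2: "\<epsilon> / 2 > 0" using \<epsilon> by simp
  have sp: "x \<in> cball 0 R" if "?p x > 0" for x using that by (intro supp) auto
  have sq: "x \<in> cball 0 R" if "?q x > 0" for x using that by (intro supp) auto
  have p0: "0 \<le> ?p x" and q0: "0 \<le> ?q x" for x by simp_all
  obtain \<delta>1 where \<delta>1: "\<delta>1 > 0" and P: "\<And>f g. perturbation R M m \<delta>1 f g \<Longrightarrow>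
     H1_integral ?p {x. f x = 0} < top \<and> H1_integral ?p {x. g x = 0} < top \<and>
     \<bar>enn2real (H1_integral ?p {x. f x = 0}) - enn2real (H1_integral ?p {x. g x = 0})\<bar> \<le> \<epsilon> / 2"
    using H1_integral_stable[of ?p R, OF cp p0 _ M m e2] sp by blast
  obtain \<delta>2 where \<delta>2: "\<delta>2 > 0" and Q: "\<And>f g. perturbation R M m \<delta>2 f g \<Longrightarrow>
     H1_integral ?q {x. f x = 0} < top \<and> H1_integral ?q {x. g x = 0} < top \<and>
     \<bar>enn2real (H1_integral ?q {x. f x = 0}) - enn2real (H1_integral ?q {x. g x = 0})\<bar> \<le> \<epsilon> / 2"
    using H1_integral_stable[of ?q R, OF cq q0 _ M m e2] sq by blast
  show ?thesis
  proof (intro exI[of _ "min \<delta>1 \<delta>2"] conjI allI impI)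
    fix f g assume fg: "perturbation R M m (min \<delta>1 \<delta>2) f g"
    note P' = P[OF perturbation_mono[OF fg min.cobounded1]] and Q' = Q[OF perturbation_mono[OF fg min.cobounded2]]
    have "signed_integral \<phi> {x. f x = 0} = enn2real (H1_integral ?p {x. f x = 0}) - enn2real (H1_integral ?q {x. f x = 0})"
      "signed_integral \<phi> {x. g x = 0} = enn2real (H1_integral ?p {x. g x = 0}) - enn2real (H1_integral ?q {x. g x = 0})"
      using P' Q' by (simp_all add: signed_integral_def)
    then show "\<bar>signed_integral \<phi> {x. f x = 0} - signed_integral \<phi> {x. g x = 0}\<bar> \<le> \<epsilon>"
      using P' Q' by linarith
  qed (use \<delta>1 \<delta>2 in simp)
qed

section \<open>Lattice points on a circle\<close>

definition dir :: "nat \<Rightarrow> int ^ 2 \<Rightarrow> real ^ 2" where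
  "dir n l = lat l /\<^sub>R sqrt (real n)"

definition half_freqs :: "nat \<Rightarrow> (int ^ 2) set" where
  "half_freqs n = {l \<in> freqs n. 0 < l $ 1 \<or> (l $ 1 = 0 \<and> 0 < l $ 2)}"

lemma finite_freqs [simp]: "finite (freqs n)"
proof -
  have b: "\<bar>x\<bar> \<le> int n" if "x\<^sup>2 + y\<^sup>2 = int n" for x y :: int
  proof (cases "x = 0")
    case False
    then have "\<bar>x\<bar> * 1 \<le> \<bar>x\<bar> * \<bar>x\<bar>" by (intro mult_left_mono) auto
    also have "\<dots> = x\<^sup>2" by (simp add: power2_eq_square)
    also have "\<dots> \<le> int n" using that by (smt (verit) zero_le_power2)
    finally show ?thesis by simp
  qed simp
  have "(\<lambda>l. (l $ 1, l $ 2)) ` freqs n \<subseteq> {- int n..int n} \<times> {- int n..int n}"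
  proof (clarsimp simp: freqs_def)
    fix l :: "int ^ 2" assume "(l $ 1)\<^sup>2 + (l $ 2)\<^sup>2 = int n"
    then show "- int n \<le> l $ 1 \<and> l $ 1 \<le> int n \<and> - int n \<le> l $ 2 \<and> l $ 2 \<le> int n"
      using b[of "l $ 1" "l $ 2"] b[of "l $ 2" "l $ 1"] by (auto simp: abs_le_iff add.commute)
  qed
  then have "finite ((\<lambda>l. (l $ 1, l $ 2)) ` freqs n)" by (rule finite_subset) auto
  moreover have "inj_on (\<lambda>l :: int ^ 2. (l $ 1, l $ 2)) (freqs n)"
    by (auto simp: inj_on_def vec_eq_iff forall_2)
  ultimately show ?thesis by (rule finite_imageD)
qed

lemma finite_half_freqs [simp]: "finite (half_freqs n)"
  by (simp add: half_freqs_def)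

lemma freqs_uminus: "- l \<in> freqs n \<longleftrightarrow> l \<in> freqs n"
  by (simp add: freqs_def)

lemma freqs_nonzero: "n > 0 \<Longrightarrow> l \<in> freqs n \<Longrightarrow> l \<noteq> 0"
  by (auto simp: freqs_def)

lemma half_freqs_disjoint: "half_freqs n \<inter> uminus ` half_freqs n = {}"
  by (auto simp: half_freqs_def)

lemma zero_notin_half_freqs: "0 \<notin> half_freqs n"
  by (simp add: half_freqs_def)

lemma freqs_eq_half:
  assumes "n > 0"
  shows "freqs n = half_freqs n \<union> uminus ` half_freqs n"
proof (intro equalityI subsetI)
  fix l assume l: "l \<in> freqs n"
  have nz: "l $ 1 \<noteq> 0 \<or> l $ 2 \<noteq> 0" using l assms by (auto simp: freqs_def)
  show "l \<in> half_freqs n \<union> uminus ` half_freqs n"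
  proof (cases "0 < l $ 1 \<or> (l $ 1 = 0 \<and> 0 < l $ 2)")
    case True
    then show ?thesis using l by (simp add: half_freqs_def)
  next
    case False
    then have "- l \<in> half_freqs n" using l nz by (auto simp: half_freqs_def freqs_uminus)
    then have "- (- l) \<in> uminus ` half_freqs n" by (rule imageI)
    then show ?thesis by simp
  qed
qed (auto simp: half_freqs_def freqs_uminus)

lemma sum_freqs_half:
  fixes g :: "int ^ 2 \<Rightarrow> 'b::comm_monoid_add"
  assumes "n > 0"
  shows "(\<Sum>l\<in>freqs n. g l) = (\<Sum>l\<in>half_freqs n. g l + g (- l))"
proof -
  have "(\<Sum>l\<in>freqs n. g l) = (\<Sum>l\<in>half_freqs n. g l) + (\<Sum>l\<in>uminus ` half_freqs n. g l)"
    unfolding freqs_eq_half[OF assms] by (rule sum.union_disjoint) (auto simp: half_freqs_disjoint)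
  also have "(\<Sum>l\<in>uminus ` half_freqs n. g l) = (\<Sum>l\<in>half_freqs n. g (- l))"
    by (subst sum.reindex) (auto simp: inj_on_def)
  finally show ?thesis by (simp add: sum.distrib)
qed

lemma lat_uminus: "lat (- l) = - lat l"
  by (simp add: lat_def vec_eq_iff)

lemma dir_uminus: "dir n (- l) = - dir n l"
  by (simp add: dir_def lat_uminus)

lemma norm_dir:
  assumes "n > 0" "l \<in> freqs n"
  shows "norm (dir n l) = 1"
proof -
  have "(norm (lat l))\<^sup>2 = real_of_int ((l $ 1)\<^sup>2 + (l $ 2)\<^sup>2)"
    by (simp add: norm_vec2 lat_def)
  also have "\<dots> = real n" using assms(2) by (simp add: freqs_def)
  finally have "norm (lat l) = sqrt (real n)" by (metis norm_ge_zero real_sqrt_unique)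
  then show ?thesis using assms(1) by (simp add: dir_def)
qed

lemma dir_component_le:
  assumes "n > 0" "l \<in> freqs n"
  shows "\<bar>dir n l $ i\<bar> \<le> 1"
  using component_le_norm_cart[of "dir n l" i] norm_dir[OF assms] by simp

text \<open>The lattice points on a circle are invariant under the quarter turn, and the squared components of a
vector along two orthogonal unit vectors add up to its squared norm. Hence the directions are
isotropic to second order for every single \<open>n\<close>.\<close>
lemma sum_dir_squares:
  assumes "n > 0"
  shows "(\<Sum>l\<in>freqs n. (z \<bullet> dir n l)\<^sup>2) = real (num_freqs n) / 2 * (norm z)\<^sup>2"
proof -
  \<comment> \<open>The quarter turn and its inverse.\<close>
  define rot where "rot l = ((\<chi> i. if i = 1 then - (l $ 2) else l $ 1) :: int ^ 2)" for l :: "int ^ 2"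
  define rot' where "rot' l = ((\<chi> i. if i = 1 then l $ 2 else - (l $ 1)) :: int ^ 2)" for l :: "int ^ 2"
  let ?S = "\<Sum>l\<in>freqs n. (z \<bullet> dir n l)\<^sup>2"
  have S: "(\<Sum>l\<in>freqs n. (z \<bullet> dir n (rot l))\<^sup>2) = ?S"
    by (rule sum.reindex_bij_witness[of _ rot' rot])
      (auto simp: rot_def rot'_def freqs_def vec_eq_iff forall_2 add.commute)
  have each: "(z \<bullet> dir n l)\<^sup>2 + (z \<bullet> dir n (rot l))\<^sup>2 = (norm z)\<^sup>2" if "l \<in> freqs n" for l
  proof -
    have rot: "dir n (rot l) $ 1 = - (dir n l $ 2)" "dir n (rot l) $ 2 = dir n l $ 1"
      by (simp_all add: dir_def lat_def rot_def)
    have "(z \<bullet> dir n l)\<^sup>2 + (z \<bullet> dir n (rot l))\<^sup>2 = (norm z)\<^sup>2 * (norm (dir n l))\<^sup>2"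
      unfolding norm_vec2 inner_vec2 rot by (simp add: power2_eq_square algebra_simps)
    then show ?thesis using norm_dir[OF assms that] by simp
  qed
  have "?S + ?S = (\<Sum>l\<in>freqs n. (z \<bullet> dir n l)\<^sup>2 + (z \<bullet> dir n (rot l))\<^sup>2)"
    by (simp add: sum.distrib S)
  also have "\<dots> = (\<Sum>l\<in>freqs n. (norm z)\<^sup>2)" by (intro sum.cong refl each)
  finally show ?thesis by (simp add: num_freqs_def)
qed

section \<open>Gaussian coefficients\<close>

text \<open>The space of the coefficients; all bounds below hold for every energy \<open>n\<close> with the same constants.\<close>
locale random_wave = prob_space M for M :: "'w measure" +
  fixes a :: "int ^ 2 \<Rightarrow> 'w \<Rightarrow> complex"
  assumes coeff: "wave_coefficients M a"
begin

lemma gaussian: "l \<noteq> 0 \<Longrightarrow> standard_complex_gaussian M (a l)"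
  using coeff by (simp add: wave_coefficients_def)

lemma a_measurable [measurable]: "l \<noteq> 0 \<Longrightarrow> a l \<in> borel_measurable M"
  using gaussian by (simp add: standard_complex_gaussian_def)

lemma a_uminus: "l \<noteq> 0 \<Longrightarrow> w \<in> space M \<Longrightarrow> a (- l) w = cnj (a l w)"
  using coeff by (simp add: wave_coefficients_def)

lemma a_indep: "0 \<notin> H \<Longrightarrow> H \<inter> uminus ` H = {} \<Longrightarrow> indep_vars (\<lambda>_. borel) a H"
  using coeff by (simp add: wave_coefficients_def)

lemma half_normal_moments:
  assumes D: "distributed M lborel X (normal_density 0 (sqrt (1 / 2)))"
  shows "integrable M X" "expectation X = 0" "integrable M (\<lambda>w. (X w)\<^sup>2)" "expectation (\<lambda>w. (X w)\<^sup>2) = 1 / 2"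
proof -
  have s: "0 < sqrt (1 / 2 :: real)" by simp
  show "integrable M X"
    using integrable_normal_moment_nz_1[OF s, of 0] distributed_integrable[OF D, of "\<lambda>x. x"] by simp
  show E: "expectation X = 0" by (rule normal_distributed_expectation[OF s D])
  show "integrable M (\<lambda>w. (X w)\<^sup>2)"
    using integrable_normal_moment[OF s, of 0 2] distributed_integrable[OF D, of "\<lambda>x. x\<^sup>2"] by simp
  have "variance X = 1 / 2" using normal_distributed_variance[OF s D] by simp
  then show "expectation (\<lambda>w. (X w)\<^sup>2) = 1 / 2" by (simp add: E)
qed

lemma a_moments:
  assumes "l \<noteq> 0"
  shows "integrable M (a l)" "expectation (\<lambda>w. a l w) = 0"
    "integrable M (\<lambda>w. a l w * cnj (a l w))" "expectation (\<lambda>w. a l w * cnj (a l w)) = 1"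
proof -
  have Re: "distributed M lborel (\<lambda>w. Re (a l w)) (normal_density 0 (sqrt (1 / 2)))"
    and Im: "distributed M lborel (\<lambda>w. Im (a l w)) (normal_density 0 (sqrt (1 / 2)))"
    using gaussian[OF assms] by (auto simp: standard_complex_gaussian_def)
  note mRe = half_normal_moments[OF Re] and mIm = half_normal_moments[OF Im]
  have eq: "a l = (\<lambda>w. complex_of_real (Re (a l w)) + \<i> * complex_of_real (Im (a l w)))"
    by (simp add: complex_eq_iff fun_eq_iff)
  show "integrable M (a l)"
    by (subst eq) (intro Bochner_Integration.integrable_add integrable_mult_right integrable_of_real mRe mIm)
  have "expectation (\<lambda>w. a l w) = expectation (\<lambda>w. complex_of_real (Re (a l w)) + \<i> * complex_of_real (Im (a l w)))"
    by (subst eq) (rule refl)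
  also have "\<dots> = of_real (expectation (\<lambda>w. Re (a l w))) + \<i> * of_real (expectation (\<lambda>w. Im (a l w)))"
    by (subst Bochner_Integration.integral_add) (auto simp: mRe mIm)
  finally show "expectation (\<lambda>w. a l w) = 0" by (simp add: mRe mIm)
  have sq: "(\<lambda>w. a l w * cnj (a l w)) = (\<lambda>w. complex_of_real ((Re (a l w))\<^sup>2 + (Im (a l w))\<^sup>2))"
    by (simp add: complex_mult_cnj fun_eq_iff)
  show "integrable M (\<lambda>w. a l w * cnj (a l w))"
    unfolding sq by (intro integrable_of_real Bochner_Integration.integrable_add mRe mIm)
  show "expectation (\<lambda>w. a l w * cnj (a l w)) = 1"
    unfolding sq integral_complex_of_real
    by (subst Bochner_Integration.integral_add) (simp_all add: mRe mIm)
qed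

lemma a_orthogonal:
  assumes "l \<noteq> 0" "m \<noteq> 0" "l \<noteq> m" "l \<noteq> - m"
  shows "integrable M (\<lambda>w. a l w * cnj (a m w))" "expectation (\<lambda>w. a l w * cnj (a m w)) = 0"
proof -
  let ?Y = "\<lambda>i z. if i = l then z else cnj z"
  have "l \<noteq> - l" "m \<noteq> - m" using assms(1,2) by (auto simp: vec_eq_iff)
  moreover have "m \<noteq> - l" using assms(4) by (metis minus_minus)
  ultimately have "l \<noteq> - l" "m \<noteq> - m" "m \<noteq> - l" by blast+
  then have "{l, m} \<inter> uminus ` {l, m} = {}"
    using assms(4) unfolding image_insert image_empty by (metis Int_insert_left_if0 Int_empty_left insert_iff empty_iff)
  then have "indep_vars (\<lambda>_. borel) a {l, m}"
    using assms(1,2) by (intro a_indep) auto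
  then have ind: "indep_vars (\<lambda>_. borel) (\<lambda>i w. ?Y i (a i w)) {l, m}"
  proof (rule indep_vars_compose2)
    show "?Y i \<in> borel_measurable borel" for i
      by (cases "i = l") (auto intro!: borel_measurable_continuous_onI continuous_intros)
  qed
  have int: "integrable M (\<lambda>w. ?Y i (a i w))" if "i \<in> {l, m}" for i
    using that assms a_moments(1)[of l] a_moments(1)[of m] by auto
  have prod: "(\<Prod>i\<in>{l, m}. ?Y i (a i w)) = a l w * cnj (a m w)" for w using assms(3) by simp
  show "integrable M (\<lambda>w. a l w * cnj (a m w))"
    using indep_vars_integrable[OF _ ind int] by (simp only: prod finite.intros)
  have "expectation (\<lambda>w. a l w * cnj (a m w)) = (\<Prod>i\<in>{l, m}. expectation (\<lambda>w. ?Y i (a i w)))"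
    using indep_vars_lebesgue_integral[OF _ ind int] by (simp only: prod finite.intros)
  also have "\<dots> = 0" using assms a_moments(2)[of l] by simp
  finally show "expectation (\<lambda>w. a l w * cnj (a m w)) = 0" .
qed

lemma half_sum_second_moment:
  assumes H: "finite H" "0 \<notin> H" "H \<inter> uminus ` H = {}"
  shows "integrable M (\<lambda>w. (cmod (\<Sum>l\<in>H. c l * a l w))\<^sup>2)"
    "expectation (\<lambda>w. (cmod (\<Sum>l\<in>H. c l * a l w))\<^sup>2) = (\<Sum>l\<in>H. (cmod (c l))\<^sup>2)"
proof -
  have ort: "integrable M (\<lambda>w. a l w * cnj (a m w))"
      "expectation (\<lambda>w. a l w * cnj (a m w)) = (if l = m then 1 else 0)" if "l \<in> H" "m \<in> H" for l m
  proof -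
    have nz: "l \<noteq> 0" "m \<noteq> 0" using that H(2) by auto
    have "l \<noteq> - m" using that H(3) by auto
    then show "integrable M (\<lambda>w. a l w * cnj (a m w))"
      "expectation (\<lambda>w. a l w * cnj (a m w)) = (if l = m then 1 else 0)"
      using a_moments(3,4)[OF nz(1)] a_orthogonal[OF nz] by (cases "l = m"; simp)+
  qed
  have sq: "complex_of_real ((cmod (\<Sum>l\<in>H. c l * a l w))\<^sup>2)
      = (\<Sum>l\<in>H. \<Sum>m\<in>H. c l * cnj (c m) * (a l w * cnj (a m w)))" for w
  proof -
    have "complex_of_real ((cmod (\<Sum>l\<in>H. c l * a l w))\<^sup>2)
        = (\<Sum>l\<in>H. c l * a l w) * cnj (\<Sum>l\<in>H. c l * a l w)"
      by (simp only: complex_norm_square)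
    also have "\<dots> = (\<Sum>l\<in>H. \<Sum>m\<in>H. (c l * a l w) * cnj (c m * a m w))"
      by (simp add: sum_product)
    finally show ?thesis by (simp add: mult_ac)
  qed
  have int: "integrable M (\<lambda>w. complex_of_real ((cmod (\<Sum>l\<in>H. c l * a l w))\<^sup>2))"
    unfolding sq by (intro Bochner_Integration.integrable_sum integrable_mult_right ort)
  then show int': "integrable M (\<lambda>w. (cmod (\<Sum>l\<in>H. c l * a l w))\<^sup>2)"
    by (simp only: complex_of_real_integrable_eq)
  have "complex_of_real (expectation (\<lambda>w. (cmod (\<Sum>l\<in>H. c l * a l w))\<^sup>2))
      = expectation (\<lambda>w. complex_of_real ((cmod (\<Sum>l\<in>H. c l * a l w))\<^sup>2))"
    by (rule integral_complex_of_real[symmetric])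
  also have "\<dots> = expectation (\<lambda>w. \<Sum>l\<in>H. \<Sum>m\<in>H. c l * cnj (c m) * (a l w * cnj (a m w)))"
    unfolding sq ..
  also have "\<dots> = (\<Sum>l\<in>H. \<Sum>m\<in>H. c l * cnj (c m) * expectation (\<lambda>w. a l w * cnj (a m w)))"
    by (simp add: Bochner_Integration.integral_sum ort(1))
  also have "\<dots> = (\<Sum>l\<in>H. \<Sum>m\<in>H. if l = m then c l * cnj (c m) else 0)"
    by (intro sum.cong refl) (simp add: ort(2))
  also have "\<dots> = (\<Sum>l\<in>H. c l * cnj (c l))"
    using H(1) by simp
  also have "\<dots> = complex_of_real (\<Sum>l\<in>H. (cmod (c l))\<^sup>2)"
    by (simp only: of_real_sum complex_norm_square)
  finally show "expectation (\<lambda>w. (cmod (\<Sum>l\<in>H. c l * a l w))\<^sup>2) = (\<Sum>l\<in>H. (cmod (c l))\<^sup>2)"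
    by (simp only: of_real_eq_iff)
qed

lemma half_normal_char:
  assumes D: "distributed M lborel X (normal_density 0 (sqrt (1 / 2)))"
  shows "expectation (\<lambda>w. iexp (t * X w)) = of_real (exp (- t\<^sup>2 / 4))"
proof -
  have s: "0 < sqrt (1 / 2 :: real)" by simp
  have N: "distributed M lborel (\<lambda>w. X w / sqrt (1 / 2)) std_normal_density"
    using normal_standard_normal_convert[OF s, of X 0] D by simp
  have meas: "(\<lambda>w. X w / sqrt (1 / 2)) \<in> measurable M lborel"
    using distributed_measurable[OF N] .
  have "expectation (\<lambda>w. iexp (t * X w)) = expectation (\<lambda>w. iexp (t * sqrt (1 / 2) * (X w / sqrt (1 / 2))))"
    by simp
  also have "\<dots> = (\<integral>x. iexp (t * sqrt (1 / 2) * x) \<partial>distr M lborel (\<lambda>w. X w / sqrt (1 / 2)))"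
    by (rule integral_distr[symmetric, OF meas]) measurable
  also have "\<dots> = char std_normal_distribution (t * sqrt (1 / 2))"
    unfolding distributed_distr_eq_density[OF N] char_def ..
  also have "\<dots> = of_real (exp (- t\<^sup>2 / 4))"
    unfolding char_std_normal_distribution by (simp add: power_mult_distrib)
  finally show ?thesis .
qed

lemma a_char:
  assumes "l \<noteq> 0"
  shows "expectation (\<lambda>w. iexp (Re (d * a l w))) = of_real (exp (- (cmod d)\<^sup>2 / 4))"
proof -
  have Re: "distributed M lborel (\<lambda>w. Re (a l w)) (normal_density 0 (sqrt (1 / 2)))"
    and Im: "distributed M lborel (\<lambda>w. Im (a l w)) (normal_density 0 (sqrt (1 / 2)))"
    and ind: "indep_var borel (\<lambda>w. Re (a l w)) borel (\<lambda>w. Im (a l w))"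
    using gaussian[OF assms] by (auto simp: standard_complex_gaussian_def)
  note [measurable] = a_measurable[OF assms]
  have ind': "indep_var borel ((\<lambda>x. iexp (Re d * x)) \<circ> (\<lambda>w. Re (a l w))) borel ((\<lambda>x. iexp (- Im d * x)) \<circ> (\<lambda>w. Im (a l w)))"
    by (rule indep_var_compose[OF ind]) measurable
  have int: "integrable M (\<lambda>w. iexp (s * X w))" if [measurable]: "X \<in> borel_measurable M" for s and X :: "'w \<Rightarrow> real"
    by (intro integrable_const_bound[where B = 1]) auto
  have "expectation (\<lambda>w. iexp (Re (d * a l w)))
     = expectation (\<lambda>w. iexp (Re d * Re (a l w)) * iexp (- Im d * Im (a l w)))"
    by (simp add: exp_add[symmetric] algebra_simps)
  also have "\<dots> = expectation (\<lambda>w. iexp (Re d * Re (a l w))) * expectation (\<lambda>w. iexp (- Im d * Im (a l w)))"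
    by (rule indep_var_lebesgue_integral[OF ind'[unfolded comp_def] int int]) measurable
  also have "\<dots> = of_real (exp (- (Re d)\<^sup>2 / 4) * exp (- (- Im d)\<^sup>2 / 4))"
    unfolding half_normal_char[OF Re] half_normal_char[OF Im] by (rule of_real_mult[symmetric])
  also have "exp (- (Re d)\<^sup>2 / 4) * exp (- (- Im d)\<^sup>2 / 4) = exp (- (cmod d)\<^sup>2 / 4)"
    by (simp add: exp_add[symmetric] cmod_power2 field_simps)
  finally show ?thesis .
qed

text \<open>In terms of characteristic functions the sum is Gaussian also when all coefficients vanish and it has
no density.\<close>
lemma half_sum_char:
  assumes H: "finite H" "0 \<notin> H" "H \<inter> uminus ` H = {}"
  shows "expectation (\<lambda>w. iexp (Re (\<Sum>l\<in>H. d l * a l w))) = of_real (exp (- (\<Sum>l\<in>H. (cmod (d l))\<^sup>2) / 4))"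
proof -
  have ind: "indep_vars (\<lambda>_. borel) (\<lambda>l w. iexp (Re (d l * a l w))) H"
    by (rule indep_vars_compose2[OF a_indep[OF H(2,3)]]) measurable
  have int: "integrable M (\<lambda>w. iexp (Re (d l * a l w)))" if "l \<in> H" for l
  proof -
    have [measurable]: "a l \<in> borel_measurable M" using that H(2) by (intro a_measurable) auto
    show ?thesis by (intro integrable_const_bound[where B = 1]) auto
  qed
  have "expectation (\<lambda>w. iexp (Re (\<Sum>l\<in>H. d l * a l w))) = expectation (\<lambda>w. \<Prod>l\<in>H. iexp (Re (d l * a l w)))"
    using H(1) by (simp add: exp_sum sum_distrib_left)
  also have "\<dots> = (\<Prod>l\<in>H. expectation (\<lambda>w. iexp (Re (d l * a l w))))"
    by (rule indep_vars_lebesgue_integral[OF H(1) ind int])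
  also have "\<dots> = (\<Prod>l\<in>H. of_real (exp (- (cmod (d l))\<^sup>2 / 4)))"
    using H(2) by (intro prod.cong refl a_char) auto
  also have "\<dots> = of_real (exp (\<Sum>l\<in>H. - (cmod (d l))\<^sup>2 / 4))"
    using H(1) by (simp add: exp_sum)
  finally show ?thesis by (simp add: sum_negf sum_divide_distrib)
qed


end

section \<open>Small ball probabilities\<close>

lemma gaussian_damping_le:
  assumes r: "r > 0"
  shows "(\<integral>z. exp (- (r * z)\<^sup>2 / 2) \<partial>std_normal_distribution) \<le> 1 / r"
    "0 \<le> (\<integral>z. exp (- (r * z)\<^sup>2 / 2) \<partial>std_normal_distribution)"
proof -
  have "(\<integral>z. exp (- (r * z)\<^sup>2 / 2) \<partial>std_normal_distribution)
      = (\<integral>z. std_normal_density z * exp (- (r * z)\<^sup>2 / 2) \<partial>lborel)"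
    by (subst integral_real_density) auto
  also have "\<dots> \<le> (\<integral>z. 1 / r * normal_density 0 (1 / r) z \<partial>lborel)"
  proof (rule integral_mono')
    show "integrable lborel (\<lambda>z. 1 / r * normal_density 0 (1 / r) z)"
      using r by (intro integrable_mult_right integrable_normal_density) simp
    fix z
    have "1 / r * normal_density 0 (1 / r) z = 1 / sqrt (2 * pi) * exp (- (r * z)\<^sup>2 / 2)"
      using r by (simp add: normal_density_def real_sqrt_divide real_sqrt_mult field_simps)
    moreover have "std_normal_density z \<le> 1 / sqrt (2 * pi)"
      by (simp add: std_normal_density_def divide_right_mono)
    then have "std_normal_density z * exp (- (r * z)\<^sup>2 / 2) \<le> 1 / sqrt (2 * pi) * exp (- (r * z)\<^sup>2 / 2)"
      by (intro mult_right_mono) auto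
    ultimately show "std_normal_density z * exp (- (r * z)\<^sup>2 / 2) \<le> 1 / r * normal_density 0 (1 / r) z" by simp
    show "0 \<le> 1 / r * normal_density 0 (1 / r) z" using r by simp
  qed
  also have "\<dots> = 1 / r" using r by simp
  finally show "(\<integral>z. exp (- (r * z)\<^sup>2 / 2) \<partial>std_normal_distribution) \<le> 1 / r" .
  show "0 \<le> (\<integral>z. exp (- (r * z)\<^sup>2 / 2) \<partial>std_normal_distribution)"
    by (rule Bochner_Integration.integral_nonneg) simp
qed

text \<open>The Gaussian bump \<open>exp (- x\<^sup>2 / 2)\<close> is the Fourier transform of the Gaussian law, so its expectation
against a random variable is an average of values of the characteristic function.\<close>
lemma (in prob_space) gaussian_smoothing:
  fixes X :: "'a \<Rightarrow> real" and Y :: "'a \<Rightarrow> complex"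
  assumes [measurable]: "X \<in> borel_measurable M" "Y \<in> borel_measurable M" and Y: "\<And>w. cmod (Y w) \<le> 1"
  shows "expectation (\<lambda>w. of_real (exp (- (X w)\<^sup>2 / 2)) * Y w)
    = (\<integral>z. expectation (\<lambda>w. iexp (z * X w) * Y w) \<partial>std_normal_distribution)"
proof -
  interpret N: prob_space std_normal_distribution
    using real_dist_normal_dist by (simp add: real_distribution_def)
  interpret P: pair_prob_space std_normal_distribution M ..
  have "integrable (std_normal_distribution \<Otimes>\<^sub>M M) (\<lambda>(z, w). iexp (z * X w) * Y w)"
  proof (rule P.integrable_const_bound[where B = 1])
    show "AE p in std_normal_distribution \<Otimes>\<^sub>M M. norm (case p of (z, w) \<Rightarrow> iexp (z * X w) * Y w) \<le> 1"
      using Y by (auto simp: norm_mult split: prod.splits)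
  qed measurable
  then have "(\<integral>w. (\<integral>z. iexp (z * X w) * Y w \<partial>std_normal_distribution) \<partial>M)
      = (\<integral>z. expectation (\<lambda>w. iexp (z * X w) * Y w) \<partial>std_normal_distribution)"
    by (rule P.Fubini_integral)
  moreover have "(\<integral>z. iexp (z * X w) * Y w \<partial>std_normal_distribution) = of_real (exp (- (X w)\<^sup>2 / 2)) * Y w" for w
  proof -
    have "(\<integral>z. iexp (z * X w) * Y w \<partial>std_normal_distribution)
        = (\<integral>z. iexp (X w * z) \<partial>std_normal_distribution) * Y w"
      by (simp only: integral_mult_left_zero mult.commute[of _ "X w"])
    also have "(\<integral>z. iexp (X w * z) \<partial>std_normal_distribution) = of_real (exp (- (X w)\<^sup>2 / 2))"
      using char_std_normal_distribution by (simp add: char_def fun_eq_iff)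
    finally show ?thesis .
  qed
  ultimately show ?thesis by (simp only:)
qed

text \<open>The indicator of the cube is at most a constant times a Gaussian bump of width \<open>\<epsilon>\<close>. Smoothing in the
three variables one after the other expresses the expectation of the bump through the joint
characteristic function, which factorises; each factor contributes one power of \<open>\<epsilon>\<close>.\<close>
lemma (in prob_space) small_ball:
  fixes X0 X1 X2 :: "'a \<Rightarrow> real"
  assumes [measurable]: "X0 \<in> borel_measurable M" "X1 \<in> borel_measurable M" "X2 \<in> borel_measurable M"
    and char: "\<And>z0 z1 z2. expectation (\<lambda>w. iexp (z0 * X0 w + z1 * X1 w + z2 * X2 w))
      = of_real (exp (- (z0\<^sup>2 + s\<^sup>2 * z1\<^sup>2 + s\<^sup>2 * z2\<^sup>2) / 2))"
    and s: "s > 0" and \<epsilon>: "\<epsilon> > 0"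
  shows "prob {w \<in> space M. \<bar>X0 w\<bar> \<le> \<epsilon> \<and> \<bar>X1 w\<bar> \<le> \<epsilon> \<and> \<bar>X2 w\<bar> \<le> \<epsilon>} \<le> exp (3 / 2) / s\<^sup>2 * \<epsilon> ^ 3"
proof -
  let ?g = "\<lambda>X w. exp (- (X w / \<epsilon>)\<^sup>2 / 2)" and ?N = std_normal_distribution
  define I where "I r = (\<integral>z. exp (- (r * z)\<^sup>2 / 2) \<partial>?N)" for r :: real
  let ?J = "\<lambda>r z. complex_of_real (exp (- (r * z)\<^sup>2 / 2))"
  have J: "(\<integral>z. ?J r z \<partial>?N) = of_real (I r)" for r
    unfolding I_def by (rule integral_complex_of_real)
  have ie: "cmod (iexp x) = 1" for x by (simp add: norm_exp_i_times)
  have "complex_of_real (expectation (\<lambda>w. ?g X0 w * (?g X1 w * ?g X2 w)))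
      = expectation (\<lambda>w. of_real (?g X0 w) * (of_real (?g X1 w) * of_real (?g X2 w)))"
    by (subst integral_complex_of_real[symmetric]) simp
  also have "\<dots> = (\<integral>z0. expectation (\<lambda>w. iexp (z0 * (X0 w / \<epsilon>)) * (of_real (?g X1 w) * of_real (?g X2 w))) \<partial>?N)"
    by (rule gaussian_smoothing) (auto simp: norm_mult mult_le_one)
  also have "\<dots> = (\<integral>z0. expectation (\<lambda>w. of_real (?g X1 w) * (of_real (?g X2 w) * iexp (z0 * (X0 w / \<epsilon>)))) \<partial>?N)"
    by (simp only: mult_ac)
  also have "\<dots> = (\<integral>z0. \<integral>z1. expectation (\<lambda>w. iexp (z1 * (X1 w / \<epsilon>)) * (of_real (?g X2 w) * iexp (z0 * (X0 w / \<epsilon>)))) \<partial>?N \<partial>?N)"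
    by (intro Bochner_Integration.integral_cong refl gaussian_smoothing) (auto simp: norm_mult)
  also have "\<dots> = (\<integral>z0. \<integral>z1. expectation (\<lambda>w. of_real (?g X2 w) * (iexp (z0 * (X0 w / \<epsilon>)) * iexp (z1 * (X1 w / \<epsilon>)))) \<partial>?N \<partial>?N)"
    by (simp only: mult_ac)
  also have "\<dots> = (\<integral>z0. \<integral>z1. \<integral>z2. expectation (\<lambda>w. iexp (z2 * (X2 w / \<epsilon>)) * (iexp (z0 * (X0 w / \<epsilon>)) * iexp (z1 * (X1 w / \<epsilon>)))) \<partial>?N \<partial>?N \<partial>?N)"
    by (intro Bochner_Integration.integral_cong refl gaussian_smoothing) (auto simp: norm_mult)
  also have "\<dots> = (\<integral>z0. \<integral>z1. \<integral>z2. ?J (1 / \<epsilon>) z0 * (?J (s / \<epsilon>) z1 * ?J (s / \<epsilon>) z2) \<partial>?N \<partial>?N \<partial>?N)"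
  proof (intro Bochner_Integration.integral_cong refl)
    fix z0 z1 z2 :: real
    have "expectation (\<lambda>w. iexp (z2 * (X2 w / \<epsilon>)) * (iexp (z0 * (X0 w / \<epsilon>)) * iexp (z1 * (X1 w / \<epsilon>))))
        = expectation (\<lambda>w. iexp (z0 / \<epsilon> * X0 w + z1 / \<epsilon> * X1 w + z2 / \<epsilon> * X2 w))"
      by (intro Bochner_Integration.integral_cong refl) (simp add: exp_add[symmetric] algebra_simps)
    also have "\<dots> = of_real (exp (- ((z0 / \<epsilon>)\<^sup>2 + s\<^sup>2 * (z1 / \<epsilon>)\<^sup>2 + s\<^sup>2 * (z2 / \<epsilon>)\<^sup>2) / 2))"
      by (rule char)
    also have "exp (- ((z0 / \<epsilon>)\<^sup>2 + s\<^sup>2 * (z1 / \<epsilon>)\<^sup>2 + s\<^sup>2 * (z2 / \<epsilon>)\<^sup>2) / 2)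
        = exp (- (1 / \<epsilon> * z0)\<^sup>2 / 2) * (exp (- (s / \<epsilon> * z1)\<^sup>2 / 2) * exp (- (s / \<epsilon> * z2)\<^sup>2 / 2))"
      by (simp add: exp_add[symmetric] power_mult_distrib power_divide add_divide_distrib)
    finally show "expectation (\<lambda>w. iexp (z2 * (X2 w / \<epsilon>)) * (iexp (z0 * (X0 w / \<epsilon>)) * iexp (z1 * (X1 w / \<epsilon>))))
        = ?J (1 / \<epsilon>) z0 * (?J (s / \<epsilon>) z1 * ?J (s / \<epsilon>) z2)"
      by (simp only: of_real_mult)
  qed
  also have "\<dots> = of_real (I (1 / \<epsilon>) * (I (s / \<epsilon>) * I (s / \<epsilon>)))"
    by (simp only: integral_mult_right_zero integral_mult_left_zero J of_real_mult)
  finally have E: "expectation (\<lambda>w. ?g X0 w * (?g X1 w * ?g X2 w)) = I (1 / \<epsilon>) * (I (s / \<epsilon>) * I (s / \<epsilon>))"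
    by (simp only: of_real_eq_iff)
  also have "\<dots> \<le> 1 / (1 / \<epsilon>) * (1 / (s / \<epsilon>) * (1 / (s / \<epsilon>)))"
    using s \<epsilon> unfolding I_def by (intro mult_mono gaussian_damping_le mult_nonneg_nonneg) auto
  also have "\<dots> = \<epsilon> ^ 3 / s\<^sup>2" by (simp add: power2_eq_square power3_eq_cube)
  finally have Ele: "expectation (\<lambda>w. ?g X0 w * (?g X1 w * ?g X2 w)) \<le> \<epsilon> ^ 3 / s\<^sup>2" .
  let ?A = "{w \<in> space M. \<bar>X0 w\<bar> \<le> \<epsilon> \<and> \<bar>X1 w\<bar> \<le> \<epsilon> \<and> \<bar>X2 w\<bar> \<le> \<epsilon>}"
  have [measurable]: "?A \<in> sets M" by measurable
  have g: "exp (- 1 / 2) \<le> exp (- (x / \<epsilon>)\<^sup>2 / 2)" if "\<bar>x\<bar> \<le> \<epsilon>" for x :: real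
  proof -
    have "\<bar>x / \<epsilon>\<bar> \<le> 1" using that \<epsilon> by simp
    then have "(x / \<epsilon>)\<^sup>2 \<le> 1" by (simp add: abs_square_le_1)
    then show ?thesis by simp
  qed
  have g1: "?g X w \<le> 1" for X and w :: 'a by simp
  have "prob ?A = expectation (indicator ?A)" by simp
  also have "\<dots> \<le> expectation (\<lambda>w. exp (3 / 2) * (?g X0 w * (?g X1 w * ?g X2 w)))"
  proof (rule integral_mono)
    show "integrable M (indicator ?A :: 'a \<Rightarrow> real)" by (intro integrable_real_indicator) (auto simp: less_top[symmetric])
    show "integrable M (\<lambda>w. exp (3 / 2) * (?g X0 w * (?g X1 w * ?g X2 w)))"
      by (intro integrable_mult_right integrable_const_bound[where B = 1]) (auto simp: mult_le_one)
    fix w assume "w \<in> space M"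
    show "indicator ?A w \<le> exp (3 / 2) * (?g X0 w * (?g X1 w * ?g X2 w))"
    proof (cases "w \<in> ?A")
      case True
      have "exp (- 1 / 2) * (exp (- 1 / 2) * exp (- 1 / 2)) \<le> ?g X0 w * (?g X1 w * ?g X2 w)"
        using True by (intro mult_mono g) auto
      moreover have "exp (3 / 2) * (exp (- 1 / 2) * (exp (- 1 / 2) * exp (- 1 / 2))) = (1 :: real)"
        by (simp add: exp_add[symmetric])
      ultimately show ?thesis using True
        mult_left_mono[of "exp (- 1 / 2) * (exp (- 1 / 2) * exp (- 1 / 2))" "?g X0 w * (?g X1 w * ?g X2 w)" "exp (3 / 2)"]
        by simp
    qed simp
  qed
  also have "\<dots> = exp (3 / 2) * expectation (\<lambda>w. ?g X0 w * (?g X1 w * ?g X2 w))" by (rule integral_mult_right_zero)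
  also have "\<dots> \<le> exp (3 / 2) * (\<epsilon> ^ 3 / s\<^sup>2)" using Ele by (intro mult_left_mono) auto
  finally show ?thesis by simp
qed

section \<open>Trigonometric sums\<close>

lemma Re_of_real_mult: "Re (of_real r * z) = r * Re z"
  by simp

text \<open>With coefficients \<open>a l w\<close> this is the rescaled wave; the derivatives and the translates of the wave are
of the same form, with the coefficients multiplied by deterministic numbers of bounded modulus.\<close>
definition trig :: "nat \<Rightarrow> (int ^ 2 \<Rightarrow> complex) \<Rightarrow> real ^ 2 \<Rightarrow> complex" where
  "trig n c t = (\<Sum>l\<in>freqs n. c l * iexp (2 * pi * (dir n l \<bullet> t))) / of_real (sqrt (real (num_freqs n)))"

lemma trig_has_derivative:
  "(trig n c has_derivative (\<lambda>h. trig n (\<lambda>l. c l * (\<i> * of_real (2 * pi * (dir n l \<bullet> h)))) t)) (at t)"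
proof -
  have "((\<lambda>t. iexp (2 * pi * (dir n l \<bullet> t))) has_derivative
      (\<lambda>h. iexp (2 * pi * (dir n l \<bullet> t)) * (\<i> * of_real (2 * pi * (dir n l \<bullet> h))))) (at t)" for l
  proof -
    have "((\<lambda>t. \<i> * complex_of_real (2 * pi * (dir n l \<bullet> t))) has_derivative
        (\<lambda>h. \<i> * complex_of_real (2 * pi * (dir n l \<bullet> h)))) (at t)"
      by (intro derivative_intros)
    then show ?thesis
      by (rule has_derivative_compose) (rule has_field_derivative_imp_has_derivative[OF DERIV_exp])
  qed
  then have "((\<lambda>t. (\<Sum>l\<in>freqs n. c l * iexp (2 * pi * (dir n l \<bullet> t))) * inverse (of_real (sqrt (real (num_freqs n))))) has_derivative
      (\<lambda>h. (\<Sum>l\<in>freqs n. c l * (iexp (2 * pi * (dir n l \<bullet> t)) * (\<i> * of_real (2 * pi * (dir n l \<bullet> h))))) * inverse (of_real (sqrt (real (num_freqs n)))))) (at t)"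
    by (intro has_derivative_mult_left has_derivative_sum has_derivative_mult_right)
  then show ?thesis
    unfolding trig_def divide_inverse by (simp add: mult_ac)
qed

lemma trig_Re_has_derivative:
  "((\<lambda>t. Re (trig n c t)) has_derivative
     (\<lambda>h. (\<chi> i. Re (trig n (\<lambda>l. c l * (\<i> * of_real (2 * pi * dir n l $ i))) t)) \<bullet> h)) (at t)"
proof -
  have "Re (trig n (\<lambda>l. c l * (\<i> * of_real (2 * pi * (dir n l \<bullet> h)))) t)
      = (\<chi> i. Re (trig n (\<lambda>l. c l * (\<i> * of_real (2 * pi * dir n l $ i))) t)) \<bullet> h" for h
  proof -
    let ?t = "\<lambda>i. trig n (\<lambda>l. c l * (\<i> * of_real (2 * pi * dir n l $ i))) t"
    have "trig n (\<lambda>l. c l * (\<i> * of_real (2 * pi * (dir n l \<bullet> h)))) t = ?t 1 * of_real (h $ 1) + ?t 2 * of_real (h $ 2)"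
      unfolding trig_def inner_vec2[of _ h] times_divide_eq_left sum_distrib_right add_divide_distrib[symmetric] sum.distrib[symmetric]
      by (intro arg_cong2[where f = "(/)"] sum.cong refl) (simp add: algebra_simps)
    then show ?thesis by (simp add: inner_vec2)
  qed
  then show ?thesis
    using has_derivative_Re[OF trig_has_derivative[of n c t]] by simp
qed

lemma norm_sums_le_ennreal:
  fixes f :: "nat \<Rightarrow> 'a::banach"
  assumes "f sums s"
  shows "ennreal (norm s) \<le> (\<Sum>k. ennreal (norm (f k)))"
proof (cases "(\<Sum>k. ennreal (norm (f k))) = top")
  case False
  then have sm: "summable (\<lambda>k. norm (f k))" by (intro summable_suminf_not_top) auto
  have "norm s \<le> (\<Sum>k. norm (f k))" using summable_norm[OF sm] sums_unique[OF assms] by simp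
  then show ?thesis using sm by (subst suminf_ennreal2) (auto intro: ennreal_leI)
qed simp

text \<open>Expanding the exponentials separates the point \<open>x\<close> from the coefficients: the right hand side bounds
the sum for all \<open>x\<close> in an interval at once, through countably many sums without \<open>x\<close>.\<close>
lemma exponential_sum_le:
  fixes c :: "'b \<Rightarrow> complex" and \<theta> :: "'b \<Rightarrow> real"
  assumes x: "\<bar>x\<bar> \<le> \<rho>"
  shows "ennreal (cmod (\<Sum>l\<in>S. c l * iexp (x * \<theta> l)))
    \<le> (\<Sum>k. ennreal (\<rho> ^ k / fact k) * ennreal (cmod (\<Sum>l\<in>S. c l * of_real (\<theta> l ^ k))))"
proof -
  have \<rho>: "\<rho> \<ge> 0" using x by linarith
  have "(\<lambda>k. \<Sum>l\<in>S. c l * ((\<i> * of_real (x * \<theta> l)) ^ k /\<^sub>R fact k)) sums (\<Sum>l\<in>S. c l * iexp (x * \<theta> l))"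
    by (intro sums_sum sums_mult exp_converges)
  then have "ennreal (cmod (\<Sum>l\<in>S. c l * iexp (x * \<theta> l)))
      \<le> (\<Sum>k. ennreal (cmod (\<Sum>l\<in>S. c l * ((\<i> * of_real (x * \<theta> l)) ^ k /\<^sub>R fact k))))"
    by (rule norm_sums_le_ennreal)
  also have "\<dots> \<le> (\<Sum>k. ennreal (\<rho> ^ k / fact k) * ennreal (cmod (\<Sum>l\<in>S. c l * of_real (\<theta> l ^ k))))"
  proof (intro suminf_le summableI)
    fix k
    have "(\<Sum>l\<in>S. c l * ((\<i> * of_real (x * \<theta> l)) ^ k /\<^sub>R fact k))
        = (\<i> ^ k * of_real (x ^ k / fact k)) * (\<Sum>l\<in>S. c l * of_real (\<theta> l ^ k))"
      unfolding sum_distrib_left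
      by (intro sum.cong refl) (simp add: scaleR_conv_of_real power_mult_distrib field_simps)
    then have "cmod (\<Sum>l\<in>S. c l * ((\<i> * of_real (x * \<theta> l)) ^ k /\<^sub>R fact k))
        = \<bar>x\<bar> ^ k / fact k * cmod (\<Sum>l\<in>S. c l * of_real (\<theta> l ^ k))"
      by (simp add: norm_mult norm_power norm_divide power_abs)
    also have "\<dots> \<le> \<rho> ^ k / fact k * cmod (\<Sum>l\<in>S. c l * of_real (\<theta> l ^ k))"
      using x by (intro mult_right_mono divide_right_mono power_mono) auto
    finally show "ennreal (cmod (\<Sum>l\<in>S. c l * ((\<i> * of_real (x * \<theta> l)) ^ k /\<^sub>R fact k)))
        \<le> ennreal (\<rho> ^ k / fact k) * ennreal (cmod (\<Sum>l\<in>S. c l * of_real (\<theta> l ^ k)))"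
      using \<rho> by (subst ennreal_mult[symmetric]) (auto intro: ennreal_leI)
  qed
  finally show ?thesis .
qed

text \<open>A bound for the supremum of the sum over a disc, from the power series in both coordinates. It is a
random variable with an expectation that can be computed term by term.\<close>
definition trig_bound :: "real \<Rightarrow> nat \<Rightarrow> (int ^ 2 \<Rightarrow> complex) \<Rightarrow> ennreal" where
  "trig_bound R n c = (\<Sum>j. \<Sum>k. ennreal ((2 * pi * R) ^ j / fact j * ((2 * pi * R) ^ k / fact k)) *
     ennreal (cmod (trig n (\<lambda>l. c l * of_real ((dir n l $ 1) ^ j * (dir n l $ 2) ^ k)) 0)))"

lemma trig_le_trig_bound:
  assumes t: "t \<in> cball 0 R"
  shows "ennreal (cmod (trig n c t)) \<le> trig_bound R n c"
proof -
  let ?\<rho> = "2 * pi * R"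
  have ti: "\<bar>2 * pi * t $ i\<bar> \<le> ?\<rho>" for i
    using component_le_norm_cart[of t i] t by (simp add: abs_mult)
  have "R \<ge> 0" using t norm_ge_zero[of t] by (simp del: norm_ge_zero)
  then have \<rho>: "?\<rho> \<ge> 0" by simp
  then have em: "ennreal (?\<rho> ^ j / fact j * (?\<rho> ^ k / fact k)) = ennreal (?\<rho> ^ j / fact j) * ennreal (?\<rho> ^ k / fact k)" for j k
    by (intro ennreal_mult divide_nonneg_nonneg zero_le_power) simp_all
  \<comment> \<open>Absorbing the normalisation, so that the expansion can be applied to plain sums.\<close>
  define c' where "c' l = c l / of_real (sqrt (real (num_freqs n)))" for l
  have "trig n c t = (\<Sum>l\<in>freqs n. c' l * iexp (2 * pi * t $ 2 * dir n l $ 2) * iexp (2 * pi * t $ 1 * dir n l $ 1))"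
    unfolding trig_def sum_divide_distrib c'_def
    by (intro sum.cong refl) (simp add: inner_vec2 exp_add[symmetric] algebra_simps)
  also have "ennreal (cmod \<dots>) \<le> (\<Sum>j. ennreal (?\<rho> ^ j / fact j) *
      ennreal (cmod (\<Sum>l\<in>freqs n. c' l * iexp (2 * pi * t $ 2 * dir n l $ 2) * of_real ((dir n l $ 1) ^ j))))"
    by (rule exponential_sum_le[OF ti])
  also have "\<dots> \<le> trig_bound R n c"
    unfolding trig_bound_def
  proof (intro suminf_le summableI)
    fix j
    have "(\<Sum>l\<in>freqs n. c' l * iexp (2 * pi * t $ 2 * dir n l $ 2) * of_real ((dir n l $ 1) ^ j))
        = (\<Sum>l\<in>freqs n. c' l * of_real ((dir n l $ 1) ^ j) * iexp (2 * pi * t $ 2 * dir n l $ 2))"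
      by (intro sum.cong refl) (simp only: mult_ac)
    also have "ennreal (cmod \<dots>) \<le> (\<Sum>k. ennreal (?\<rho> ^ k / fact k) *
      ennreal (cmod (\<Sum>l\<in>freqs n. c' l * of_real ((dir n l $ 1) ^ j) * of_real ((dir n l $ 2) ^ k))))"
      by (rule exponential_sum_le[OF ti])
    finally have "ennreal (?\<rho> ^ j / fact j) *
      ennreal (cmod (\<Sum>l\<in>freqs n. c' l * iexp (2 * pi * t $ 2 * dir n l $ 2) * of_real ((dir n l $ 1) ^ j)))
      \<le> ennreal (?\<rho> ^ j / fact j) * (\<Sum>k. ennreal (?\<rho> ^ k / fact k) *
      ennreal (cmod (\<Sum>l\<in>freqs n. c' l * of_real ((dir n l $ 1) ^ j) * of_real ((dir n l $ 2) ^ k))))"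
      by (rule mult_left_mono) simp
    also have "\<dots> = (\<Sum>k. ennreal (?\<rho> ^ j / fact j * (?\<rho> ^ k / fact k)) *
      ennreal (cmod (\<Sum>l\<in>freqs n. c' l * of_real ((dir n l $ 1) ^ j) * of_real ((dir n l $ 2) ^ k))))"
      unfolding ennreal_suminf_cmult[symmetric]
      by (intro suminf_cong) (simp only: em, simp only: mult.assoc)
    also have "(\<lambda>k. \<Sum>l\<in>freqs n. c' l * of_real ((dir n l $ 1) ^ j) * of_real ((dir n l $ 2) ^ k))
        = (\<lambda>k. trig n (\<lambda>l. c l * of_real ((dir n l $ 1) ^ j * (dir n l $ 2) ^ k)) 0)"
      unfolding trig_def sum_divide_distrib c'_def by (intro ext sum.cong refl) simp
    finally show "ennreal (?\<rho> ^ j / fact j) *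
      ennreal (cmod (\<Sum>l\<in>freqs n. c' l * iexp (2 * pi * t $ 2 * dir n l $ 2) * of_real ((dir n l $ 1) ^ j)))
      \<le> (\<Sum>k. ennreal (?\<rho> ^ j / fact j * (?\<rho> ^ k / fact k)) *
      ennreal (cmod (trig n (\<lambda>l. c l * of_real ((dir n l $ 1) ^ j * (dir n l $ 2) ^ k)) 0)))"
      by (simp only: fun_eq_iff)
  qed
  finally show ?thesis .
qed

context random_wave
begin

lemma coefficient_sum_measurable [measurable]:
  assumes "n > 0"
  shows "(\<lambda>w. trig n (\<lambda>l. a l w * b l) t) \<in> borel_measurable M"
  unfolding trig_def
  by (intro borel_measurable_divide borel_measurable_sum borel_measurable_times borel_measurable_const
      a_measurable freqs_nonzero[OF assms])

text \<open>Orthogonality of the coefficients in a half system of frequencies keeps the second moment bounded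
independently of the number of frequencies.\<close>
lemma coefficient_sum_first_moment:
  assumes n: "n > 0" and b: "\<And>l. l \<in> freqs n \<Longrightarrow> cmod (b l) \<le> \<beta>"
  shows "(\<integral>\<^sup>+ w. ennreal (cmod (trig n (\<lambda>l. a l w * b l) 0)) \<partial>M) \<le> ennreal (1 + 2 * \<beta>\<^sup>2)"
proof (cases "freqs n = {}")
  case True
  then show ?thesis by (simp add: trig_def)
next
  case False
  define N where "N = real (num_freqs n)"
  have N: "N > 0" using False by (simp add: N_def num_freqs_def card_gt_0_iff)
  let ?H = "half_freqs n"
  note H = finite_half_freqs[of n] zero_notin_half_freqs[of n] half_freqs_disjoint[of n]
  define A where "A w = (\<Sum>l\<in>?H. b l * a l w)" for w
  define B where "B w = (\<Sum>l\<in>?H. cnj (b (- l)) * a l w)" for w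
  have dom: "cmod (trig n (\<lambda>l. a l w * b l) 0) \<le> 1 + 2 / N * (cmod (A w))\<^sup>2 + 2 / N * (cmod (B w))\<^sup>2"
    if w: "w \<in> space M" for w
  proof -
    have "(\<Sum>l\<in>freqs n. a l w * b l) = (\<Sum>l\<in>?H. a l w * b l + a (- l) w * b (- l))"
      by (rule sum_freqs_half[OF n])
    also have "\<dots> = (\<Sum>l\<in>?H. b l * a l w + cnj (cnj (b (- l)) * a l w))"
    proof (intro sum.cong refl)
      fix l assume "l \<in> ?H"
      then have "l \<noteq> 0" using H(2) by auto
      then show "a l w * b l + a (- l) w * b (- l) = b l * a l w + cnj (cnj (b (- l)) * a l w)"
        using a_uminus[OF _ w, of l] by simp
    qed
    also have "\<dots> = A w + cnj (B w)" by (simp add: A_def B_def sum.distrib)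
    finally have eq: "trig n (\<lambda>l. a l w * b l) 0 = (A w + cnj (B w)) / of_real (sqrt N)"
      by (simp add: trig_def N_def)
    let ?x = "cmod (trig n (\<lambda>l. a l w * b l) 0)"
    have "?x\<^sup>2 = (cmod (A w + cnj (B w)))\<^sup>2 / N"
      using N by (simp add: eq norm_divide power_divide)
    also have "\<dots> \<le> (cmod (A w) + cmod (B w))\<^sup>2 / N"
      using N norm_triangle_ineq[of "A w" "cnj (B w)"] by (intro divide_right_mono power_mono) auto
    also have "\<dots> \<le> (2 * (cmod (A w))\<^sup>2 + 2 * (cmod (B w))\<^sup>2) / N"
      using N sum_squares_bound[of "cmod (A w)" "cmod (B w)"]
      by (intro divide_right_mono) (auto simp: power2_sum)
    finally have "?x\<^sup>2 \<le> 2 / N * (cmod (A w))\<^sup>2 + 2 / N * (cmod (B w))\<^sup>2" by (simp add: add_divide_distrib)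
    \<comment> \<open>A crude passage from the second to the first moment suffices.\<close>
    moreover have "?x \<le> 1 + ?x\<^sup>2"
      using zero_le_power2[of "?x - 1 / 2"] unfolding power2_diff power_divide by simp
    ultimately show ?thesis by linarith
  qed
  note mA = half_sum_second_moment[OF H, of b, folded A_def]
  note mB = half_sum_second_moment[OF H, of "\<lambda>l. cnj (b (- l))", folded B_def]
  let ?D = "\<lambda>w. 1 + 2 / N * (cmod (A w))\<^sup>2 + 2 / N * (cmod (B w))\<^sup>2"
  have int: "integrable M ?D"
    by (intro Bochner_Integration.integrable_add integrable_mult_right mA(1) mB(1) integrable_const)
  have "(\<integral>\<^sup>+ w. ennreal (cmod (trig n (\<lambda>l. a l w * b l) 0)) \<partial>M) \<le> (\<integral>\<^sup>+ w. ennreal (?D w) \<partial>M)"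
    by (intro nn_integral_mono ennreal_leI dom)
  also have "\<dots> = ennreal (expectation ?D)"
    using N by (intro nn_integral_eq_integral int) auto
  also have "\<dots> \<le> ennreal (1 + 2 * \<beta>\<^sup>2)"
  proof (rule ennreal_leI)
  have "expectation ?D = 1 + 2 / N * (\<Sum>l\<in>?H. (cmod (b l))\<^sup>2) + 2 / N * (\<Sum>l\<in>?H. (cmod (b (- l)))\<^sup>2)"
    using mA mB by (simp add: prob_space)
  also have "\<dots> = 1 + 2 / N * (\<Sum>l\<in>freqs n. (cmod (b l))\<^sup>2)"
    by (simp add: sum_freqs_half[OF n] sum.distrib distrib_left)
  also have "\<dots> \<le> 1 + 2 / N * (\<Sum>l\<in>freqs n. \<beta>\<^sup>2)"
    using b N by (intro add_left_mono mult_left_mono sum_mono power_mono) auto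
  also have "(\<Sum>l\<in>freqs n. \<beta>\<^sup>2) = N * \<beta>\<^sup>2" by (simp add: N_def num_freqs_def)
  also have "1 + 2 / N * (N * \<beta>\<^sup>2) = 1 + 2 * \<beta>\<^sup>2" using N by simp
  finally show "expectation ?D \<le> 1 + 2 * \<beta>\<^sup>2" .
  qed
  finally show ?thesis .
qed

lemma trig_bound_measurable [measurable]:
  assumes "n > 0"
  shows "(\<lambda>w. trig_bound R n (\<lambda>l. a l w * b l)) \<in> borel_measurable M"
  unfolding trig_bound_def mult.assoc using coefficient_sum_measurable[OF assms] by measurable

lemma trig_bound_expectation:
  assumes n: "n > 0" and b: "\<And>l. l \<in> freqs n \<Longrightarrow> cmod (b l) \<le> \<beta>" and R: "R \<ge> 0"
  shows "(\<integral>\<^sup>+ w. trig_bound R n (\<lambda>l. a l w * b l) \<partial>M) \<le> ennreal ((1 + 2 * \<beta>\<^sup>2) * exp (2 * pi * R) * exp (2 * pi * R))"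
proof -
  let ?\<rho> = "2 * pi * R"
  have \<rho>: "?\<rho> \<ge> 0" using R by simp
  then have em: "ennreal (?\<rho> ^ j / fact j * (?\<rho> ^ k / fact k)) = ennreal (?\<rho> ^ j / fact j) * ennreal (?\<rho> ^ k / fact k)" for j k
    by (intro ennreal_mult divide_nonneg_nonneg zero_le_power) simp_all
  let ?B = "\<lambda>j k l. b l * of_real ((dir n l $ 1) ^ j * (dir n l $ 2) ^ k)"
  let ?x = "\<lambda>j k w. ennreal (cmod (trig n (\<lambda>l. a l w * ?B j k l) 0))"
  have [measurable]: "?x j k \<in> borel_measurable M" for j k
    using coefficient_sum_measurable[OF n] by measurable
  have Bb: "cmod (?B j k l) \<le> \<beta>" if "l \<in> freqs n" for j k l
  proof -
    have "\<bar>dir n l $ 1\<bar> ^ j * \<bar>dir n l $ 2\<bar> ^ k \<le> 1"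
      using dir_component_le[OF n that] by (intro mult_le_one power_le_one) auto
    then have "cmod (b l) * (\<bar>dir n l $ 1\<bar> ^ j * \<bar>dir n l $ 2\<bar> ^ k) \<le> cmod (b l) * 1"
      by (intro mult_left_mono) auto
    then show ?thesis using b[OF that] by (simp add: norm_mult norm_power)
  qed
  have es: "(\<Sum>k. ennreal (?\<rho> ^ k / fact k)) = ennreal (exp ?\<rho>)"
    using exp_converges[of ?\<rho>] \<rho>
    by (subst suminf_ennreal2) (auto simp: sums_iff divide_inverse mult.commute)
  have "(\<integral>\<^sup>+ w. trig_bound R n (\<lambda>l. a l w * b l) \<partial>M)
      = (\<integral>\<^sup>+ w. (\<Sum>j. \<Sum>k. ennreal (?\<rho> ^ j / fact j * (?\<rho> ^ k / fact k)) * ?x j k w) \<partial>M)"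
    by (simp add: trig_bound_def mult.assoc)
  also have "\<dots> = (\<Sum>j. \<Sum>k. \<integral>\<^sup>+ w. ennreal (?\<rho> ^ j / fact j * (?\<rho> ^ k / fact k)) * ?x j k w \<partial>M)"
    by (subst nn_integral_suminf, measurable) (intro suminf_cong nn_integral_suminf, measurable)
  also have "\<dots> \<le> (\<Sum>j. \<Sum>k. ennreal (?\<rho> ^ j / fact j) * (ennreal (?\<rho> ^ k / fact k) * ennreal (1 + 2 * \<beta>\<^sup>2)))"
  proof (intro suminf_le summableI)
    fix j k
    have "(\<integral>\<^sup>+ w. ennreal (?\<rho> ^ j / fact j * (?\<rho> ^ k / fact k)) * ?x j k w \<partial>M)
        = ennreal (?\<rho> ^ j / fact j * (?\<rho> ^ k / fact k)) * (\<integral>\<^sup>+ w. ?x j k w \<partial>M)"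
      by (rule nn_integral_cmult) measurable
    also have "\<dots> \<le> ennreal (?\<rho> ^ j / fact j * (?\<rho> ^ k / fact k)) * ennreal (1 + 2 * \<beta>\<^sup>2)"
      by (intro mult_left_mono coefficient_sum_first_moment[OF n Bb]) auto
    also have "\<dots> = ennreal (?\<rho> ^ j / fact j) * (ennreal (?\<rho> ^ k / fact k) * ennreal (1 + 2 * \<beta>\<^sup>2))"
      by (simp only: em, simp only: mult.assoc)
    finally show "(\<integral>\<^sup>+ w. ennreal (?\<rho> ^ j / fact j * (?\<rho> ^ k / fact k)) * ?x j k w \<partial>M)
        \<le> ennreal (?\<rho> ^ j / fact j) * (ennreal (?\<rho> ^ k / fact k) * ennreal (1 + 2 * \<beta>\<^sup>2))" .
  qed
  also have "\<dots> = ennreal (exp ?\<rho>) * (ennreal (exp ?\<rho>) * ennreal (1 + 2 * \<beta>\<^sup>2))"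
    by (simp only: ennreal_suminf_cmult ennreal_suminf_multc es)
  also have "\<dots> = ennreal ((1 + 2 * \<beta>\<^sup>2) * exp ?\<rho> * exp ?\<rho>)"
  proof -
    have nn: "0 \<le> 1 + 2 * \<beta>\<^sup>2" by simp
    have "ennreal (exp ?\<rho> * (exp ?\<rho> * (1 + 2 * \<beta>\<^sup>2))) = ennreal (exp ?\<rho>) * (ennreal (exp ?\<rho>) * ennreal (1 + 2 * \<beta>\<^sup>2))"
      by (simp only: ennreal_mult exp_ge_zero mult_nonneg_nonneg nn)
    then show ?thesis by (simp only: mult_ac)
  qed
  finally show ?thesis .
qed

lemma trig_real:
  assumes n: "n > 0" and w: "w \<in> space M" and g: "\<And>l. g (- l) = cnj (g l)"
  shows "trig n (\<lambda>l. a l w * g l) t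
    = of_real (Re (\<Sum>l\<in>half_freqs n. (of_real (2 / sqrt (real (num_freqs n))) * iexp (2 * pi * (dir n l \<bullet> t)) * g l) * a l w))"
proof -
  let ?N = "sqrt (real (num_freqs n))"
  let ?x = "\<lambda>l. a l w * g l * iexp (2 * pi * (dir n l \<bullet> t))"
  have "(\<Sum>l\<in>freqs n. ?x l) = (\<Sum>l\<in>half_freqs n. ?x l + ?x (- l))" by (rule sum_freqs_half[OF n])
  also have "\<dots> = (\<Sum>l\<in>half_freqs n. of_real (2 * Re (?x l)))"
  proof (intro sum.cong refl)
    fix l assume "l \<in> half_freqs n"
    then have "l \<noteq> 0" using zero_notin_half_freqs by auto
    then have "?x (- l) = cnj (?x l)"
      by (simp add: a_uminus[OF _ w] g dir_uminus exp_cnj)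
    then show "?x l + ?x (- l) = of_real (2 * Re (?x l))" by (simp only: complex_add_cnj)
  qed
  finally have "trig n (\<lambda>l. a l w * g l) t = of_real ((\<Sum>l\<in>half_freqs n. 2 * Re (?x l)) / ?N)"
    by (simp add: trig_def)
  also have "(\<Sum>l\<in>half_freqs n. 2 * Re (?x l)) / ?N = (\<Sum>l\<in>half_freqs n. 2 / ?N * Re (?x l))"
    by (simp add: sum_divide_distrib)
  also have "\<dots> = Re (\<Sum>l\<in>half_freqs n. (of_real (2 / ?N) * iexp (2 * pi * (dir n l \<bullet> t)) * g l) * a l w)"
    unfolding Re_sum
  proof (intro sum.cong refl)
    fix l
    have "(of_real (2 / ?N) * iexp (2 * pi * (dir n l \<bullet> t)) * g l) * a l w = of_real (2 / ?N) * ?x l"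
      by (simp only: mult_ac)
    then show "2 / ?N * Re (?x l) = Re ((of_real (2 / ?N) * iexp (2 * pi * (dir n l \<bullet> t)) * g l) * a l w)"
      by (simp only: Re_of_real_mult)
  qed
  finally show ?thesis .
qed

text \<open>The rescaled wave translated by \<open>\<tau>\<close>, as a real function.\<close>
definition field :: "nat \<Rightarrow> real ^ 2 \<Rightarrow> 'w \<Rightarrow> real ^ 2 \<Rightarrow> real" where
  "field n \<tau> w t = Re (trig n (\<lambda>l. a l w * iexp (2 * pi * (lat l \<bullet> \<tau>))) t)"

definition grad :: "nat \<Rightarrow> real ^ 2 \<Rightarrow> 'w \<Rightarrow> real ^ 2 \<Rightarrow> real ^ 2" where
  "grad n \<tau> w t = (\<chi> i. Re (trig n (\<lambda>l. a l w * iexp (2 * pi * (lat l \<bullet> \<tau>)) * (\<i> * of_real (2 * pi * dir n l $ i))) t))"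

lemma field_has_derivative: "(field n \<tau> w has_derivative (\<lambda>h. grad n \<tau> w t \<bullet> h)) (at t)"
  unfolding field_def grad_def by (rule trig_Re_has_derivative)

lemma wave_eq_field:
  assumes "n > 0" "w \<in> space M"
  shows "wave a n w (\<tau> + t /\<^sub>R sqrt (real n)) = of_real (field n \<tau> w t)"
proof -
  have "wave a n w (\<tau> + t /\<^sub>R sqrt (real n)) = trig n (\<lambda>l. a l w * iexp (2 * pi * (lat l \<bullet> \<tau>))) t"
    unfolding wave_def trig_def dir_def
    by (intro arg_cong2[where f = "(/)"] sum.cong refl)
       (simp add: exp_add[symmetric] inner_add_right algebra_simps)
  also have "\<dots> = of_real (field n \<tau> w t)"
    unfolding field_def
    by (subst (1 2) trig_real[OF assms]) (auto simp: lat_uminus exp_cnj)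
  finally show ?thesis .
qed

text \<open>At each point the value of the field and the two components of its gradient are independent Gaussian
variables with variances \<open>1\<close>, \<open>2 * pi\<^sup>2\<close> and \<open>2 * pi\<^sup>2\<close>: the value comes with real and the gradient with
imaginary multiples of the coefficients, and the two components are uncorrelated by isotropy.\<close>
lemma field_gradient_char:
  assumes n: "n > 0" and ne: "freqs n \<noteq> {}"
  shows "expectation (\<lambda>w. iexp (z0 * field n 0 w t + z1 * grad n 0 w t $ 1 + z2 * grad n 0 w t $ 2))
    = of_real (exp (- (z0\<^sup>2 + (sqrt 2 * pi)\<^sup>2 * z1\<^sup>2 + (sqrt 2 * pi)\<^sup>2 * z2\<^sup>2) / 2))"
proof -
  define N where "N = real (num_freqs n)"
  have N: "N > 0" using ne by (simp add: N_def num_freqs_def card_gt_0_iff)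
  define z where "z = ((\<chi> i. if i = 1 then z1 else z2) :: real ^ 2)"
  define \<gamma> where "\<gamma> l = complex_of_real z0 + \<i> * of_real (2 * pi * (z \<bullet> dir n l))" for l
  define d where "d l = of_real (2 / sqrt N) * iexp (2 * pi * (dir n l \<bullet> t)) * \<gamma> l" for l
  let ?H = "half_freqs n"
  have dz: "z \<bullet> dir n l = z1 * dir n l $ 1 + z2 * dir n l $ 2" for l
    by (simp add: z_def inner_vec2)
  have alg: "of_real z0 * (e * 1 * x) + of_real z1 * (e * (\<i> * of_real (2 * pi * u)) * x)
      + of_real z2 * (e * (\<i> * of_real (2 * pi * v)) * x)
      = e * (of_real z0 + \<i> * of_real (2 * pi * (z1 * u + z2 * v))) * x" for e x :: complex and u v :: real
    by (simp add: algebra_simps)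
  have lin: "z0 * field n 0 w t + z1 * grad n 0 w t $ 1 + z2 * grad n 0 w t $ 2 = Re (\<Sum>l\<in>?H. d l * a l w)"
    if w: "w \<in> space M" for w
  proof -
    let ?e = "\<lambda>l. of_real (2 / sqrt N) * iexp (2 * pi * (dir n l \<bullet> t))"
    let ?g = "\<lambda>i l. \<i> * complex_of_real (2 * pi * dir n l $ i)"
    have "field n 0 w t = Re (trig n (\<lambda>l. a l w * 1) t)" by (simp add: field_def)
    also have "\<dots> = Re (\<Sum>l\<in>?H. (?e l * 1) * a l w)"
      unfolding N_def by (subst trig_real[OF n w]) simp_all
    finally have 0: "field n 0 w t = Re (\<Sum>l\<in>?H. (?e l * 1) * a l w)" .
    have "grad n 0 w t $ i = Re (trig n (\<lambda>l. a l w * ?g i l) t)" for i by (simp add: grad_def)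
    also have "\<dots> i = Re (\<Sum>l\<in>?H. (?e l * ?g i l) * a l w)" for i
      unfolding N_def by (subst trig_real[OF n w]) (simp_all add: dir_uminus)
    finally have i: "grad n 0 w t $ i = Re (\<Sum>l\<in>?H. (?e l * ?g i l) * a l w)" for i .
    have "z0 * field n 0 w t + z1 * grad n 0 w t $ 1 + z2 * grad n 0 w t $ 2
      = Re (of_real z0 * (\<Sum>l\<in>?H. (?e l * 1) * a l w) + of_real z1 * (\<Sum>l\<in>?H. (?e l * ?g 1 l) * a l w)
        + of_real z2 * (\<Sum>l\<in>?H. (?e l * ?g 2 l) * a l w))"
      by (simp only: 0 i plus_complex.sel Re_of_real_mult)
    also have "of_real z0 * (\<Sum>l\<in>?H. (?e l * 1) * a l w) + of_real z1 * (\<Sum>l\<in>?H. (?e l * ?g 1 l) * a l w)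
        + of_real z2 * (\<Sum>l\<in>?H. (?e l * ?g 2 l) * a l w) = (\<Sum>l\<in>?H. d l * a l w)"
      unfolding sum_distrib_left sum.distrib[symmetric] d_def \<gamma>_def dz
      by (intro sum.cong refl alg)
    finally show ?thesis .
  qed
  have cmod\<gamma>: "(cmod (\<gamma> l))\<^sup>2 = z0\<^sup>2 + 4 * pi\<^sup>2 * (z \<bullet> dir n l)\<^sup>2" for l
    by (simp add: \<gamma>_def cmod_power2 power_mult_distrib)
  have "(\<Sum>l\<in>?H. (cmod (d l))\<^sup>2) = (\<Sum>l\<in>?H. 4 / N * (cmod (\<gamma> l))\<^sup>2)"
    using N by (intro sum.cong refl) (simp add: d_def norm_mult power_mult_distrib power_divide norm_exp_i_times norm_divide)
  also have "\<dots> = 2 / N * (\<Sum>l\<in>?H. (cmod (\<gamma> l))\<^sup>2 + (cmod (\<gamma> (- l)))\<^sup>2)"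
    by (simp add: cmod\<gamma> dir_uminus sum_distrib_left field_simps)
  also have "\<dots> = 2 / N * (\<Sum>l\<in>freqs n. (cmod (\<gamma> l))\<^sup>2)"
    by (simp only: sum_freqs_half[OF n])
  also have "\<dots> = 2 / N * (N * z0\<^sup>2 + 4 * pi\<^sup>2 * (N / 2 * (norm z)\<^sup>2))"
    unfolding cmod\<gamma> N_def sum_dir_squares[OF n, symmetric] by (simp add: sum.distrib sum_distrib_left num_freqs_def)
  also have "\<dots> = 2 * (z0\<^sup>2 + (sqrt 2 * pi)\<^sup>2 * z1\<^sup>2 + (sqrt 2 * pi)\<^sup>2 * z2\<^sup>2)"
    using N by (simp add: norm_vec2 z_def power_mult_distrib field_simps)
  finally have var: "(\<Sum>l\<in>?H. (cmod (d l))\<^sup>2) = 2 * (z0\<^sup>2 + (sqrt 2 * pi)\<^sup>2 * z1\<^sup>2 + (sqrt 2 * pi)\<^sup>2 * z2\<^sup>2)" .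
  have "expectation (\<lambda>w. iexp (z0 * field n 0 w t + z1 * grad n 0 w t $ 1 + z2 * grad n 0 w t $ 2))
      = expectation (\<lambda>w. iexp (Re (\<Sum>l\<in>?H. d l * a l w)))"
    by (intro Bochner_Integration.integral_cong refl) (simp only: lin)
  also have "\<dots> = of_real (exp (- (\<Sum>l\<in>?H. (cmod (d l))\<^sup>2) / 4))"
    by (rule half_sum_char[OF finite_half_freqs zero_notin_half_freqs half_freqs_disjoint])
  finally show ?thesis unfolding var by simp
qed

end

section \<open>Uniform regularity and nondegeneracy\<close>

context random_wave
begin

lemma field_tame:
  assumes B: "B \<ge> 0"
    and 1: "\<And>i t. t \<in> cball 0 R \<Longrightarrow>
      cmod (trig n (\<lambda>l. a l w * (iexp (2 * pi * (lat l \<bullet> \<tau>)) * (\<i> * of_real (2 * pi * dir n l $ i)))) t) \<le> B"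
    and 2: "\<And>i j t. t \<in> cball 0 R \<Longrightarrow>
      cmod (trig n (\<lambda>l. a l w * (iexp (2 * pi * (lat l \<bullet> \<tau>)) * (\<i> * of_real (2 * pi * dir n l $ i))
        * (\<i> * of_real (2 * pi * dir n l $ j)))) t) \<le> B"
  shows "tame R (4 * B) (field n \<tau> w) (grad n \<tau> w)"
proof -
  have g: "\<bar>grad n \<tau> w t $ i\<bar> \<le> B" if "t \<in> cball 0 R" for t i
    using order_trans[OF abs_Re_le_cmod 1[OF that, of i]] by (simp add: grad_def mult.assoc)
  define D where "D i t = (\<chi> j. Re (trig n (\<lambda>l. a l w * iexp (2 * pi * (lat l \<bullet> \<tau>)) * (\<i> * of_real (2 * pi * dir n l $ i))
        * (\<i> * of_real (2 * pi * dir n l $ j))) t))" for i t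
  have der: "((\<lambda>t. grad n \<tau> w t $ i) has_derivative (\<lambda>h. D i t \<bullet> h)) (at t)" for i t
    unfolding grad_def D_def vec_lambda_beta by (rule trig_Re_has_derivative)
  have D: "norm (D i t) \<le> 2 * B" if "t \<in> cball 0 R" for t i
  proof -
    have "\<bar>D i t $ j\<bar> \<le> B" for j
      using order_trans[OF abs_Re_le_cmod 2[OF that, of i j]] by (simp add: D_def mult.assoc)
    from this[of 1] this[of 2] show ?thesis using norm_vec2_le[of "D i t"] by linarith
  qed
  have lip: "\<bar>grad n \<tau> w x $ i - grad n \<tau> w y $ i\<bar> \<le> 2 * B * dist x y"
    if "x \<in> cball 0 R" "y \<in> cball 0 R" for x y i
  proof -
    obtain s where s: "0 < s" "s < 1"
      and eq: "grad n \<tau> w x $ i - grad n \<tau> w y $ i = D i (y + s *\<^sub>R (x - y)) \<bullet> (x - y)"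
      by (rule mvt_along_line[OF der])
    have "y + s *\<^sub>R (x - y) \<in> cball 0 R" using s that by (intro segment_in_cball) auto
    then show ?thesis unfolding eq dist_norm
      by (intro order_trans[OF Cauchy_Schwarz_ineq2] mult_right_mono D) auto
  qed
  show ?thesis
    unfolding tame_def
  proof (intro conjI allI ballI)
    show "(field n \<tau> w has_derivative (\<lambda>h. grad n \<tau> w x \<bullet> h)) (at x)" for x
      by (rule field_has_derivative)
    show "norm (grad n \<tau> w x) \<le> 4 * B" if "x \<in> cball 0 R" for x
      using norm_vec2_le[of "grad n \<tau> w x"] g[OF that, of 1] g[OF that, of 2] B by linarith
    show "norm (grad n \<tau> w x - grad n \<tau> w y) \<le> 4 * B * dist x y"
      if "x \<in> cball 0 R" "y \<in> cball 0 R" for x y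
      using norm_vec2_le[of "grad n \<tau> w x - grad n \<tau> w y"] lip[OF that, of 1] lip[OF that, of 2] by simp
  qed
qed

text \<open>Markov's inequality for the sum of the bounds of the two first and four second derivatives. A
translation multiplies the coefficients by numbers of modulus 1, so the bound is uniform in \<open>\<tau>\<close>.\<close>
lemma field_tame_probability:
  assumes R: "R \<ge> 0" and \<eta>: "\<eta> > 0"
  shows "\<exists>B>0. \<forall>n \<tau>. n > 0 \<longrightarrow> (\<exists>E\<in>sets M. prob E \<le> \<eta> \<and>
    (\<forall>w\<in>space M - E. tame R B (field n \<tau> w) (grad n \<tau> w)))"
proof -
  \<comment> \<open>Each derivative contributes a factor of modulus at most \<open>2 * pi\<close>.\<close>
  define \<beta> where "\<beta> = (2 * pi)\<^sup>2"
  define K where "K = (1 + 2 * \<beta>\<^sup>2) * exp (2 * pi * R) * exp (2 * pi * R)"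
  define B where "B = 6 * K / \<eta>"
  have "1 + 2 * \<beta>\<^sup>2 > 0" using zero_le_power2[of \<beta>] by linarith
  then have K: "K > 0" by (simp add: K_def)
  have B: "B > 0" using K \<eta> by (simp add: B_def)
  show ?thesis
  proof (intro exI[of _ "4 * B"] conjI allI impI)
    show "4 * B > 0" using B by simp
    fix n :: nat and \<tau> assume n: "n > 0"
    define g where "g i l = \<i> * complex_of_real (2 * pi * dir n l $ i)" for i :: 2 and l
    define e where "e l = iexp (2 * pi * (lat l \<bullet> \<tau>))" for l
    define b1 where "b1 i l = e l * g i l" for i l
    define b2 where "b2 i j l = e l * g i l * g j l" for i j l
    have e: "cmod (e l) = 1" for l unfolding e_def by (rule norm_exp_i_times)
    have g: "cmod (g i l) \<le> 2 * pi" if "l \<in> freqs n" for i l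
    proof -
      have "cmod (g i l) = 2 * pi * \<bar>dir n l $ i\<bar>" by (simp add: g_def norm_mult)
      also have "\<dots> \<le> 2 * pi * 1" by (intro mult_left_mono dir_component_le[OF n that]) simp
      finally show ?thesis by simp
    qed
    have b1: "cmod (b1 i l) \<le> \<beta>" if l: "l \<in> freqs n" for i l
    proof -
      have "cmod (b1 i l) \<le> 2 * pi * 1" using g[OF l] by (simp add: b1_def norm_mult e)
      also have "\<dots> \<le> 2 * pi * (2 * pi)" using pi_gt3 by (intro mult_left_mono) auto
      finally show ?thesis by (simp add: \<beta>_def power2_eq_square)
    qed
    have b2: "cmod (b2 i j l) \<le> \<beta>" if l: "l \<in> freqs n" for i j l
    proof -
      have "cmod (g i l) * cmod (g j l) \<le> 2 * pi * (2 * pi)" by (intro mult_mono g[OF l]) auto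
      then show ?thesis by (simp add: b2_def norm_mult e \<beta>_def power2_eq_square)
    qed
    define U where "U w = (\<Sum>i\<in>UNIV. trig_bound R n (\<lambda>l. a l w * b1 i l))
      + (\<Sum>i\<in>UNIV. \<Sum>j\<in>UNIV. trig_bound R n (\<lambda>l. a l w * b2 i j l))" for w
    note [measurable] = trig_bound_measurable[OF n]
    have [measurable]: "U \<in> borel_measurable M" unfolding U_def by measurable
    have "(\<integral>\<^sup>+ w. U w \<partial>M) = (\<Sum>i\<in>UNIV. \<integral>\<^sup>+ w. trig_bound R n (\<lambda>l. a l w * b1 i l) \<partial>M)
        + (\<Sum>i\<in>UNIV. \<Sum>j\<in>UNIV. \<integral>\<^sup>+ w. trig_bound R n (\<lambda>l. a l w * b2 i j l) \<partial>M)"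
      unfolding U_def by (subst nn_integral_add; (subst nn_integral_sum)?; simp add: nn_integral_sum)
    also have "\<dots> \<le> (\<Sum>i\<in>(UNIV :: 2 set). ennreal K) + (\<Sum>i\<in>(UNIV :: 2 set). \<Sum>j\<in>(UNIV :: 2 set). ennreal K)"
      unfolding K_def by (intro add_mono sum_mono trig_bound_expectation n b1 b2 R)
    also have "\<dots> = ennreal (6 * K)"
    proof -
      have "(\<Sum>i\<in>(UNIV :: 2 set). ennreal K) + (\<Sum>i\<in>(UNIV :: 2 set). \<Sum>j\<in>(UNIV :: 2 set). ennreal K)
        = ennreal K + ennreal K + (ennreal K + ennreal K + (ennreal K + ennreal K))" by (simp only: sum_2)
      also have "\<dots> = ennreal (K + K + (K + K + (K + K)))"
        using K by (simp only: ennreal_plus add_nonneg_nonneg less_imp_le)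
      finally show ?thesis by simp
    qed
    finally have EU: "(\<integral>\<^sup>+ w. U w \<partial>M) \<le> ennreal (6 * K)" .
    define E where "E = {w \<in> space M. 1 \<le> ennreal (1 / B) * U w}"
    have E: "E \<in> sets M" unfolding E_def by measurable
    have "emeasure M E \<le> ennreal (1 / B) * (\<integral>\<^sup>+ w. U w * indicator (space M) w \<partial>M)"
      unfolding E_def by (rule nn_integral_Markov_inequality) measurable
    also have "(\<integral>\<^sup>+ w. U w * indicator (space M) w \<partial>M) = (\<integral>\<^sup>+ w. U w \<partial>M)"
      by (intro nn_integral_cong) simp
    also have "ennreal (1 / B) * \<dots> \<le> ennreal (1 / B) * ennreal (6 * K)"
      by (intro mult_left_mono EU) simp
    also have "\<dots> = ennreal \<eta>"
      using K \<eta> by (simp add: B_def ennreal_mult[symmetric])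
    finally have "prob E \<le> \<eta>" using \<eta> by (simp add: emeasure_eq_measure)
    moreover have "tame R (4 * B) (field n \<tau> w) (grad n \<tau> w)" if w: "w \<in> space M - E" for w
    proof (rule field_tame)
      have "ennreal (1 / B) * U w \<le> 1" using w by (auto simp: E_def)
      then have "ennreal B * (ennreal (1 / B) * U w) \<le> ennreal B * 1" by (intro mult_left_mono) auto
      moreover have "ennreal B * (ennreal (1 / B) * U w) = U w"
        using B by (simp add: mult.assoc[symmetric] ennreal_mult[symmetric])
      ultimately have Uw: "U w \<le> ennreal B" by simp
      have T1: "trig_bound R n (\<lambda>l. a l w * b1 i l) \<le> ennreal B" for i
      proof -
        have "trig_bound R n (\<lambda>l. a l w * b1 i l) \<le> (\<Sum>i\<in>UNIV. trig_bound R n (\<lambda>l. a l w * b1 i l))"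
          by (rule member_le_sum) auto
        also have "\<dots> \<le> U w" by (simp add: U_def)
        finally show ?thesis using Uw by (rule order_trans)
      qed
      have T2: "trig_bound R n (\<lambda>l. a l w * b2 i j l) \<le> ennreal B" for i j
      proof -
        have "trig_bound R n (\<lambda>l. a l w * b2 i j l) \<le> (\<Sum>j\<in>UNIV. trig_bound R n (\<lambda>l. a l w * b2 i j l))"
          by (rule member_le_sum) auto
        also have "\<dots> \<le> (\<Sum>i\<in>UNIV. \<Sum>j\<in>UNIV. trig_bound R n (\<lambda>l. a l w * b2 i j l))"
          by (rule member_le_sum) auto
        also have "\<dots> \<le> U w" by (simp add: U_def)
        finally show ?thesis using Uw by (rule order_trans)
      qed
      have le: "cmod (trig n c t) \<le> B" if "t \<in> cball 0 R" "trig_bound R n c \<le> ennreal B" for c t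
        using order_trans[OF trig_le_trig_bound[OF that(1)] that(2)] B by (simp add: ennreal_le_iff)
      show "cmod (trig n (\<lambda>l. a l w * (iexp (2 * pi * (lat l \<bullet> \<tau>)) * (\<i> * of_real (2 * pi * dir n l $ i)))) t) \<le> B"
        if "t \<in> cball 0 R" for i t
        using le[OF that T1[of i]] by (simp only: b1_def e_def g_def)
      show "cmod (trig n (\<lambda>l. a l w * (iexp (2 * pi * (lat l \<bullet> \<tau>)) * (\<i> * of_real (2 * pi * dir n l $ i))
        * (\<i> * of_real (2 * pi * dir n l $ j)))) t) \<le> B" if "t \<in> cball 0 R" for i j t
        using le[OF that T2[of i j]] by (simp only: b2_def e_def g_def)
    qed (use B in simp)
    ultimately show "\<exists>E\<in>sets M. prob E \<le> \<eta> \<and> (\<forall>w\<in>space M - E. tame R (4 * B) (field n \<tau> w) (grad n \<tau> w))"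
      using E by blast
  qed
qed

lemma field_measurable [measurable]: "n > 0 \<Longrightarrow> (\<lambda>w. field n \<tau> w t) \<in> borel_measurable M"
  unfolding field_def using coefficient_sum_measurable by measurable

lemma grad_measurable [measurable]: "n > 0 \<Longrightarrow> (\<lambda>w. grad n \<tau> w t $ i) \<in> borel_measurable M"
  unfolding grad_def vec_lambda_beta mult.assoc using coefficient_sum_measurable by measurable

lemma field_small_ball:
  assumes "n > 0" "freqs n \<noteq> {}" "\<epsilon> > 0"
  shows "prob {w \<in> space M. \<bar>field n 0 w t\<bar> \<le> \<epsilon> \<and> \<bar>grad n 0 w t $ 1\<bar> \<le> \<epsilon> \<and> \<bar>grad n 0 w t $ 2\<bar> \<le> \<epsilon>}
    \<le> exp (3 / 2) / (sqrt 2 * pi)\<^sup>2 * \<epsilon> ^ 3"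
  using assms by (intro small_ball field_gradient_char) auto

text \<open>If the field and its gradient are both small at some point, they are small at the nearest point of a
grid of width comparable to the smallness \<open>m\<close>. There are of order \<open>m\<^sup>-\<^sup>2\<close> grid points, and each of them is
exceptional with a probability of order \<open>m\<^sup>3\<close>.\<close>
lemma field_nondegenerate_probability:
  assumes R: "R > 0" and B: "B > 0" and \<eta>: "\<eta> > 0"
  shows "\<exists>m>0. \<forall>n. n > 0 \<longrightarrow> freqs n \<noteq> {} \<longrightarrow> (\<exists>E\<in>sets M. prob E \<le> \<eta> \<and>
    (\<forall>w\<in>space M - E. tame (2 * R) B (field n 0 w) (grad n 0 w) \<longrightarrow>
      (\<forall>p\<in>cball 0 R. \<bar>field n 0 w p\<bar> < m \<longrightarrow> m \<le> norm (grad n 0 w p))))"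
proof -
  define C where "C = exp (3 / 2) / (sqrt 2 * pi)\<^sup>2"
  have C: "C > 0" by (simp add: C_def)
  define A where "A = 9 * C * ((1 + 2 * B) * R) ^ 3"
  have A: "A > 0" using B C R by (simp add: A_def)
  obtain k :: nat where k: "A / \<eta> < real k" using reals_Archimedean2 by blast
  have "A / \<eta> > 0" using A \<eta> by simp
  then have k0: "k > 0" using k by (cases k) auto
  define m where "m = R / real k"
  have m: "m > 0" using R k0 by (simp add: m_def)
  \<comment> \<open>Smallness at a grid point that follows from smallness \<open>m\<close> at distance at most \<open>2 * m\<close>.\<close>
  define \<epsilon> where "\<epsilon> = (1 + 2 * B) * m"
  have \<epsilon>: "\<epsilon> > 0" using m B by (simp add: \<epsilon>_def)
  let ?I = "{- int k..int k} \<times> {- int k..int k}"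
  define x where "x ij = ((\<chi> c. if c = 1 then real_of_int (fst ij) * m else real_of_int (snd ij) * m) :: real ^ 2)"
    for ij :: "int \<times> int"
  show ?thesis
  proof (intro exI[of _ m] conjI[OF m] allI impI)
    fix n :: nat assume n: "n > 0" "freqs n \<noteq> {}"
    define F where "F ij = {w \<in> space M. \<bar>field n 0 w (x ij)\<bar> \<le> \<epsilon> \<and> \<bar>grad n 0 w (x ij) $ 1\<bar> \<le> \<epsilon> \<and> \<bar>grad n 0 w (x ij) $ 2\<bar> \<le> \<epsilon>}" for ij
    have F: "F ij \<in> sets M" for ij
      unfolding F_def using field_measurable[OF n(1)] grad_measurable[OF n(1)] by measurable
    define E where "E = (\<Union>ij\<in>?I. F ij)"
    have E: "E \<in> sets M" unfolding E_def using F by (intro sets.finite_UN) auto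
    have "prob E \<le> (\<Sum>ij\<in>?I. prob (F ij))"
      unfolding E_def using F by (intro finite_measure_subadditive_finite) auto
    also have "\<dots> \<le> (\<Sum>ij\<in>?I. C * \<epsilon> ^ 3)"
      unfolding F_def C_def by (intro sum_mono field_small_ball n \<epsilon>)
    also have "\<dots> = real (2 * k + 1) ^ 2 * (C * \<epsilon> ^ 3)"
    proof -
      have "nat (1 + 2 * int k) = 2 * k + 1" by simp
      then show ?thesis by (simp add: card_cartesian_product power2_eq_square algebra_simps)
    qed
    also have "\<dots> \<le> (3 * real k) ^ 2 * (C * \<epsilon> ^ 3)"
      using k0 C \<epsilon> by (intro mult_right_mono power_mono) auto
    also have "\<dots> = A / real k"
    proof -
      have "\<epsilon> = (1 + 2 * B) * R / real k" by (simp add: \<epsilon>_def m_def)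
      then have "\<epsilon> ^ 3 = ((1 + 2 * B) * R) ^ 3 / real k ^ 3" by (simp add: power_divide)
      then show ?thesis using k0 by (simp add: A_def power2_eq_square power3_eq_cube)
    qed
    also have "\<dots> \<le> \<eta>" using k k0 \<eta> by (simp add: field_simps)
    finally have pE: "prob E \<le> \<eta>" .
    show "\<exists>E\<in>sets M. prob E \<le> \<eta> \<and> (\<forall>w\<in>space M - E. tame (2 * R) B (field n 0 w) (grad n 0 w) \<longrightarrow>
      (\<forall>p\<in>cball 0 R. \<bar>field n 0 w p\<bar> < m \<longrightarrow> m \<le> norm (grad n 0 w p)))"
    proof (intro bexI[OF _ E] conjI[OF pE] ballI impI)
      fix w p
      assume w: "w \<in> space M - E" and t: "tame (2 * R) B (field n 0 w) (grad n 0 w)"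
        and p: "p \<in> cball 0 R" and fp: "\<bar>field n 0 w p\<bar> < m"
      show "m \<le> norm (grad n 0 w p)"
      proof (rule ccontr)
        assume "\<not> m \<le> norm (grad n 0 w p)"
        then have gp: "norm (grad n 0 w p) < m" by simp
        define ij where "ij = (\<lfloor>p $ 1 / m\<rfloor>, \<lfloor>p $ 2 / m\<rfloor>)"
        have Rm: "R = real k * m" using k0 by (simp add: m_def)
        have comp: "\<lfloor>p $ c / m\<rfloor> \<in> {- int k..int k}" "\<bar>real_of_int \<lfloor>p $ c / m\<rfloor> * m - p $ c\<bar> \<le> m" for c
        proof -
          have "\<bar>p $ c\<bar> \<le> real k * m" using component_le_norm_cart[of p c] p Rm by simp
          then have "- real k \<le> p $ c / m" "p $ c / m \<le> real k"
            using m by (auto simp: field_simps abs_le_iff)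
          then show "\<lfloor>p $ c / m\<rfloor> \<in> {- int k..int k}" by (auto simp: le_floor_iff floor_le_iff)
          have "\<bar>real_of_int \<lfloor>p $ c / m\<rfloor> - p $ c / m\<bar> \<le> 1" by linarith
          then have "\<bar>real_of_int \<lfloor>p $ c / m\<rfloor> - p $ c / m\<bar> * m \<le> 1 * m" using m by (intro mult_right_mono) auto
          moreover have "(real_of_int \<lfloor>p $ c / m\<rfloor> - p $ c / m) * m = real_of_int \<lfloor>p $ c / m\<rfloor> * m - p $ c"
            unfolding left_diff_distrib using m by simp
          then have "\<bar>real_of_int \<lfloor>p $ c / m\<rfloor> - p $ c / m\<bar> * m = \<bar>real_of_int \<lfloor>p $ c / m\<rfloor> * m - p $ c\<bar>"
            using abs_mult[of "real_of_int \<lfloor>p $ c / m\<rfloor> - p $ c / m" m] m by (simp only: abs_of_pos)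
          ultimately show "\<bar>real_of_int \<lfloor>p $ c / m\<rfloor> * m - p $ c\<bar> \<le> m" by simp
        qed
        have ijI: "ij \<in> ?I" using comp(1)[of 1] comp(1)[of 2] by (simp add: ij_def)
        let ?x = "x ij"
        have "norm (?x - p) \<le> 2 * m"
          using norm_vec2_le[of "?x - p"] comp(2)[of 1] comp(2)[of 2] by (simp add: x_def ij_def)
        then have xp: "dist ?x p \<le> 2 * m" by (simp add: dist_norm)
        have le_k: "\<bar>real_of_int i * m\<bar> \<le> R" if "i \<in> {- int k..int k}" for i
        proof -
          have "\<bar>real_of_int i\<bar> \<le> real k" using that by auto
          then have "\<bar>real_of_int i\<bar> * m \<le> real k * m" using m by (intro mult_right_mono) auto
          then show ?thesis using m Rm by (simp add: abs_mult)
        qed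
        have xb: "?x \<in> cball 0 (2 * R)"
          using norm_vec2_le[of ?x] le_k[of "fst ij"] le_k[of "snd ij"] ijI by (auto simp: x_def)
        have pb: "p \<in> cball 0 (2 * R)" using p R by simp
        have "norm (grad n 0 w ?x - grad n 0 w p) \<le> B * dist ?x p" by (rule tameD(3)[OF t xb pb])
        also have "\<dots> \<le> B * (2 * m)" using xp B by (intro mult_left_mono) auto
        finally have "norm (grad n 0 w ?x - grad n 0 w p) \<le> B * (2 * m)" .
        then have "norm (grad n 0 w ?x) \<le> \<epsilon>"
          using gp norm_triangle_ineq2[of "grad n 0 w ?x" "grad n 0 w p"] by (simp add: \<epsilon>_def algebra_simps)
        then have gx: "\<bar>grad n 0 w ?x $ c\<bar> \<le> \<epsilon>" for c
          using component_le_norm_cart[of "grad n 0 w ?x" c] by linarith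
        obtain s where s: "0 < s" "s < 1"
          and eq: "field n 0 w ?x - field n 0 w p = grad n 0 w (p + s *\<^sub>R (?x - p)) \<bullet> (?x - p)"
          by (rule mvt_along_line[OF field_has_derivative])
        have "p + s *\<^sub>R (?x - p) \<in> cball 0 (2 * R)" using s pb xb by (intro segment_in_cball) auto
        then have "norm (grad n 0 w (p + s *\<^sub>R (?x - p))) \<le> B" by (rule tameD(2)[OF t])
        then have "\<bar>field n 0 w ?x - field n 0 w p\<bar> \<le> B * (2 * m)"
          unfolding eq using xp B
          by (intro order_trans[OF Cauchy_Schwarz_ineq2] mult_mono) (auto simp: dist_norm)
        then have "\<bar>field n 0 w ?x\<bar> \<le> \<epsilon>" using fp by (simp add: \<epsilon>_def algebra_simps)
        then have "w \<in> F ij" using gx w by (simp add: F_def)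
        then show False using w ijI by (auto simp: E_def)
      qed
    qed
  qed
qed

end

section \<open>Almost periods and convergence in distribution\<close>

lemma along_enumerate:
  assumes "infinite S'" and "\<forall>\<^sub>F n in along S'. P n"
  shows "\<forall>\<^sub>F k in sequentially. P (enumerate S' k)"
proof -
  have "\<forall>\<^sub>F n in sequentially. n \<in> S' \<longrightarrow> P n"
    using assms(2) by (simp add: along_def eventually_inf_principal)
  then obtain N where N: "\<And>n. n \<ge> N \<Longrightarrow> n \<in> S' \<Longrightarrow> P n" by (auto simp: eventually_sequentially)
  have "P (enumerate S' k)" if "k \<ge> N" for k
    using that le_enumerate[OF assms(1), of k] enumerate_in_set[OF assms(1), of k] by (intro N) auto
  then show ?thesis by (auto simp: eventually_sequentially)
qed

text \<open>A finite set has density 0 in the sums of two squares, as these contain all squares.\<close>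
lemma relative_density_one_infinite:
  assumes "relative_density_one S' sums_of_two_squares"
  shows "infinite S'"
proof
  assume fin: "finite S'"
  let ?S = sums_of_two_squares
  have lim: "(\<lambda>x. real (card (S' \<inter> {..x})) / real (card (?S \<inter> {..x}))) \<longlonglongrightarrow> 1"
    using assms by (simp add: relative_density_one_def)
  have "strict_mono (\<lambda>m :: nat. m ^ 2)" by (auto simp: strict_mono_def power_strict_mono)
  from LIMSEQ_subseq_LIMSEQ[OF lim this]
  have lim1: "(\<lambda>m. real (card (S' \<inter> {..m ^ 2})) / real (card (?S \<inter> {..m ^ 2}))) \<longlonglongrightarrow> 1" by (simp add: comp_def)
  have card: "m + 1 \<le> card (?S \<inter> {..m ^ 2})" for m
  proof -
    have "(\<lambda>i. i ^ 2) ` {..m} \<subseteq> ?S \<inter> {..m ^ 2}"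
    proof (rule image_subsetI)
      fix i assume "i \<in> {..m}"
      then have "i ^ 2 \<le> m ^ 2" by (simp add: power_mono)
      moreover have "int (i ^ 2) = (int i)\<^sup>2 + 0\<^sup>2" by simp
      then have "i ^ 2 \<in> ?S" unfolding sums_of_two_squares_def by blast
      ultimately show "i ^ 2 \<in> ?S \<inter> {..m ^ 2}" by simp
    qed
    then have "card ((\<lambda>i. i ^ 2) ` {..m}) \<le> card (?S \<inter> {..m ^ 2})" by (intro card_mono) auto
    moreover have "card ((\<lambda>i :: nat. i ^ 2) ` {..m}) = m + 1"
      by (subst card_image) (auto simp: inj_on_def power2_eq_iff_nonneg)
    ultimately show ?thesis by simp
  qed
  have upper: "real (card (S' \<inter> {..m ^ 2})) / real (card (?S \<inter> {..m ^ 2})) \<le> real (card S') / real (m + 1)" for m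
    using card[of m] fin by (intro frac_le) (auto intro!: card_mono simp: of_nat_le_iff simp del: of_nat_Suc)
  have "(\<lambda>m. real (card S') * (1 / real (Suc m))) \<longlonglongrightarrow> real (card S') * 0"
    by (intro tendsto_mult tendsto_const LIMSEQ_Suc[OF lim_1_over_n])
  then have z: "(\<lambda>m. real (card S') / real (m + 1)) \<longlonglongrightarrow> 0" by simp
  have "(\<lambda>m. real (card (S' \<inter> {..m ^ 2})) / real (card (?S \<inter> {..m ^ 2}))) \<longlonglongrightarrow> 0"
    by (intro tendsto_sandwich[OF _ _ tendsto_const z] always_eventually allI upper) simp
  from LIMSEQ_unique[OF lim1 this] show False by simp
qed

lemma freqs_nonempty: "n \<in> sums_of_two_squares \<Longrightarrow> freqs n \<noteq> {}"
proof -
  assume "n \<in> sums_of_two_squares"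
  then obtain a b :: int where "int n = a\<^sup>2 + b\<^sup>2" by (auto simp: sums_of_two_squares_def)
  then have "(\<chi> i. if i = 1 then a else b) \<in> freqs n" by (simp add: freqs_def)
  then show ?thesis by blast
qed

text \<open>Convergence in probability, stated through exceptional events: this avoids discussing the
measurability of suprema and the integrability of the variables.\<close>
lemma (in prob_space) tendsto_0_in_distributionI:
  assumes meas: "\<forall>\<^sub>F k in sequentially. X (enumerate S' k) \<in> borel_measurable M"
    and small: "\<And>\<epsilon> \<eta>. \<epsilon> > 0 \<Longrightarrow> \<eta> > 0 \<Longrightarrow> \<forall>\<^sub>F k in sequentially. \<exists>E\<in>sets M. prob E \<le> \<eta> \<and>
      (\<forall>w\<in>space M - E. \<bar>X (enumerate S' k) w\<bar> \<le> \<epsilon>)"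
  shows "tendsto_0_in_distribution M S' X"
  unfolding tendsto_0_in_distribution_def weak_conv_m_def weak_conv_def
proof (intro allI impI)
  fix x :: real assume cont: "isCont (cdf (return borel 0)) x"
  let ?Y = "\<lambda>k. X (enumerate S' k)"
  have cdf0: "cdf (return borel 0) y = (if 0 \<le> y then 1 else 0)" for y :: real
    by (simp add: cdf_def measure_return indicator_def)
  \<comment> \<open>The limiting distribution function jumps at 0, so this point is exempt.\<close>
  have "x \<noteq> 0"
  proof
    assume "x = 0"
    have "(\<lambda>k. - (1 / real (Suc k))) \<longlonglongrightarrow> - 0"
      by (intro tendsto_minus LIMSEQ_Suc[OF lim_1_over_n])
    then have "(\<lambda>k. cdf (return borel 0) (- (1 / real (Suc k)))) \<longlonglongrightarrow> cdf (return borel 0) x"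
      using cont \<open>x = 0\<close> by (intro isCont_tendsto_compose[OF cont]) simp
    moreover have "(\<lambda>k. cdf (return borel 0) (- (1 / real (Suc k)))) = (\<lambda>k. 0)"
      by (simp add: cdf0 fun_eq_iff)
    ultimately have "cdf (return borel 0) x = 0" using LIMSEQ_unique tendsto_const by metis
    then show False using \<open>x = 0\<close> by (simp add: cdf0)
  qed
  show "(\<lambda>k. cdf (distr M borel (?Y k)) x) \<longlonglongrightarrow> cdf (return borel 0) x"
  proof (rule tendstoI)
    fix e :: real assume e: "e > 0"
    have "\<bar>x\<bar> / 2 > 0" "e / 2 > 0" using \<open>x \<noteq> 0\<close> e by auto
    from small[OF this] meas
    show "\<forall>\<^sub>F k in sequentially. dist (cdf (distr M borel (?Y k)) x) (cdf (return borel 0) x) < e"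
    proof eventually_elim
      case (elim k)
      then obtain E where E: "E \<in> sets M" "prob E \<le> e / 2" "\<And>w. w \<in> space M - E \<Longrightarrow> \<bar>?Y k w\<bar> \<le> \<bar>x\<bar> / 2" by blast
      note [measurable] = elim(2)
      have cdfk: "cdf (distr M borel (?Y k)) x = prob {w \<in> space M. ?Y k w \<le> x}"
        by (simp add: cdf_def measure_distr vimage_def Int_def conj_commute)
      have m: "{w \<in> space M. ?Y k w \<le> x} \<in> sets M" by measurable
      show ?case
      proof (cases "x > 0")
        case True
        have "space M - E \<subseteq> {w \<in> space M. ?Y k w \<le> x}"
        proof
          fix w assume w: "w \<in> space M - E"
          then show "w \<in> {w \<in> space M. ?Y k w \<le> x}" using E(3)[OF w] True by auto
        qed
        then have "prob (space M - E) \<le> prob {w \<in> space M. ?Y k w \<le> x}" by (rule finite_measure_mono[OF _ m])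
        then have "1 - e / 2 \<le> prob {w \<in> space M. ?Y k w \<le> x}" using E(2) prob_compl[OF E(1)] by linarith
        then show ?thesis using True e prob_le_1[of "{w \<in> space M. ?Y k w \<le> x}"]
          by (simp add: cdfk cdf0 dist_real_def)
      next
        case False
        then have xneg: "x < 0" using \<open>x \<noteq> 0\<close> by simp
        have "{w \<in> space M. ?Y k w \<le> x} \<subseteq> E"
        proof
          fix w assume w: "w \<in> {w \<in> space M. ?Y k w \<le> x}"
          show "w \<in> E"
          proof (rule ccontr)
            assume "w \<notin> E"
            then have "\<bar>?Y k w\<bar> \<le> \<bar>x\<bar> / 2" using w by (intro E(3)) auto
            then show False using w xneg by auto
          qed
        qed
        then have "prob {w \<in> space M. ?Y k w \<le> x} \<le> prob E" by (rule finite_measure_mono[OF _ E(1)])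
        then have "prob {w \<in> space M. ?Y k w \<le> x} \<le> e / 2" using E(2) by linarith
        then show ?thesis using xneg e measure_nonneg[of M "{w \<in> space M. ?Y k w \<le> x}"]
          by (simp add: cdfk cdf0 dist_real_def)
      qed
    qed
  qed
qed

lemma trig_jointly_continuous: "continuous_on UNIV (\<lambda>(c, t). trig n c t)"
proof -
  have "continuous_on UNIV (\<lambda>p :: (int ^ 2 \<Rightarrow> complex) \<times> (real ^ 2). fst p l)" for l
    by (rule continuous_on_compose2[OF continuous_on_product_coordinates continuous_on_fst[OF continuous_on_id]]) auto
  then show ?thesis
    unfolding trig_def case_prod_beta' divide_inverse
    by (intro continuous_intros)
qed

context random_wave
begin

lemma field_continuous: "continuous_on UNIV (field n \<tau> w)"
  by (intro continuous_at_imp_continuous_on ballI has_derivative_continuous[OF field_has_derivative])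

text \<open>The zero set depends on the sample only through finitely many coefficients, on which the wave depends
continuously. The coefficient with index 0 need not be measurable and is replaced by 0, like all
coefficients outside the circle.\<close>
lemma field_zero_integral_measurable:
  assumes n: "n > 0" and \<psi>: "continuous_on UNIV \<psi>"
    and supp: "\<And>x. \<psi> x > 0 \<Longrightarrow> x \<in> cball 0 R"
  shows "(\<lambda>w. H1_integral \<psi> {t. field n \<tau> w t = 0}) \<in> borel_measurable M"
proof -
  define c where "c w l = (if l \<in> freqs n then a l w * iexp (2 * pi * (lat l \<bullet> \<tau>)) else 0)" for w l
  have "(\<lambda>w. c w l) \<in> borel_measurable M" for l
  proof (cases "l \<in> freqs n")
    case True
    have [measurable]: "a l \<in> borel_measurable M" by (rule a_measurable[OF freqs_nonzero[OF n True]])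
    show ?thesis using True by (simp add: c_def)
  qed (simp add: c_def)
  then have [measurable]: "c \<in> borel_measurable M" by (rule measurable_coordinatewise_then_product)
  have [measurable]: "(\<lambda>c. H1_integral \<psi> {t. trig n c t = 0}) \<in> borel_measurable borel"
    by (rule H1_integral_of_zero_set_measurable[OF trig_jointly_continuous \<psi> supp])
  have "(\<lambda>w. H1_integral \<psi> {t. trig n (c w) t = 0}) \<in> borel_measurable M" by measurable
  also have "?this \<longleftrightarrow> ?thesis"
  proof (intro measurable_cong arg_cong[where f = "H1_integral \<psi>"] Collect_cong)
    fix w t assume w: "w \<in> space M"
    have "trig n (c w) t = trig n (\<lambda>l. a l w * iexp (2 * pi * (lat l \<bullet> \<tau>))) t"
      unfolding trig_def c_def by simp
    also have "\<dots> = of_real (field n \<tau> w t)"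
      unfolding field_def by (subst (1 2) trig_real[OF n w]) (auto simp: lat_uminus exp_cnj)
    finally show "trig n (c w) t = 0 \<longleftrightarrow> field n \<tau> w t = 0" by simp
  qed
  finally show ?thesis .
qed

lemma field_signed_integral_measurable:
  assumes n: "n > 0" and \<phi>: "continuous_on UNIV \<phi>" and supp: "\<And>x. \<phi> x \<noteq> 0 \<Longrightarrow> x \<in> cball 0 R"
  shows "(\<lambda>w. signed_integral \<phi> {t. field n \<tau> w t = 0}) \<in> borel_measurable M"
proof -
  have [measurable]: "(\<lambda>w. H1_integral (\<lambda>x. max 0 (\<phi> x)) {t. field n \<tau> w t = 0}) \<in> borel_measurable M"
    "(\<lambda>w. H1_integral (\<lambda>x. max 0 (- \<phi> x)) {t. field n \<tau> w t = 0}) \<in> borel_measurable M"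
    using \<phi> by (intro field_zero_integral_measurable[OF n, where R = R] supp continuous_intros; auto)+
  show ?thesis unfolding signed_integral_def by measurable
qed

text \<open>Almost sure convergence implies convergence in probability; by continuity of the field the
exceptional event is determined by a countable dense set of points and is therefore measurable.\<close>
lemma field_almost_period_probability:
  assumes inf: "infinite S'" and ap: "almost_periods M a S' \<tau>" and \<delta>: "\<delta> > 0" and \<eta>: "\<eta> > 0"
  shows "\<forall>\<^sub>F k in sequentially. \<exists>E\<in>sets M. prob E \<le> \<eta> \<and>
    (\<forall>w\<in>space M - E. \<forall>t. \<bar>field (enumerate S' k) 0 w t - field (enumerate S' k) (\<tau> (enumerate S' k)) w t\<bar> \<le> \<delta>)"
proof -
  let ?n = "enumerate S'"
  let ?h = "\<lambda>k w t. \<bar>field (?n k) 0 w t - field (?n k) (\<tau> (?n k)) w t\<bar>"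
  have npos: "?n k > 0" if "k > 0" for k using le_enumerate[OF inf, of k] that by linarith
  obtain D :: "(real ^ 2) set" where D: "countable D" "\<And>X. open X \<Longrightarrow> X \<noteq> {} \<Longrightarrow> \<exists>d\<in>D. d \<in> X"
    using countable_dense_exists by blast
  define E where "E k = {w \<in> space M. \<exists>t\<in>D. \<delta> < ?h k w t}" for k
  have E: "E k \<in> sets M" if "k > 0" for k
  proof -
    have [measurable]: "(\<lambda>w. field (?n k) \<sigma> w t) \<in> borel_measurable M" for \<sigma> t
      by (rule field_measurable[OF npos[OF that]])
    have "E k = (\<Union>t\<in>D. {w \<in> space M. \<delta> < ?h k w t})" by (auto simp: E_def)
    also have "\<dots> \<in> sets M" by (intro sets.countable_UN'[OF D(1)] image_subsetI) measurable
    finally show ?thesis .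
  qed
  have good: "?h k w t \<le> \<delta>" if "w \<in> space M - E k" for k w t
  proof (rule ccontr)
    assume "\<not> ?h k w t \<le> \<delta>"
    then have "t \<in> {t. \<delta> < ?h k w t}" by simp
    then have "{t. \<delta> < ?h k w t} \<noteq> {}" by blast
    moreover have "open {t. \<delta> < ?h k w t}"
      by (intro open_Collect_less continuous_intros field_continuous)
    ultimately obtain d where "d \<in> D" "\<delta> < ?h k w d" using D(2) by blast
    then show False using that by (auto simp: E_def)
  qed
  have "AE w in M. \<forall>\<^sub>F k in sequentially. w \<notin> E k"
  proof -
    have "AE w in M. ((\<lambda>n. SUP t. cmod (wave a n w (t + \<tau> n) - wave a n w t)) \<longlongrightarrow> 0) (along S')"
      using ap by (simp add: almost_periods_def)
    then show ?thesis
    proof eventually_elim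
      case (elim w)
      have "\<forall>\<^sub>F n in along S'. (SUP t. cmod (wave a n w (t + \<tau> n) - wave a n w t)) < \<delta>"
        using elim \<delta> by (rule order_tendstoD(2))
      then have "\<forall>\<^sub>F k in sequentially. (SUP t. cmod (wave a (?n k) w (t + \<tau> (?n k)) - wave a (?n k) w t)) < \<delta>"
        by (rule along_enumerate[OF inf])
      moreover have "\<forall>\<^sub>F k in sequentially. k > (0 :: nat)" by (rule eventually_gt_at_top)
      ultimately show ?case
      proof eventually_elim
        case (elim k)
        let ?m = "?n k"
        define d where "d t = cmod (wave a ?m w (t + \<tau> ?m) - wave a ?m w t)" for t
        define b where "b = (\<Sum>l\<in>freqs ?m. cmod (a l w)) / sqrt (real (num_freqs ?m))"
        have wb: "cmod (wave a ?m w t) \<le> b" for t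
        proof -
          have "cmod (\<Sum>l\<in>freqs ?m. a l w * exp (2 * \<i> * complex_of_real pi * complex_of_real (lat l \<bullet> t)))
              \<le> (\<Sum>l\<in>freqs ?m. cmod (a l w))"
            by (rule sum_norm_le) (simp add: norm_mult)
          then show ?thesis unfolding wave_def b_def by (simp add: norm_divide divide_right_mono)
        qed
        have "bdd_above (range d)"
        proof (rule bdd_aboveI2)
          show "d t \<le> b + b" for t
            unfolding d_def using norm_triangle_ineq4[of "wave a ?m w (t + \<tau> ?m)" "wave a ?m w t"]
              wb[of "t + \<tau> ?m"] wb[of t] by linarith
        qed
        then have "d t \<le> (SUP t. d t)" for t by (rule cSUP_upper[OF UNIV_I])
        moreover have "(SUP t. d t) < \<delta>" using elim(1) by (simp add: d_def)
        ultimately have dl: "d t < \<delta>" for t by (rule order.strict_trans1)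
        show "w \<notin> E k"
        proof
          assume "w \<in> E k"
          then obtain t where w: "w \<in> space M" and t: "\<delta> < ?h k w t" by (auto simp: E_def)
          let ?s = "t /\<^sub>R sqrt (real ?m)"
          have "d ?s = cmod (wave a ?m w (\<tau> ?m + ?s) - wave a ?m w (0 + ?s))"
            by (simp add: d_def add.commute)
          also have "\<dots> = cmod (of_real (field ?m (\<tau> ?m) w t - field ?m 0 w t))"
            by (simp only: wave_eq_field[OF npos[OF elim(2)] w] of_real_diff)
          also have "\<dots> = ?h k w t" by (simp only: norm_of_real abs_minus_commute)
          finally show False using t dl[of ?s] by simp
        qed
      qed
    qed
  qed
  \<comment> \<open>The shift by one avoids the energy \<open>0\<close>, where the wave need not be measurable.\<close>
  have "(\<lambda>k. expectation (indicator (E (Suc k)) :: 'w \<Rightarrow> real)) \<longlonglongrightarrow> expectation (\<lambda>w. 0 :: real)"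
  proof (rule integral_dominated_convergence[where w = "\<lambda>_. 1"])
    show "AE w in M. (\<lambda>k. indicator (E (Suc k)) w :: real) \<longlonglongrightarrow> 0"
      using \<open>AE w in M. \<forall>\<^sub>F k in sequentially. w \<notin> E k\<close>
    proof eventually_elim
      case (elim w)
      then have "\<forall>\<^sub>F k in sequentially. w \<notin> E (Suc k)"
        by (simp only: eventually_sequentially_Suc[where P = "\<lambda>k. w \<notin> E k"])
      then have "\<forall>\<^sub>F k in sequentially. (indicator (E (Suc k)) w :: real) = 0"
        by (rule eventually_mono) simp
      then show ?case by (rule tendsto_eventually)
    qed
    show "indicator (E (Suc k)) \<in> borel_measurable M" for k
      using E[of "Suc k"] by (intro borel_measurable_indicator) auto
    show "AE w in M. norm (indicator (E (Suc k)) w :: real) \<le> 1" for k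
      by (auto simp: indicator_def)
  qed auto
  then have "(\<lambda>k. prob (E (Suc k))) \<longlonglongrightarrow> 0"
    using E by simp
  then have "\<forall>\<^sub>F k in sequentially. prob (E (Suc k)) < \<eta>" using \<eta> by (rule order_tendstoD(2))
  then have "\<forall>\<^sub>F k in sequentially. prob (E k) < \<eta>"
    by (simp only: eventually_sequentially_Suc[where P = "\<lambda>k. prob (E k) < \<eta>"])
  moreover have "\<forall>\<^sub>F k in sequentially. k > (0 :: nat)" by (rule eventually_gt_at_top)
  ultimately show ?thesis
  proof eventually_elim
    case (elim k)
    show ?case
      by (rule bexI[OF _ E[OF elim(2)]]) (use elim(1) good in auto)
  qed
qed

end

theorem theorem2p3:
  fixes M :: "'w measure" and a :: "int ^ 2 \<Rightarrow> 'w \<Rightarrow> complex"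
    and S' :: "nat set" and \<tau> :: "nat \<Rightarrow> real ^ 2" and \<alpha> \<kappa> :: real
    and \<Omega> :: "(real ^ 2) set" and \<phi> :: "real ^ 2 \<Rightarrow> real"
  assumes "admissible_energies S'"
    and "wave_coefficients M a"
    and "almost_periods M a S' \<tau>"
    and "\<alpha> > 0" and "\<kappa> > 0"
    and "\<forall>\<^sub>F n in along S'.
           torus_norm (\<tau> n) \<le> exp (real (num_freqs n) powr (1 + \<alpha>)) / sqrt (real n)"
    and "\<forall>\<^sub>F n in along S'.
           (SUP t. \<bar>wave_cov n (t + \<tau> n) - wave_cov n t\<bar>) \<le> exp (- (ln (real n) powr \<kappa>))"
    and "open \<Omega>" and "convex \<Omega>" and "compact (closure \<Omega>)" and "C1_boundary \<Omega>"
    and "continuous_on UNIV \<phi>" and "closure {t. \<phi> t \<noteq> 0} \<subseteq> \<Omega>"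
  shows "tendsto_0_in_distribution M S' (\<lambda>n w.
           (LINT t:nodal_set (rescaled_wave a n w) \<Omega>|H1. \<phi> t)
         - (LINT t:nodal_set (rescaled_translated_wave a \<tau> n w) \<Omega>|H1. \<phi> t))"
proof -
  interpret random_wave M a
    using assms(2) by (auto simp: random_wave_def random_wave_axioms_def wave_coefficients_def)
  have dens: "relative_density_one S' sums_of_two_squares"
    using assms(1) by (simp add: admissible_energies_def)
  have inf: "infinite S'" by (rule relative_density_one_infinite[OF dens])
  have sub: "S' \<subseteq> sums_of_two_squares" using dens by (simp add: relative_density_one_def)
  have supp: "\<phi> x = 0" if "x \<notin> \<Omega>" for x
    using that assms(13) closure_subset[of "{t. \<phi> t \<noteq> 0}"] by blast
  obtain R where R: "R > 0" "\<Omega> \<subseteq> cball 0 R"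
  proof -
    have "bounded \<Omega>" using assms(10) by (meson bounded_closure_image bounded_subset closure_subset compact_imp_bounded)
    then obtain b where "b > 0" "\<forall>x\<in>\<Omega>. norm x \<le> b" unfolding bounded_pos by blast
    then show ?thesis using that by (metis mem_cball_0 subsetI)
  qed
  have suppR: "x \<in> cball 0 R" if "\<phi> x \<noteq> 0" for x using that supp[of x] R(2) by blast
  define L where "L n \<sigma> w = signed_integral \<phi> {t. field n \<sigma> w t = 0}" for n \<sigma> w
  let ?X = "\<lambda>n w. (LINT t:nodal_set (rescaled_wave a n w) \<Omega>|H1. \<phi> t)
         - (LINT t:nodal_set (rescaled_translated_wave a \<tau> n w) \<Omega>|H1. \<phi> t)"
  have X: "?X n w = L n 0 w - L n (\<tau> n) w" if n: "n > 0" and w: "w \<in> space M" for n w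
  proof -
    have "(LINT t:{t. field n \<sigma> w t = 0} \<inter> \<Omega>|H1. \<phi> t) = L n \<sigma> w" for \<sigma>
      unfolding L_def
      by (intro set_integral_eq_signed_integral assms(12) supp closed_Collect_eq continuous_on_const field_continuous)
    moreover have "rescaled_wave a n w t = of_real (field n 0 w t)" for t
      using wave_eq_field[OF n w, of 0 t] by (simp add: rescaled_wave_def)
    then have "nodal_set (rescaled_wave a n w) \<Omega> = {t. field n 0 w t = 0} \<inter> \<Omega>"
      by (auto simp: nodal_set_def)
    moreover have "rescaled_translated_wave a \<tau> n w t = of_real (field n (\<tau> n) w t)" for t
      using wave_eq_field[OF n w, of "\<tau> n" t] by (simp add: rescaled_translated_wave_def translated_wave_def)
    then have "nodal_set (rescaled_translated_wave a \<tau> n w) \<Omega> = {t. field n (\<tau> n) w t = 0} \<inter> \<Omega>"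
      by (auto simp: nodal_set_def)
    ultimately show ?thesis by (simp only:)
  qed
  have npos: "enumerate S' k > 0" if "k > 0" for k using le_enumerate[OF inf, of k] that by linarith
  have nne: "freqs (enumerate S' k) \<noteq> {}" for k
    using enumerate_in_set[OF inf, of k] sub by (intro freqs_nonempty) auto
  have ev0: "\<forall>\<^sub>F k in sequentially. k > (0 :: nat)" by (rule eventually_gt_at_top)
  show ?thesis
  proof (rule tendsto_0_in_distributionI)
    show "\<forall>\<^sub>F k in sequentially. ?X (enumerate S' k) \<in> borel_measurable M"
      using ev0
    proof eventually_elim
      case (elim k)
      note n = npos[OF elim]
      let ?n = "enumerate S' k"
      have [measurable]: "L ?n \<sigma> \<in> borel_measurable M" for \<sigma>
        unfolding L_def by (rule field_signed_integral_measurable[OF n assms(12) suppR])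
      have "(\<lambda>w. L ?n 0 w - L ?n (\<tau> ?n) w) \<in> borel_measurable M" by measurable
      also have "?this \<longleftrightarrow> ?case"
        by (intro measurable_cong X[OF n, symmetric])
      finally show ?case .
    qed
  next
    fix \<epsilon> \<eta> :: real assume \<epsilon>: "\<epsilon> > 0" and \<eta>: "\<eta> > 0"
    have e4: "\<eta> / 4 > 0" using \<eta> by auto
    \<comment> \<open>Large enough for the nondegeneracy on the disc of radius \<open>R + 1\<close> and for the perturbation.\<close>
    define R2 where "R2 = 2 * (R + 1) + 3"
    have R2: "R2 \<ge> 0" "R + 3 \<le> R2" "2 * (R + 1) \<le> R2" using R(1) by (auto simp: R2_def)
    obtain B where B: "B > 0" and tameE: "\<And>n \<sigma>. n > 0 \<Longrightarrow> \<exists>E\<in>sets M. prob E \<le> \<eta> / 4 \<and>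
        (\<forall>w\<in>space M - E. tame R2 B (field n \<sigma> w) (grad n \<sigma> w))"
      using field_tame_probability[OF R2(1) e4] by blast
    have "R + 1 > 0" using R(1) by simp
    then obtain m where m: "m > 0" and nondegE: "\<And>n. n > 0 \<Longrightarrow> freqs n \<noteq> {} \<Longrightarrow> \<exists>E\<in>sets M. prob E \<le> \<eta> / 4 \<and>
        (\<forall>w\<in>space M - E. tame (2 * (R + 1)) B (field n 0 w) (grad n 0 w) \<longrightarrow>
        (\<forall>p\<in>cball 0 (R + 1). \<bar>field n 0 w p\<bar> < m \<longrightarrow> m \<le> norm (grad n 0 w p)))"
      using field_nondegenerate_probability[OF _ B e4, of "R + 1"] by blast
    obtain \<delta> where \<delta>: "\<delta> > 0" and stable: "\<And>f g. perturbation R B m \<delta> f g \<Longrightarrow>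
       \<bar>signed_integral \<phi> {x. f x = 0} - signed_integral \<phi> {x. g x = 0}\<bar> \<le> \<epsilon>"
      using signed_integral_stable[OF assms(12) _ B m \<epsilon>, of R] suppR by blast
    show "\<forall>\<^sub>F k in sequentially. \<exists>E\<in>sets M. prob E \<le> \<eta> \<and>
      (\<forall>w\<in>space M - E. \<bar>?X (enumerate S' k) w\<bar> \<le> \<epsilon>)"
      using ev0 field_almost_period_probability[OF inf assms(3) \<delta> e4]
    proof eventually_elim
      case (elim k)
      let ?n = "enumerate S' k"
      note n = npos[OF elim(1)]
      obtain E1 where E1: "E1 \<in> sets M" "prob E1 \<le> \<eta> / 4"
        "\<forall>w\<in>space M - E1. \<forall>t. \<bar>field ?n 0 w t - field ?n (\<tau> ?n) w t\<bar> \<le> \<delta>" using elim(2) by blast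
      obtain E2 where E2: "E2 \<in> sets M" "prob E2 \<le> \<eta> / 4"
        "\<forall>w\<in>space M - E2. tame R2 B (field ?n 0 w) (grad ?n 0 w)" using tameE[OF n, of 0] by blast
      obtain E3 where E3: "E3 \<in> sets M" "prob E3 \<le> \<eta> / 4"
        "\<forall>w\<in>space M - E3. tame R2 B (field ?n (\<tau> ?n) w) (grad ?n (\<tau> ?n) w)" using tameE[OF n, of "\<tau> ?n"] by blast
      obtain E4 where E4: "E4 \<in> sets M" "prob E4 \<le> \<eta> / 4"
        "\<forall>w\<in>space M - E4. tame (2 * (R + 1)) B (field ?n 0 w) (grad ?n 0 w) \<longrightarrow>
        (\<forall>p\<in>cball 0 (R + 1). \<bar>field ?n 0 w p\<bar> < m \<longrightarrow> m \<le> norm (grad ?n 0 w p))" using nondegE[OF n nne] by blast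
      define E where "E = E1 \<union> E2 \<union> (E3 \<union> E4)"
      have E: "E \<in> sets M" using E1(1) E2(1) E3(1) E4(1) by (simp add: E_def)
      have "prob E \<le> prob (E1 \<union> E2) + prob (E3 \<union> E4)"
        unfolding E_def using E1(1) E2(1) E3(1) E4(1) by (intro measure_Un_le) auto
      also have "\<dots> \<le> (prob E1 + prob E2) + (prob E3 + prob E4)"
        using E1(1) E2(1) E3(1) E4(1) by (intro add_mono measure_Un_le)
      finally have pE: "prob E \<le> \<eta>" using E1(2) E2(2) E3(2) E4(2) by linarith
      have "\<bar>?X ?n w\<bar> \<le> \<epsilon>" if w: "w \<in> space M - E" for w
      proof -
        have wM: "w \<in> space M" and wE: "w \<in> space M - E1" "w \<in> space M - E2" "w \<in> space M - E3" "w \<in> space M - E4"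
          using w by (auto simp: E_def)
        have f: "tame (R + 3) B (field ?n 0 w) (grad ?n 0 w)"
          using E2(3) wE(2) R2(2) tame_mono by blast
        have g: "tame (R + 3) B (field ?n (\<tau> ?n) w) (grad ?n (\<tau> ?n) w)"
          using E3(3) wE(3) R2(2) tame_mono by blast
        have "tame (2 * (R + 1)) B (field ?n 0 w) (grad ?n 0 w)"
          using E2(3) wE(2) R2(3) tame_mono by blast
        then have nd: "\<forall>p\<in>cball 0 (R + 1). \<bar>field ?n 0 w p\<bar> < m \<longrightarrow> m \<le> norm (grad ?n 0 w p)"
          using E4(3) wE(4) by blast
        have c: "\<forall>x\<in>cball 0 (R + 3). \<bar>field ?n 0 w x - field ?n (\<tau> ?n) w x\<bar> \<le> \<delta>" using E1(3) wE(1) by blast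
        have "perturbation R B m \<delta> (field ?n 0 w) (field ?n (\<tau> ?n) w)"
          unfolding perturbation_def using f g nd c by blast
        then show ?thesis unfolding X[OF n wM] L_def by (rule stable)
      qed
      then show ?case using E pE by blast
    qed
  qed
qed

end
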